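(* Let $T>0$, $D=\mathbb{R}^d/\mathbb{Z}^d$, and let $P_0\in L^2(D,\mathbb{R}^d)$ be a divergence-free vector field of zero spatial mean. Then the concave maximization problem $$\mathcal{J}[P_0]=\sup_{(E,B)\in\mathcal{EB}_{2,\infty}}\;\Big(-K[E,B]-\int_{[0,T]\times D}P_0\cdot E\Big)$$ (where, less precisely, $K[E,B]=\frac12\int_{[0,T]\times D}E\cdot(\mathbb{I}_d+2B)^{-1}\cdot E$, and $\mathcal{EB}_{2,\infty}$ and $K$ are defined in the context) always admits a solution, i.e. the supremum is attained by some $(E,B)\in\mathcal{EB}_{2,\infty}$. In addition, $$0\le\mathcal{J}[P_0]\le Td\int_D|P_0|^2,$$ and any such solution $(E,B)$ satisfies $$\mathrm{spect}(B)\subset\Big[-\frac12,\frac{d-1}{2}\Big]\ \text{ a.e. in }[0,T]\times D,\qquad \int_{[0,T]\times D}|E|^2\le 4d^2T\int_D|P_0|^2,$$ and $B$ belongs to $C^{1/2}([0,T],C^1(D)'_{w*})$.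
   Context: Summation over repeated lower and upper indices is implied; $\partial^k=\delta^{kj}\partial_j$, $\bigtriangleup=\delta^{ij}\partial_i\partial_j$; $\mathbb{I}_d$ is the $d\times d$ identity matrix; $(-\bigtriangleup)^{-1}$ acts on zero-mean functions (or distributions) on the torus $D$. $P_0$ is regarded as a time-independent field on $[0,T]\times D$. The class $\mathcal{EB}_{2,\infty}$: the set of all pairs $(E,B)$ with $E\in L^2([0,T]\times D;\mathbb{R}^d)$ and $B\in L^\infty([0,T]\times D)$ valued in the symmetric $d\times d$ matrices, subject to the constraint $$B(T,\cdot)=0,\qquad \partial_tB_{ij}=\tfrac12(\partial_jE_i+\partial_iE_j)+\partial_i\partial_j(-\bigtriangleup)^{-1}\partial^kE_k,$$ understood in the weak sense: for all smooth functions $\zeta$ on $[0,T]$ vanishing at $t=0$ and all smooth functions $\psi$ on $D$ valued in the symmetric $d\times d$ matrices, $$\int_{[0,T]\times D}B_{ij}(t,x)\zeta'(t)\psi^{ij}(x)-E_k(t,x)\zeta(t)\left(\partial_j\psi^{kj}+\partial^k(-\bigtriangleup)^{-1}\partial_i\partial_j\psi^{ij}\right)(x)=0.$$ The functional $K$: for $(E,B)\in\mathcal{EB}_{2,\infty}$, $$K[E,B]=\sup_{M\ge Z\otimes Z}\;\frac12\int_{[0,T]\times D}2E_iZ^i-(\delta_{ij}+2B_{ij})M^{ij}\;\in[0,+\infty],$$ where the supremum is over all pairs $(Z,M)$ of continuous functions on $[0,T]\times D$, valued respectively in $\mathbb{R}^d$ and in the symmetric $d\times d$ matrices, with $M\ge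 Z\otimes Z$ pointwise in the sense of symmetric matrices. The statement $B\in C^{1/2}([0,T],C^1(D)'_{w*})$ means that (after modification on a null set of times) for every $C^1$ function $\psi$ on $D$ valued in the symmetric $d\times d$ matrices, the function $t\mapsto\int_DB_{ij}(t,\cdot)\psi^{ij}$ is Hölder continuous with exponent $1/2$ on $[0,T]$. *)

theory Defs
  imports "HOL-Analysis.Analysis"
begin

text \<open>
  The torus \<open>D = R^d / Z^d\<close> has dimension \<open>d = CARD('n)\<close>. Continuous and differentiable functions on
  \<open>D\<close> are \<open>Z^d\<close>-periodic functions on \<open>real^'n\<close>. Measurable functions on \<open>D\<close> matter only almost
  everywhere and are given by their restriction to the fundamental domain \<open>cbox 0 1 = [0,1]^d\<close>;
  their values elsewhere are irrelevant, so no periodicity is imposed. Elements of Lebesgue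
  spaces are given by Borel representatives.
\<close>

definition torus :: "(real^'n) measure" where
  "torus = restrict_space lborel (cbox 0 1)"

definition cylinder :: "real \<Rightarrow> (real \<times> (real^'n)) measure" where
  "cylinder T = restrict_space lborel {0..T} \<Otimes>\<^sub>M torus"

definition periodic :: "(real^'n \<Rightarrow> 'b) \<Rightarrow> bool" where
  "periodic f \<longleftrightarrow> (\<forall>x i. f (x + axis i 1) = f x)"


section \<open>Differentiable functions\<close>

primrec C_diff :: "nat \<Rightarrow> ('a::euclidean_space \<Rightarrow> 'b::real_normed_vector) \<Rightarrow> bool" where
  "C_diff 0 f \<longleftrightarrow> continuous_on UNIV f"
| "C_diff (Suc k) f \<longleftrightarrow> (\<forall>x. f differentiable (at x)) \<and>
     (\<forall>b\<in>Basis. C_diff k (\<lambda>x. frechet_derivative f (at x) b))"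

definition smooth :: "('a::euclidean_space \<Rightarrow> 'b::real_normed_vector) \<Rightarrow> bool" where
  "smooth f \<longleftrightarrow> (\<forall>k. C_diff k f)"

definition pd :: "'n \<Rightarrow> (real^'n \<Rightarrow> real) \<Rightarrow> real^'n \<Rightarrow> real" where
  "pd i f x = frechet_derivative f (at x) (axis i 1)"

definition laplacian :: "(real^'n \<Rightarrow> real) \<Rightarrow> real^'n \<Rightarrow> real" where
  "laplacian f x = (\<Sum>i\<in>UNIV. pd i (pd i f) x)"

text \<open>For smooth periodic \<open>f\<close> of zero mean, exactly one \<open>\<phi>\<close> satisfies the description below.\<close>

definition inv_neg_laplacian :: "(real^'n \<Rightarrow> real) \<Rightarrow> real^'n \<Rightarrow> real" where
  "inv_neg_laplacian f = (THE \<phi>. smooth \<phi> \<and> periodic \<phi> \<and> (\<integral>x. \<phi> x \<partial>torus) = 0 \<and>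
     (\<forall>x. - laplacian \<phi> x = f x))"


section \<open>Matrices\<close>

definition sym_mat :: "real^'n^'n \<Rightarrow> bool" where
  "sym_mat A \<longleftrightarrow> transpose A = A"

definition contract :: "real^'n^'n \<Rightarrow> real^'n^'n \<Rightarrow> real" where
  "contract A M = (\<Sum>i\<in>UNIV. \<Sum>j\<in>UNIV. A $ i $ j * M $ i $ j)"

definition tensor :: "real^'n \<Rightarrow> real^'n \<Rightarrow> real^'n^'n" where
  "tensor v w = (\<chi> i j. v $ i * w $ j)"

definition mat_ge :: "real^'n^'n \<Rightarrow> real^'n^'n \<Rightarrow> bool" where
  "mat_ge M N \<longleftrightarrow> (\<forall>v. v \<bullet> (N *v v) \<le> v \<bullet> (M *v v))"

text \<open>Only used for symmetric matrices, whose eigenvalues are all real.\<close>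

definition spect :: "real^'n^'n \<Rightarrow> real set" where
  "spect A = {c. \<exists>v. v \<noteq> 0 \<and> A *v v = c *\<^sub>R v}"


section \<open>The maximization problem\<close>

definition square_integrable :: "'a measure \<Rightarrow> ('a \<Rightarrow> real^'n) \<Rightarrow> bool" where
  "square_integrable \<mu> f \<longleftrightarrow> f \<in> borel_measurable \<mu> \<and> integrable \<mu> (\<lambda>x. (norm (f x))\<^sup>2)"

definition divergence_free :: "(real^'n \<Rightarrow> real^'n) \<Rightarrow> bool" where
  "divergence_free P \<longleftrightarrow> (\<forall>\<phi>. smooth \<phi> \<and> periodic \<phi> \<longrightarrow>
     (\<integral>x. (\<Sum>k\<in>UNIV. P x $ k * pd k \<phi> x) \<partial>torus) = 0)"

text \<open>
  The \<open>k\<close>-th component of the field against which \<open>E\<close> is tested: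
  \<open>\<partial>_j \<psi>^{kj} + \<partial>^k (-\<Delta>)^{-1} \<partial>_i \<partial>_j \<psi>^{ij}\<close>.
\<close>

definition dual_field :: "(real^'n \<Rightarrow> real^'n^'n) \<Rightarrow> 'n \<Rightarrow> real^'n \<Rightarrow> real" where
  "dual_field \<psi> k x = (\<Sum>j\<in>UNIV. pd j (\<lambda>y. \<psi> y $ k $ j) x) +
     pd k (inv_neg_laplacian (\<lambda>y. \<Sum>i\<in>UNIV. \<Sum>j\<in>UNIV. pd i (pd j (\<lambda>z. \<psi> z $ i $ j)) y)) x"

text \<open>
  Smooth functions of \<open>t\<close> on \<open>[0,T]\<close> are restrictions of smooth functions on the line. Since \<open>\<zeta>\<close> need
  not vanish at \<open>T\<close>, the weak equation contains the final condition \<open>B(T,\<cdot>) = 0\<close>.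
\<close>

definition EB_constraint ::
  "real \<Rightarrow> (real \<times> (real^'n) \<Rightarrow> real^'n) \<Rightarrow> (real \<times> (real^'n) \<Rightarrow> real^'n^'n) \<Rightarrow> bool" where
  "EB_constraint T E B \<longleftrightarrow>
     (\<forall>(\<zeta> :: real \<Rightarrow> real) (\<psi> :: real^'n \<Rightarrow> real^'n^'n).
        smooth \<zeta> \<and> \<zeta> 0 = 0 \<and> smooth \<psi> \<and> periodic \<psi> \<and> (\<forall>x. sym_mat (\<psi> x)) \<longrightarrow>
        (\<integral>(t, x). contract (B (t, x)) (\<psi> x) * deriv \<zeta> t
            - (\<Sum>k\<in>UNIV. E (t, x) $ k * \<zeta> t * dual_field \<psi> k x) \<partial>cylinder T) = 0)"

definition EB_class ::
  "real \<Rightarrow> ((real \<times> (real^'n) \<Rightarrow> real^'n) \<times> (real \<times> (real^'n) \<Rightarrow> real^'n^'n)) set" where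
  "EB_class T = {(E, B). square_integrable (cylinder T) E \<and>
     B \<in> borel_measurable (cylinder T) \<and>
     (\<exists>C. AE p in cylinder T. norm (B p) \<le> C) \<and>
     (AE p in cylinder T. sym_mat (B p)) \<and>
     EB_constraint T E B}"

definition K_admissible ::
  "real \<Rightarrow> ((real \<times> (real^'n) \<Rightarrow> real^'n) \<times> (real \<times> (real^'n) \<Rightarrow> real^'n^'n)) set" where
  "K_admissible T = {(Z, M).
     continuous_on ({0..T} \<times> UNIV) Z \<and> continuous_on ({0..T} \<times> UNIV) M \<and>
     (\<forall>t\<in>{0..T}. periodic (\<lambda>x. Z (t, x)) \<and> periodic (\<lambda>x. M (t, x))) \<and>
     (\<forall>p\<in>{0..T} \<times> UNIV. sym_mat (M p) \<and> mat_ge (M p) (tensor (Z p) (Z p)))}"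

definition K ::
  "real \<Rightarrow> (real \<times> (real^'n) \<Rightarrow> real^'n) \<Rightarrow> (real \<times> (real^'n) \<Rightarrow> real^'n^'n) \<Rightarrow> ereal" where
  "K T E B = (SUP (Z, M) \<in> K_admissible T.
     ereal (1/2 * (\<integral>p. 2 * (E p \<bullet> Z p) - contract (mat 1 + 2 *\<^sub>R B p) (M p) \<partial>cylinder T)))"

definition objective :: "real \<Rightarrow> (real^'n \<Rightarrow> real^'n) \<Rightarrow>
    (real \<times> (real^'n) \<Rightarrow> real^'n) \<Rightarrow> (real \<times> (real^'n) \<Rightarrow> real^'n^'n) \<Rightarrow> ereal" where
  "objective T P\<^sub>0 E B = - K T E B - ereal (\<integral>(t, x). P\<^sub>0 x \<bullet> E (t, x) \<partial>cylinder T)"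

definition J :: "real \<Rightarrow> (real^'n \<Rightarrow> real^'n) \<Rightarrow> ereal" where
  "J T P\<^sub>0 = (SUP (E, B) \<in> EB_class T. objective T P\<^sub>0 E B)"

definition is_solution :: "real \<Rightarrow> (real^'n \<Rightarrow> real^'n) \<Rightarrow>
    (real \<times> (real^'n) \<Rightarrow> real^'n) \<Rightarrow> (real \<times> (real^'n) \<Rightarrow> real^'n^'n) \<Rightarrow> bool" where
  "is_solution T P\<^sub>0 E B \<longleftrightarrow> (E, B) \<in> EB_class T \<and> objective T P\<^sub>0 E B = J T P\<^sub>0"

definition concave_problem :: "real \<Rightarrow> (real^'n \<Rightarrow> real^'n) \<Rightarrow> bool" where
  "concave_problem T P\<^sub>0 \<longleftrightarrow>
     (\<forall>(E, B) \<in> EB_class T. \<forall>(E', B') \<in> EB_class T. \<forall>u\<in>{0..1}.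
        let E'' = (\<lambda>p. (1 - u) *\<^sub>R E p + u *\<^sub>R E' p);
            B'' = (\<lambda>p. (1 - u) *\<^sub>R B p + u *\<^sub>R B' p)
        in (E'', B'') \<in> EB_class T \<and>
           ereal (1 - u) * objective T P\<^sub>0 E B + ereal u * objective T P\<^sub>0 E' B'
             \<le> objective T P\<^sub>0 E'' B'')"


section \<open>Regularity in time\<close>

definition holder_on :: "real \<Rightarrow> real set \<Rightarrow> (real \<Rightarrow> real) \<Rightarrow> bool" where
  "holder_on \<alpha> S g \<longleftrightarrow> (\<exists>C. \<forall>s\<in>S. \<forall>t\<in>S. \<bar>g s - g t\<bar> \<le> C * \<bar>s - t\<bar> powr \<alpha>)"

text \<open>
  \<open>B \<in> C^{1/2}([0,T], C^1(D)'_{w*})\<close>. \<open>B'\<close> is the modification of \<open>B\<close> on a null set of times, the same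
  for all \<open>\<psi>\<close>. Integrability of each \<open>B'(t,\<cdot>)\<close> makes the pairing with \<open>\<psi>\<close> meaningful at every time.
\<close>

definition holder_half_weak_star :: "real \<Rightarrow> (real \<times> (real^'n) \<Rightarrow> real^'n^'n) \<Rightarrow> bool" where
  "holder_half_weak_star T B \<longleftrightarrow>
     (\<exists>B'. (AE t in restrict_space lborel {0..T}. \<forall>x\<in>cbox 0 1. B' (t, x) = B (t, x)) \<and>
       (\<forall>t\<in>{0..T}. integrable torus (\<lambda>x. B' (t, x))) \<and>
       (\<forall>\<psi>. C_diff 1 \<psi> \<and> periodic \<psi> \<and> (\<forall>x. sym_mat (\<psi> x)) \<longrightarrow>
          holder_on (1/2) {0..T} (\<lambda>t. \<integral>x. contract (B' (t, x)) (\<psi> x) \<partial>torus)))"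

end

theory Submission
  imports Defs
begin

text \<open>
  The problem is solved by the direct method. Write \<open>d\<close> for the dimension.

  Testing the evolution equation with multiples of the identity matrix shows that \<open>tr B = 0\<close>, since the
  dual field of \<open>g I\<close> vanishes (\<open>dual_field_trace\<close>, \<open>EB_trace_zero\<close>). If \<open>K[E,B]\<close> is finite, the matrices
  \<open>M = s h^2 v \<otimes> v\<close> with arbitrarily large \<open>s\<close> force \<open>I + 2B \<ge> 0\<close> (\<open>K_psd\<close>). Hence \<open>0 \<le> I + 2B \<le> d I\<close>,
  which is the bound on the spectrum. The choice \<open>M = Z \<otimes> Z\<close>, with \<open>Z\<close> close to \<open>E/d\<close>, then gives
  \<open>\<integral>|E|^2 \<le> 2 d K[E,B]\<close> (\<open>K_energy\<close>). The bounds on \<open>J\<close> and on the solutions follow by the Cauchy-Schwarz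
  inequality.

  For existence no weak compactness is needed. The sets of pairs whose objective is at least
  \<open>J - 1/(n+1)\<close> are nested, convex and bounded in \<open>L^2\<close>; by the parallelogram identity, elements of
  almost minimal norm form a Cauchy sequence (\<open>nested_midconvex_limit\<close>). The strong limit lies in
  the class, and it attains the supremum because the objective is an infimum of continuous affine
  functionals.

  For the regularity in time, the equation gives \<open>\<integral>B(s,\<cdot>):\<psi> = \<integral>_s^T \<integral>E \<cdot> w\<close>, where \<open>w\<close> is the dual field of \<open>\<psi>\<close>
  (\<open>pairB_eq_fluxE\<close>), and \<open>w\<close> is the orthogonal projection of the row divergence of \<open>\<psi>\<close> on divergence-free
  fields (\<open>dual_field_energy\<close>). So the left-hand side is Hoelder continuous with exponent 1/2 and a
  constant controlled by \<open>E\<close> and the first derivatives of \<open>\<psi>\<close>. One set of times of full measure serves the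
  countably many trigonometric fields \<open>\<psi>\<close>, and convolution with trigonometric kernels passes to
  \<open>C^1\<close> fields. At the exceptional times, \<open>B(t,\<cdot>)\<close> is replaced by a function compatible with the Hoelder
  estimate, which exists by the same lemma on nested convex sets (\<open>torus_section_limit\<close>).

  The inverse Laplacian in the definition of the dual field is meaningful only if the Poisson
  equation on the torus has a unique smooth solution. This is proved with real Fourier series:
  \<open>fourier_inversion\<close>, \<open>poisson_exists\<close> and \<open>poisson_unique\<close>.
\<close>

section \<open>Smooth functions\<close>

lemma frechet_derivative_eq: "(f has_derivative f') (at x) \<Longrightarrow> frechet_derivative f (at x) = f'"
  by (metis frechet_derivative_at)

lemma differentiable_derivative: "f differentiable (at x) \<Longrightarrow> (f has_derivative frechet_derivative f (at x)) (at x)"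
  by (simp add: frechet_derivative_works)

lemma smooth_imp_differentiable: "smooth f \<Longrightarrow> f differentiable (at x)"
  unfolding smooth_def by (metis C_diff.simps(2))

lemma C_diff_imp_continuous: "C_diff k f \<Longrightarrow> continuous_on UNIV f"
  by (cases k) (auto intro!: differentiable_imp_continuous_on simp: differentiable_on_def differentiable_at_withinI)

lemma smooth_imp_continuous: "smooth f \<Longrightarrow> continuous_on UNIV f"
  using C_diff_imp_continuous smooth_def by blast

lemma smooth_frechet_derivative: "smooth f \<Longrightarrow> b \<in> Basis \<Longrightarrow> smooth (\<lambda>x. frechet_derivative f (at x) b)"
  unfolding smooth_def by (metis C_diff.simps(2))

text \<open>
  Coinduction for smoothness: a set of differentiable functions that is closed under partial derivatives
  consists of smooth functions.
\<close>

lemma smooth_coinduct: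
  assumes "f \<in> X" and "\<And>f x. f \<in> X \<Longrightarrow> f differentiable (at x)"
    and "\<And>f b. f \<in> X \<Longrightarrow> b \<in> Basis \<Longrightarrow> (\<lambda>x. frechet_derivative f (at x) b) \<in> X"
  shows "smooth f"
proof -
  have "C_diff n f" if "f \<in> X" for n f
    using that
  proof (induction n arbitrary: f)
    case 0
    then show ?case using assms(2) by (simp add: continuous_at_imp_continuous_on differentiable_imp_continuous_within)
  next
    case (Suc n)
    then show ?case using assms by auto
  qed
  then show ?thesis using assms(1) smooth_def by blast
qed

lemma smooth_trig:
  fixes w :: "'a::euclidean_space" and a :: "'b::real_normed_vector"
  shows "smooth (\<lambda>x. cos (w \<bullet> x) *\<^sub>R a + sin (w \<bullet> x) *\<^sub>R b)"
proof -
  let ?X = "{f. \<exists>a b::'b. f = (\<lambda>x. cos (w \<bullet> x) *\<^sub>R a + sin (w \<bullet> x) *\<^sub>R b)}"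
  have D: "((\<lambda>x. cos (w \<bullet> x) *\<^sub>R a + sin (w \<bullet> x) *\<^sub>R b) has_derivative
     (\<lambda>h. cos (w \<bullet> x) *\<^sub>R ((w \<bullet> h) *\<^sub>R b) + sin (w \<bullet> x) *\<^sub>R (- (w \<bullet> h) *\<^sub>R a))) (at x)" for a b :: 'b and x
    by (auto intro!: derivative_eq_intros simp: algebra_simps)
  show ?thesis
  proof (rule smooth_coinduct[of _ ?X])
    show "(\<lambda>x. cos (w \<bullet> x) *\<^sub>R a + sin (w \<bullet> x) *\<^sub>R b) \<in> ?X" by blast
    show "f differentiable (at x)" if "f \<in> ?X" for f x
      using that D unfolding differentiable_def by blast
    show "(\<lambda>x. frechet_derivative f (at x) c) \<in> ?X" if A: "f \<in> ?X" "c \<in> Basis" for f c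
    proof -
      obtain a b where f: "f = (\<lambda>x. cos (w \<bullet> x) *\<^sub>R a + sin (w \<bullet> x) *\<^sub>R b)" using A by blast
      have "(\<lambda>x. frechet_derivative f (at x) c) = (\<lambda>x. cos (w \<bullet> x) *\<^sub>R ((w \<bullet> c) *\<^sub>R b) + sin (w \<bullet> x) *\<^sub>R (- (w \<bullet> c) *\<^sub>R a))"
        unfolding f frechet_derivative_eq[OF D] ..
      then show ?thesis by blast
    qed
  qed
qed

lemma smooth_const: "smooth (\<lambda>x::'a::euclidean_space. c::'b::real_normed_vector)"
  using smooth_trig[of "0::'a" c 0] by simp

lemma smooth_add:
  fixes f g :: "'a::euclidean_space \<Rightarrow> 'b::real_normed_vector"
  assumes "smooth f" "smooth g" shows "smooth (\<lambda>x. f x + g x)"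
proof (rule smooth_coinduct[of _ "{h. \<exists>f g. smooth f \<and> smooth g \<and> h = (\<lambda>x. f x + g x)}"])
  show "(\<lambda>x. f x + g x) \<in> {h. \<exists>f g. smooth f \<and> smooth g \<and> h = (\<lambda>x. f x + g x)}" using assms by blast
  fix h x assume "h \<in> {h. \<exists>f g. smooth f \<and> smooth g \<and> h = (\<lambda>x. f x + g x)}"
  then obtain f g where h: "smooth f" "smooth g" "h = (\<lambda>x. f x + g x)" by blast
  then show "h differentiable (at x)" by (simp add: smooth_imp_differentiable)
next
  fix h and b :: 'a assume "h \<in> {h. \<exists>f g. smooth f \<and> smooth g \<and> h = (\<lambda>x::'a. f x + g x :: 'b)}" and b: "b \<in> Basis"
  then obtain f g where h: "smooth f" "smooth g" "h = (\<lambda>x. f x + g x)" by blast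
  have "frechet_derivative h (at x) = (\<lambda>b. frechet_derivative f (at x) b + frechet_derivative g (at x) b)" for x
    unfolding h(3) by (intro frechet_derivative_eq has_derivative_add differentiable_derivative smooth_imp_differentiable h)
  then show "(\<lambda>x. frechet_derivative h (at x) b) \<in> {h. \<exists>f g. smooth f \<and> smooth g \<and> h = (\<lambda>x. f x + g x)}"
    using h smooth_frechet_derivative[OF _ b] by auto
qed

lemma frechet_derivative_bounded_linear:
  assumes "bounded_linear L" "f differentiable (at x)"
  shows "frechet_derivative (\<lambda>x. L (f x)) (at x) = (\<lambda>b. L (frechet_derivative f (at x) b))"
  by (intro frechet_derivative_eq bounded_linear.has_derivative[OF assms(1)] differentiable_derivative assms)

lemma smooth_bounded_linear:
  fixes f :: "'a::euclidean_space \<Rightarrow> 'b::real_normed_vector" and L :: "'b \<Rightarrow> 'c::real_normed_vector"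
  assumes "smooth f" "bounded_linear L" shows "smooth (\<lambda>x. L (f x))"
proof (rule smooth_coinduct[of _ "{h. \<exists>f. smooth f \<and> h = (\<lambda>x. L (f x))}"])
  show "(\<lambda>x. L (f x)) \<in> {h. \<exists>f. smooth f \<and> h = (\<lambda>x. L (f x))}" using assms by blast
  fix h x assume "h \<in> {h. \<exists>f. smooth f \<and> h = (\<lambda>x. L (f x))}"
  then obtain f where h: "smooth f" "h = (\<lambda>x. L (f x))" by blast
  then show "h differentiable (at x)"
    using bounded_linear.has_derivative[OF assms(2) differentiable_derivative[OF smooth_imp_differentiable[OF h(1)]]]
    by (auto simp: differentiable_def)
next
  fix h :: "'a \<Rightarrow> 'c" and b :: 'a assume "h \<in> {h. \<exists>f. smooth f \<and> h = (\<lambda>x. L (f x))}" and b: "b \<in> Basis"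
  then obtain f where h: "smooth f" "h = (\<lambda>x. L (f x))" by blast
  then show "(\<lambda>x. frechet_derivative h (at x) b) \<in> {h. \<exists>f. smooth f \<and> h = (\<lambda>x. L (f x))}"
    using h smooth_frechet_derivative[OF _ b] frechet_derivative_bounded_linear[OF assms(2) smooth_imp_differentiable[OF h(1)]] by auto
qed

lemma smooth_scaleR: "smooth f \<Longrightarrow> smooth (\<lambda>x. c *\<^sub>R f x)"
  by (rule smooth_bounded_linear[OF _ bounded_linear_scaleR_right])

lemma smooth_cmult: "smooth f \<Longrightarrow> smooth (\<lambda>x. (c::real) * f x)"
  using smooth_scaleR[of f c] by simp

lemma smooth_minus: "smooth f \<Longrightarrow> smooth (\<lambda>x. - f x)"
  using smooth_scaleR[of f "-1"] by simp

lemma smooth_diff: "smooth f \<Longrightarrow> smooth g \<Longrightarrow> smooth (\<lambda>x. f x - g x)"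
  using smooth_add[OF _ smooth_minus, of f g] by simp

lemma smooth_sum: "(\<And>i. i \<in> I \<Longrightarrow> smooth (f i)) \<Longrightarrow> smooth (\<lambda>x. \<Sum>i\<in>I. f i x)"
  by (induction I rule: infinite_finite_induct) (auto intro: smooth_const smooth_add)

lemma smooth_power: "smooth (\<lambda>t::real. t ^ m)"
proof -
  let ?X = "{f. \<exists>c m. f = (\<lambda>t::real. c * t ^ m)}"
  have D: "((\<lambda>t::real. c * t ^ m) has_derivative (\<lambda>h. (c * real m * h) * t ^ (m - 1))) (at t)" for c m t
    by (auto intro!: derivative_eq_intros)
  have "smooth (\<lambda>t::real. 1 * t ^ m)"
  proof (rule smooth_coinduct[of _ ?X])
    show "(\<lambda>t::real. 1 * t ^ m) \<in> ?X" by blast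
    show "f differentiable (at x)" if "f \<in> ?X" for f x
      using that D by (auto simp: differentiable_def)
    show "(\<lambda>x. frechet_derivative f (at x) c) \<in> ?X" if A: "f \<in> ?X" "c \<in> Basis" for f c
    proof -
      obtain a m where f: "f = (\<lambda>t. a * t ^ m)" using A by blast
      have "(\<lambda>x. frechet_derivative f (at x) c) = (\<lambda>t. (a * real m) * t ^ (m - 1))"
        unfolding f frechet_derivative_eq[OF D] using A(2) by auto
      then show ?thesis by blast
    qed
  qed
  then show ?thesis by simp
qed

section \<open>Partial derivatives\<close>

lemma smooth_pd: "smooth f \<Longrightarrow> smooth (pd i f)"
  unfolding pd_def using smooth_frechet_derivative[of f "axis i 1"] by (simp add: axis_in_Basis_iff)

lemma pd_eq: "(f has_derivative f') (at x) \<Longrightarrow> pd i f x = f' (axis i 1)"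
  by (simp add: pd_def frechet_derivative_eq)

lemma pd_add: "f differentiable (at x) \<Longrightarrow> g differentiable (at x) \<Longrightarrow>
  pd i (\<lambda>x. f x + g x) x = pd i f x + pd i g x"
  unfolding pd_def by (subst frechet_derivative_eq[OF has_derivative_add[OF differentiable_derivative differentiable_derivative]]) auto

lemma pd_cmult: "f differentiable (at x) \<Longrightarrow> pd i (\<lambda>x. c * f x) x = c * pd i f x"
  unfolding pd_def by (subst frechet_derivative_bounded_linear[of "\<lambda>x. c * x"]) (auto intro: bounded_linear_mult_right)

lemma pd_const [simp]: "pd i (\<lambda>x. c) x = 0" by (simp add: pd_def)

lemma pd_minus: "f differentiable (at x) \<Longrightarrow> pd i (\<lambda>x. - f x) x = - pd i f x"
  using pd_cmult[of f x i "-1"] by simp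

lemma pd_diff: "f differentiable (at x) \<Longrightarrow> g differentiable (at x) \<Longrightarrow>
  pd i (\<lambda>x. f x - g x) x = pd i f x - pd i g x"
  using pd_add[of f x "\<lambda>x. - g x" i] by (simp add: pd_minus)

lemma pd_sum: "(\<And>a. a \<in> A \<Longrightarrow> f a differentiable (at x)) \<Longrightarrow>
  pd i (\<lambda>x. \<Sum>a\<in>A. f a x) x = (\<Sum>a\<in>A. pd i (f a) x)"
  by (induction A rule: infinite_finite_induct) (auto simp: pd_add)

lemma pd_mult: "f differentiable (at x) \<Longrightarrow> g differentiable (at x) \<Longrightarrow>
  pd i (\<lambda>x. f x * g x) x = f x * pd i g x + pd i f x * g x"
  unfolding pd_def by (subst frechet_derivative_eq[OF has_derivative_mult[OF differentiable_derivative differentiable_derivative]]) auto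

lemma frechet_derivative_sum_pd:
  fixes f :: "real^'n \<Rightarrow> real"
  assumes "f differentiable (at x)"
  shows "frechet_derivative f (at x) h = (\<Sum>i\<in>UNIV. h $ i * pd i f x)"
proof -
  have L: "linear (frechet_derivative f (at x))"
    using differentiable_derivative[OF assms] has_derivative_linear by blast
  have "h = (\<Sum>i\<in>UNIV. (h $ i) *\<^sub>R axis i 1)"
    by (metis basis_expansion scalar_mult_eq_scaleR)
  then have "frechet_derivative f (at x) h = frechet_derivative f (at x) (\<Sum>i\<in>UNIV. (h $ i) *\<^sub>R axis i 1)" by simp
  also have "\<dots> = (\<Sum>i\<in>UNIV. h $ i * pd i f x)"
    by (simp add: linear_sum[OF L] linear_cmul[OF L] pd_def)
  finally show ?thesis .
qed

section \<open>Periodic functions and their integrals\<close>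

lemma periodicD: "periodic f \<Longrightarrow> f (x + axis i 1) = f x" by (simp add: periodic_def)

lemma periodic_int:
  fixes f :: "real^'n \<Rightarrow> 'b"
  assumes "periodic f"
  shows "f (x + (\<chi> i. of_int (n i))) = f x"
proof -
  have one: "f (x + of_nat m *\<^sub>R axis i 1) = f x" for x m i
  proof (induction m)
    case (Suc m)
    have "f (x + of_nat (Suc m) *\<^sub>R axis i 1) = f ((x + of_nat m *\<^sub>R axis i 1) + axis i 1)"
      by (simp add: algebra_simps)
    then show ?case using Suc periodicD[OF assms] by metis
  qed simp
  have oneint: "f (x + of_int m *\<^sub>R axis i 1) = f x" for x m i
  proof (cases "m \<ge> 0")
    case True
    then show ?thesis using one[of x "nat m" i] by simp
  next
    case False
    then show ?thesis using one[of "x + of_int m *\<^sub>R axis i 1" "nat (-m)" i] by (simp add: algebra_simps)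
  qed
  have "f (x + (\<Sum>i\<in>I. of_int (n i) *\<^sub>R axis i 1)) = f x" if "finite I" for I
    using that
  proof (induction I arbitrary: x)
    case (insert i I)
    show ?case using insert(1,2) insert(3)[of "x + of_int (n i) *\<^sub>R axis i 1"] oneint[of x "n i" i]
      by (simp add: add.assoc)
  qed simp
  moreover have "(\<chi> i. of_int (n i)) = (\<Sum>i\<in>UNIV. of_int (n i) *\<^sub>R axis i (1::real))"
    by (simp add: vec_eq_iff axis_def if_distrib[of "\<lambda>x. _ * x"] cong: if_cong)
  ultimately show ?thesis by (metis finite)
qed

text \<open>
  The representative of \<open>x\<close> modulo \<open>Z^d\<close> in \<open>[0,1)^d\<close>.
\<close>

definition vfrac :: "real^'n \<Rightarrow> real^'n" where
  "vfrac x = (\<chi> i. frac (x $ i))"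

lemma mem_unit_box: "x \<in> cbox 0 (1::real^'n) \<longleftrightarrow> (\<forall>i. 0 \<le> x $ i \<and> x $ i \<le> 1)"
  by (simp add: mem_box_cart)

lemma vfrac_in: "vfrac x \<in> cbox 0 1"
  by (simp add: vfrac_def mem_unit_box less_imp_le[OF frac_lt_1])

lemma periodic_vfrac: "periodic f \<Longrightarrow> f (vfrac x) = f x"
  using periodic_int[of f "vfrac x" "\<lambda>i. floor (x $ i)"]
  by (simp add: vfrac_def frac_def plus_vec_def)

lemma periodic_frechet_derivative:
  assumes "periodic f" "\<And>x. f differentiable (at x)"
  shows "periodic (\<lambda>x. frechet_derivative f (at x) b)"
  unfolding periodic_def
proof (intro allI)
  fix x i
  have "((\<lambda>x. f (x + axis i 1)) has_derivative frechet_derivative f (at (x + axis i 1))) (at x)"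
    by (rule has_derivative_eq_rhs, rule has_derivative_compose[OF _ differentiable_derivative[OF assms(2)]])
       (auto intro!: derivative_eq_intros)
  then show "frechet_derivative f (at (x + axis i 1)) b = frechet_derivative f (at x) b"
    using frechet_derivative_eq periodicD[OF assms(1)] by fastforce
qed

lemma periodic_pd: "periodic f \<Longrightarrow> (\<And>x. f differentiable (at x)) \<Longrightarrow> periodic (pd i f)"
  unfolding pd_def[abs_def] by (rule periodic_frechet_derivative)

lemma periodic_bounded:
  fixes f :: "real^'n \<Rightarrow> 'b::real_normed_vector"
  assumes "periodic f" "continuous_on UNIV f"
  obtains C where "\<And>x. norm (f x) \<le> C" "C > 0"
proof -
  have "compact (f ` cbox 0 1)" by (intro compact_continuous_image continuous_on_subset[OF assms(2)]) auto
  then obtain C where C: "\<forall>y \<in> f ` cbox 0 1. norm y \<le> C" "C > 0"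
    by (meson bounded_pos compact_imp_bounded)
  then have "norm (f x) \<le> C" for x
    using vfrac_in[of x] periodic_vfrac[OF assms(1), of x] by force
  then show ?thesis using that C by blast
qed

lemma periodic_shift_fun: "periodic f \<Longrightarrow> periodic (\<lambda>y. f (x + y))"
  by (simp add: periodic_def add.assoc[symmetric])

text \<open>
  The shifted cube is cut along \<open>x_i = 1\<close>; by periodicity the part beyond that hyperplane fills the gap
  left at \<open>x_i = 0\<close>.
\<close>

lemma integral_shift_coord:
  fixes f :: "real^'n \<Rightarrow> 'b::euclidean_space"
  assumes f: "periodic f" "continuous_on UNIV f" and h: "0 \<le> h" "h \<le> 1"
  shows "integral (cbox 0 1) (\<lambda>y. f (y + h *\<^sub>R axis i 1)) = integral (cbox 0 1) f"
proof -
  let ?e = "axis i 1 :: real^'n"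
  have e: "?e \<in> Basis" by (simp add: axis_in_Basis_iff)
  have int: "f integrable_on cbox a b" for a b
    by (intro integrable_continuous continuous_on_subset[OF f(2)]) auto
  have sh: "integral (cbox a b) (\<lambda>y. f (y + c)) = integral (cbox (a + c) (b + c)) f" for a b c
    using integral_shift_cbox_plus[of a b f c] by (simp add: o_def add.commute)
  define u :: "real^'n" where "u = (\<chi> j. if j = i then h else 1)"
  have ei: "x \<bullet> ?e = x $ i" for x by (simp add: inner_axis)
  have m1: "x \<in> cbox (h *\<^sub>R ?e) (1 + h *\<^sub>R ?e) \<longleftrightarrow>
    h \<le> x $ i \<and> x $ i \<le> 1 + h \<and> (\<forall>j. j \<noteq> i \<longrightarrow> 0 \<le> x $ j \<and> x $ j \<le> 1)" for x :: "real^'n"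
    by (auto simp: mem_box_cart axis_def split: if_splits)
  have m2: "x \<in> cbox 0 1 \<longleftrightarrow>
    0 \<le> x $ i \<and> x $ i \<le> 1 \<and> (\<forall>j. j \<noteq> i \<longrightarrow> 0 \<le> x $ j \<and> x $ j \<le> 1)" for x :: "real^'n"
    by (auto simp: mem_box_cart)
  have m3: "x \<in> cbox 0 u \<longleftrightarrow>
    0 \<le> x $ i \<and> x $ i \<le> h \<and> (\<forall>j. j \<noteq> i \<longrightarrow> 0 \<le> x $ j \<and> x $ j \<le> 1)" for x :: "real^'n"
    by (auto simp: mem_box_cart u_def split: if_splits)
  have m4: "x \<in> cbox (0 + ?e) (u + ?e) \<longleftrightarrow>
    1 \<le> x $ i \<and> x $ i \<le> 1 + h \<and> (\<forall>j. j \<noteq> i \<longrightarrow> 0 \<le> x $ j \<and> x $ j \<le> 1)" for x :: "real^'n"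
    by (auto simp: mem_box_cart axis_def u_def split: if_splits)
  have "integral (cbox 0 1) (\<lambda>y. f (y + h *\<^sub>R ?e)) = integral (cbox (h *\<^sub>R ?e) (1 + h *\<^sub>R ?e)) f"
    using sh[of 0 1 "h *\<^sub>R ?e"] by simp
  also have "\<dots> = integral (cbox (h *\<^sub>R ?e) (1 + h *\<^sub>R ?e) \<inter> {x. x \<bullet> ?e \<le> 1}) f +
           integral (cbox (h *\<^sub>R ?e) (1 + h *\<^sub>R ?e) \<inter> {x. x \<bullet> ?e \<ge> 1}) f"
    by (rule integral_split[OF int e])
  also have "cbox (h *\<^sub>R ?e) (1 + h *\<^sub>R ?e) \<inter> {x. x \<bullet> ?e \<le> 1} = cbox 0 1 \<inter> {x. x \<bullet> ?e \<ge> h}"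
    unfolding set_eq_iff Int_iff m1 m2 mem_Collect_eq ei using h by auto
  also have "cbox (h *\<^sub>R ?e) (1 + h *\<^sub>R ?e) \<inter> {x. x \<bullet> ?e \<ge> 1} = cbox (0 + ?e) (u + ?e)"
    unfolding set_eq_iff Int_iff m1 m4 mem_Collect_eq ei using h by auto
  also have "integral \<dots> f = integral (cbox 0 u) (\<lambda>y. f (y + ?e))"
    by (rule sh[symmetric])
  also have "(\<lambda>y. f (y + ?e)) = f" using periodicD[OF f(1)] by auto
  also have "cbox 0 u = cbox 0 1 \<inter> {x. x \<bullet> ?e \<le> h}"
    unfolding set_eq_iff Int_iff m2 m3 mem_Collect_eq ei using h by auto
  also have "integral (cbox 0 1 \<inter> {x. x \<bullet> ?e \<ge> h}) f + integral (cbox 0 1 \<inter> {x. x \<bullet> ?e \<le> h}) f =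
    integral (cbox 0 1) f"
    using integral_split[OF int e, of 0 1 h] by simp
  finally show ?thesis .
qed

lemma integral_shift_periodic:
  fixes f :: "real^'n \<Rightarrow> 'b::euclidean_space"
  assumes f: "periodic f" "continuous_on UNIV f"
  shows "integral (cbox 0 1) (\<lambda>y. f (x + y)) = integral (cbox 0 1) f"
proof -
  have *: "integral (cbox 0 1) (\<lambda>y. f (y + (\<Sum>i\<in>I. vfrac x $ i *\<^sub>R axis i 1))) = integral (cbox 0 1) f"
    if "finite I" for I
    using that
  proof (induction I)
    case (insert i I)
    let ?g = "\<lambda>y. f (y + (\<Sum>i\<in>I. vfrac x $ i *\<^sub>R axis i 1))"
    have "periodic ?g" using periodic_shift_fun[OF f(1), of "(\<Sum>i\<in>I. vfrac x $ i *\<^sub>R axis i 1)"] by (simp add: add.commute)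
    moreover have "continuous_on UNIV ?g"
      by (intro continuous_on_compose2[OF f(2)] continuous_intros) auto
    ultimately have "integral (cbox 0 1) (\<lambda>y. ?g (y + vfrac x $ i *\<^sub>R axis i 1)) = integral (cbox 0 1) ?g"
      using vfrac_in[of x] by (intro integral_shift_coord) (auto simp: mem_unit_box)
    then show ?case using insert by (simp add: add.assoc)
  qed simp
  have "(\<Sum>i\<in>UNIV. vfrac x $ i *\<^sub>R axis i 1) = vfrac x"
    by (metis basis_expansion scalar_mult_eq_scaleR)
  then have "integral (cbox 0 1) (\<lambda>y. f (y + vfrac x)) = integral (cbox 0 1) f"
    using *[of UNIV] by simp
  moreover have "f (y + vfrac x) = f (x + y)" for y
    using periodic_vfrac[OF periodic_shift_fun[OF f(1), of y], of x] by (simp add: add.commute)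
  ultimately show ?thesis by simp
qed

text \<open>
  Differentiation under the integral sign of the constant function \<open>s \<mapsto> \<integral>f(s e_i + y) dy\<close>.
\<close>

lemma integral_pd_eq_0:
  fixes f :: "real^'n \<Rightarrow> real"
  assumes per: "periodic f" and diff: "\<And>x. f differentiable (at x)" and cont: "continuous_on UNIV (pd i f)"
  shows "integral (cbox 0 1) (pd i f) = 0"
proof -
  let ?e = "axis i 1 :: real^'n"
  have cf: "continuous_on UNIV f"
    using diff by (simp add: continuous_at_imp_continuous_on differentiable_imp_continuous_within)
  have "((\<lambda>s. integral (cbox 0 1) (\<lambda>y. f (s *\<^sub>R ?e + y))) has_field_derivative
     integral (cbox 0 1) (\<lambda>y. pd i f (0 *\<^sub>R ?e + y))) (at 0 within UNIV)"
  proof (rule leibniz_rule_field_derivative)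
    show "((\<lambda>s. f (s *\<^sub>R ?e + t)) has_field_derivative pd i f (s *\<^sub>R ?e + t)) (at s within UNIV)" for s t
    proof -
      have "((\<lambda>s. f (s *\<^sub>R ?e + t)) has_derivative (\<lambda>h. frechet_derivative f (at (s *\<^sub>R ?e + t)) (h *\<^sub>R ?e))) (at s)"
        by (rule has_derivative_compose[OF _ differentiable_derivative[OF diff]]) (auto intro!: derivative_eq_intros)
      moreover have "frechet_derivative f (at (s *\<^sub>R ?e + t)) (h *\<^sub>R ?e) = pd i f (s *\<^sub>R ?e + t) * h" for h
        using linear_cmul[OF has_derivative_linear[OF differentiable_derivative[OF diff]]] by (simp add: pd_def)
      ultimately show ?thesis by (simp add: has_field_derivative_def)
    qed
    show "(\<lambda>y. f (s *\<^sub>R ?e + y)) integrable_on cbox 0 1" for s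
      by (intro integrable_continuous continuous_on_compose2[OF cf] continuous_intros) auto
    show "continuous_on (UNIV \<times> cbox 0 1) (\<lambda>(s, y). pd i f (s *\<^sub>R ?e + y))"
      unfolding split_beta by (intro continuous_on_compose2[OF cont] continuous_intros) auto
  qed auto
  then have "((\<lambda>s::real. integral (cbox 0 1) f) has_field_derivative integral (cbox 0 1) (pd i f)) (at 0)"
    by (simp add: integral_shift_periodic[OF per cf])
  then show ?thesis by (rule DERIV_unique) auto
qed

section \<open>Fourier coefficients on the torus\<close>

lemma space_torus [simp]: "space torus = cbox 0 1"
  by (simp add: torus_def space_restrict_space)

lemma emeasure_torus: "emeasure (torus :: (real^'n) measure) (space torus) = 1"
proof -
  have "(\<Prod>b\<in>Basis. (1::real^'n) \<bullet> b) = 1"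
    by (intro prod.neutral) (auto simp: Basis_vec_def inner_axis)
  moreover have "\<forall>b\<in>Basis. 0 \<le> (1::real^'n) \<bullet> b" by (auto simp: Basis_vec_def inner_axis)
  ultimately have "emeasure lborel (cbox 0 (1::real^'n)) = 1"
    by (simp add: emeasure_lborel_cbox_eq)
  then show ?thesis
    unfolding torus_def by (simp add: emeasure_restrict_space)
qed

lemma finite_torus: "finite_measure (torus :: (real^'n) measure)"
  by (intro finite_measureI) (simp add: emeasure_torus del: space_torus)

interpretation torus: finite_measure "torus :: (real^'n) measure" by (rule finite_torus)

lemma measure_torus [simp]: "measure (torus :: (real^'n) measure) (cbox 0 1) = 1"
  using emeasure_torus by (simp add: measure_def)

text \<open>
  For continuous functions the Lebesgue integral over the torus and the Henstock-Kurzweil integral over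
  the unit cube agree; Fourier analysis below is done with the latter.
\<close>

lemma torus_integral:
  fixes f :: "real^'n \<Rightarrow> 'b::euclidean_space"
  assumes "continuous_on (cbox 0 1) f"
  shows "integrable torus f" "(\<integral>x. f x \<partial>torus) = integral (cbox 0 1) f"
proof -
  have "set_integrable lborel (cbox 0 1) f"
    unfolding set_integrable_def by (intro borel_integrable_compact assms) auto
  then show "integrable torus f" "(\<integral>x. f x \<partial>torus) = integral (cbox 0 1) f"
    using set_borel_integral_eq_integral(2)[of "cbox 0 1" f]
    by (auto simp: torus_def integrable_restrict_space integral_restrict_space set_integrable_def
        set_lebesgue_integral_def)
qed

text \<open>
  The frequency vector \<open>2\<pi>k\<close> of an integer vector \<open>k\<close>.
\<close>

definition freq :: "int^'n \<Rightarrow> real^'n" where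
  "freq k = (\<chi> i. 2 * pi * of_int (k $ i))"

lemma freq_axis: "freq k \<bullet> axis i 1 = 2 * pi * of_int (k $ i)"
  by (simp add: freq_def inner_axis)

lemma freq_minus: "freq (- k) = - freq k" by (simp add: freq_def vec_eq_iff)
lemma freq_add: "freq (k + l) = freq k + freq l" by (simp add: freq_def vec_eq_iff algebra_simps)
lemma freq_diff: "freq (k - l) = freq k - freq l" by (simp add: freq_def vec_eq_iff algebra_simps)
lemma freq_0 [simp]: "freq 0 = 0" by (simp add: freq_def vec_eq_iff)

lemma cos_freq_shift: "cos (freq k \<bullet> (x + axis i 1)) = cos (freq k \<bullet> x)"
  "sin (freq k \<bullet> (x + axis i 1)) = sin (freq k \<bullet> x)"
proof -
  have "cos (2 * pi * of_int (k $ i)) = 1" "sin (2 * pi * of_int (k $ i)) = 0"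
    by (metis cos_int_2pin mult.commute, metis sin_int_2pin mult.commute)
  then show "cos (freq k \<bullet> (x + axis i 1)) = cos (freq k \<bullet> x)"
  "sin (freq k \<bullet> (x + axis i 1)) = sin (freq k \<bullet> x)"
    by (simp_all add: inner_add_right freq_axis cos_add sin_add)
qed

text \<open>
  Real Fourier coefficients, for functions with values in a Euclidean space.
\<close>

definition cos_coeff :: "(real^'n \<Rightarrow> 'b::euclidean_space) \<Rightarrow> int^'n \<Rightarrow> 'b" where
  "cos_coeff f k = integral (cbox 0 1) (\<lambda>z. cos (freq k \<bullet> z) *\<^sub>R f z)"

definition sin_coeff :: "(real^'n \<Rightarrow> 'b::euclidean_space) \<Rightarrow> int^'n \<Rightarrow> 'b" where
  "sin_coeff f k = integral (cbox 0 1) (\<lambda>z. sin (freq k \<bullet> z) *\<^sub>R f z)"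

text \<open>
  The component of \<open>f\<close> of frequencies \<open>k\<close> and \<open>-k\<close>: half of what they contribute together when \<open>k \<noteq> 0\<close>,
  so that summation over all \<open>k \<in> Z^d\<close> returns \<open>f\<close>. In complex notation it is the real part
  of \<open>c_k(f) e^{2\<pi>i k \<cdot> x}\<close>, for real-valued \<open>f\<close>.
\<close>

definition fourier_mode :: "(real^'n \<Rightarrow> 'b::euclidean_space) \<Rightarrow> int^'n \<Rightarrow> real^'n \<Rightarrow> 'b" where
  "fourier_mode f k x = cos (freq k \<bullet> x) *\<^sub>R cos_coeff f k + sin (freq k \<bullet> x) *\<^sub>R sin_coeff f k"

lemma smooth_fourier_mode: "smooth (fourier_mode f k)"
  unfolding fourier_mode_def[abs_def] by (rule smooth_trig)

lemma periodic_fourier_mode: "periodic (fourier_mode f k)"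
  by (simp add: periodic_def fourier_mode_def cos_freq_shift)

lemma cbox_integrable:
  fixes f :: "real^'n \<Rightarrow> 'b::euclidean_space"
  shows "continuous_on UNIV f \<Longrightarrow> f integrable_on cbox a b"
  by (rule integrable_continuous, erule continuous_on_subset) simp

lemma fourier_mode_conv:
  fixes f :: "real^'n \<Rightarrow> 'b::euclidean_space"
  assumes f: "periodic f" "continuous_on UNIV f"
  shows "fourier_mode f k x = integral (cbox 0 1) (\<lambda>y. cos (freq k \<bullet> y) *\<^sub>R f (x + y))"
proof -
  let ?g = "\<lambda>y. cos (freq k \<bullet> (y - x)) *\<^sub>R f y"
  have "periodic ?g"
    unfolding periodic_def
  proof (intro allI)
    fix y i
    have "y + axis i 1 - x = (y - x) + axis i 1" by simp
    then show "?g (y + axis i 1) = ?g y" using periodicD[OF f(1)] cos_freq_shift(1) by metis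
  qed
  moreover have "continuous_on UNIV ?g" by (intro continuous_intros f)
  ultimately have "integral (cbox 0 1) (\<lambda>y. ?g (x + y)) = integral (cbox 0 1) ?g"
    by (rule integral_shift_periodic)
  moreover have g: "?g = (\<lambda>y. cos (freq k \<bullet> x) *\<^sub>R (cos (freq k \<bullet> y) *\<^sub>R f y) + sin (freq k \<bullet> x) *\<^sub>R (sin (freq k \<bullet> y) *\<^sub>R f y))"
    by (auto simp: inner_diff_right cos_diff scaleR_add_left mult_ac)
  moreover have "integral (cbox 0 1) ?g = fourier_mode f k x"
    unfolding g fourier_mode_def cos_coeff_def sin_coeff_def
    by (subst integral_add) (auto intro!: cbox_integrable continuous_intros f simp del: scaleR_scaleR)
  ultimately show ?thesis by simp
qed

lemma cos_freq_deriv: "((\<lambda>x. cos (freq k \<bullet> x)) has_derivative (\<lambda>h. - sin (freq k \<bullet> x) * (freq k \<bullet> h))) (at x)"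
  "((\<lambda>x. sin (freq k \<bullet> x)) has_derivative (\<lambda>h. cos (freq k \<bullet> x) * (freq k \<bullet> h))) (at x)"
  by (auto intro!: derivative_eq_intros)

lemma pd_cos_freq: "pd i (\<lambda>x. cos (freq k \<bullet> x)) x = - sin (freq k \<bullet> x) * (2 * pi * of_int (k $ i))"
  "pd i (\<lambda>x. sin (freq k \<bullet> x)) x = cos (freq k \<bullet> x) * (2 * pi * of_int (k $ i))"
  using cos_freq_deriv[of k x] by (simp_all add: pd_eq freq_axis)

text \<open>
  Continuously differentiable functions on the torus.
\<close>

definition C1_periodic :: "(real^'n \<Rightarrow> real) \<Rightarrow> bool" where
  "C1_periodic f \<longleftrightarrow> periodic f \<and> (\<forall>x. f differentiable (at x)) \<and> (\<forall>i. continuous_on UNIV (pd i f))"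

lemma C1_periodic_cont: "C1_periodic f \<Longrightarrow> continuous_on UNIV f"
  by (simp add: C1_periodic_def continuous_at_imp_continuous_on differentiable_imp_continuous_within)

lemma C1_periodic_smooth: "smooth f \<Longrightarrow> periodic f \<Longrightarrow> C1_periodic f"
  by (simp add: C1_periodic_def smooth_imp_differentiable smooth_imp_continuous smooth_pd)

lemma C1_periodic_mult: "C1_periodic f \<Longrightarrow> C1_periodic g \<Longrightarrow> C1_periodic (\<lambda>x. f x * g x)"
  using C1_periodic_cont[of f] C1_periodic_cont[of g]
  by (auto simp: C1_periodic_def periodic_def pd_mult intro!: continuous_intros)

lemma C1_periodic_pd_integral: "C1_periodic f \<Longrightarrow> integral (cbox 0 1) (pd i f) = 0"
  by (intro integral_pd_eq_0) (auto simp: C1_periodic_def)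

lemma C1_periodic_pd_periodic: "C1_periodic f \<Longrightarrow> periodic (pd i f)"
  by (intro periodic_pd) (auto simp: C1_periodic_def)

lemma integration_by_parts:
  assumes "C1_periodic f" "C1_periodic g"
  shows "integral (cbox 0 1) (\<lambda>x. f x * pd i g x) = - integral (cbox 0 1) (\<lambda>x. pd i f x * g x)"
proof -
  have "0 = integral (cbox 0 1) (pd i (\<lambda>x. f x * g x))" using C1_periodic_pd_integral[OF C1_periodic_mult[OF assms]] by simp
  also have "pd i (\<lambda>x. f x * g x) = (\<lambda>x. f x * pd i g x + pd i f x * g x)"
    using assms by (auto simp: C1_periodic_def pd_mult)
  also have "integral (cbox 0 1) \<dots> = integral (cbox 0 1) (\<lambda>x. f x * pd i g x) + integral (cbox 0 1) (\<lambda>x. pd i f x * g x)"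
    using assms C1_periodic_cont[of f] C1_periodic_cont[of g]
    by (intro integral_add cbox_integrable continuous_intros) (auto simp: C1_periodic_def)
  finally show ?thesis by simp
qed

lemma C1_periodic_trig: "C1_periodic (\<lambda>x. cos (freq k \<bullet> x))" "C1_periodic (\<lambda>x. sin (freq k \<bullet> x))"
  using C1_periodic_smooth[OF smooth_trig[of "freq k" "1::real" 0]] C1_periodic_smooth[OF smooth_trig[of "freq k" "0::real" 1]]
  by (simp_all add: periodic_def cos_freq_shift)

lemma coeff_pd:
  assumes "C1_periodic f"
  shows "cos_coeff (pd i f) k = 2 * pi * of_int (k $ i) * sin_coeff f k"
    "sin_coeff (pd i f) k = - (2 * pi * of_int (k $ i) * cos_coeff f k)"
proof -
  let ?c = "2 * pi * of_int (k $ i) :: real"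
  have "cos_coeff (pd i f) k = - integral (cbox 0 1) (\<lambda>x. - ?c * (sin (freq k \<bullet> x) * f x))"
    using integration_by_parts[OF C1_periodic_trig(1)[of k] assms, of i]
    by (simp add: cos_coeff_def pd_cos_freq mult_ac)
  also have "\<dots> = ?c * sin_coeff f k" unfolding integral_mult_right sin_coeff_def by simp
  finally show "cos_coeff (pd i f) k = ?c * sin_coeff f k" .
  have "sin_coeff (pd i f) k = - integral (cbox 0 1) (\<lambda>x. ?c * (cos (freq k \<bullet> x) * f x))"
    using integration_by_parts[OF C1_periodic_trig(2)[of k] assms, of i]
    by (simp add: sin_coeff_def pd_cos_freq mult_ac)
  also have "\<dots> = - (?c * cos_coeff f k)" unfolding integral_mult_right cos_coeff_def by simp
  finally show "sin_coeff (pd i f) k = - (?c * cos_coeff f k)" .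
qed

lemma pd_fourier_mode:
  assumes "C1_periodic f"
  shows "pd i (fourier_mode f k) x = fourier_mode (pd i f) k x"
proof -
  have "(fourier_mode f k has_derivative (\<lambda>h. (- sin (freq k \<bullet> x) * (freq k \<bullet> h)) * cos_coeff f k + (cos (freq k \<bullet> x) * (freq k \<bullet> h)) * sin_coeff f k)) (at x)"
    unfolding fourier_mode_def[abs_def] real_scaleR_def
    by (intro has_derivative_add has_derivative_mult_left cos_freq_deriv)
  then show ?thesis
    by (simp add: pd_eq freq_axis fourier_mode_def coeff_pd[OF assms] algebra_simps)
qed

section \<open>Convolution with trigonometric kernels\<close>

text \<open>
  Even trigonometric polynomials: the linear span of the functions \<open>cos (2\<pi>k \<cdot> y)\<close>.
\<close>

inductive_set cosspan :: "(real^'n \<Rightarrow> real) set" where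
  cosspan_cos: "(\<lambda>y. cos (freq k \<bullet> y)) \<in> cosspan"
| cosspan_add: "p \<in> cosspan \<Longrightarrow> q \<in> cosspan \<Longrightarrow> (\<lambda>y. p y + q y) \<in> cosspan"
| cosspan_scale: "p \<in> cosspan \<Longrightarrow> (\<lambda>y. c * p y) \<in> cosspan"

lemma cosspan_const: "(\<lambda>y. c) \<in> cosspan"
  using cosspan_scale[OF cosspan_cos[of 0], of c] by simp

lemma cosspan_mult:
  assumes "p \<in> cosspan" "q \<in> cosspan"
  shows "(\<lambda>y. p y * q y) \<in> cosspan"
  using assms(1)
proof induction
  case (cosspan_cos k)
  show ?case using assms(2)
  proof induction
    case (cosspan_cos l)
    have "(\<lambda>y. cos (freq k \<bullet> y) * cos (freq l \<bullet> y)) = (\<lambda>y. (1/2) * (cos (freq (k - l) \<bullet> y) + cos (freq (k + l) \<bullet> y)))"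
      by (simp add: freq_add freq_diff inner_add_left inner_diff_left cos_add cos_diff)
    also have "\<dots> \<in> cosspan" by (intro cosspan.intros)
    finally show ?case .
  next
    case (cosspan_add p q)
    show ?case using cosspan.cosspan_add[OF cosspan_add.IH] by (simp add: distrib_left)
  next
    case (cosspan_scale p c)
    show ?case using cosspan.cosspan_scale[OF cosspan_scale.IH, of c] by (simp add: mult.left_commute)
  qed
next
  case (cosspan_add p q)
  show ?case using cosspan.cosspan_add[OF cosspan_add.IH] by (simp add: distrib_right)
next
  case (cosspan_scale p c)
  show ?case using cosspan.cosspan_scale[OF cosspan_scale.IH, of c] by (simp add: mult.assoc)
qed

lemma cosspan_prod: "(\<And>i. i \<in> I \<Longrightarrow> p i \<in> cosspan) \<Longrightarrow> (\<lambda>y. \<Prod>i\<in>I. p i y) \<in> cosspan"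
proof (induction I rule: infinite_finite_induct)
  case (insert i I)
  then show ?case using cosspan_mult[of "p i" "\<lambda>y. \<Prod>i\<in>I. p i y"] by simp
qed (simp_all add: cosspan_const)

lemma cosspan_power: "p \<in> cosspan \<Longrightarrow> (\<lambda>y. p y ^ n) \<in> cosspan"
proof (induction n)
  case (Suc n)
  then show ?case using cosspan_mult[of p "\<lambda>y. p y ^ n"] by simp
qed (simp add: cosspan_const)

lemma cosspan_cont: "p \<in> cosspan \<Longrightarrow> continuous_on UNIV p"
  by (induction rule: cosspan.induct) (auto intro!: continuous_intros)

text \<open>
  A convolution with the sign of \<open>y\<close> reversed, \<open>\<integral>q(y) f(x + y) dy\<close>; for the even kernels used below this
  is the usual one.
\<close>

definition conv :: "(real^'n \<Rightarrow> real) \<Rightarrow> (real^'n \<Rightarrow> 'b::euclidean_space) \<Rightarrow> real^'n \<Rightarrow> 'b" where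
  "conv q f x = integral (cbox 0 1) (\<lambda>y. q y *\<^sub>R f (x + y))"

lemma shift_cont: "continuous_on UNIV f \<Longrightarrow> continuous_on UNIV (\<lambda>y. f (x + y))" for f :: "real^'n \<Rightarrow> 'b::euclidean_space"
  by (rule continuous_on_compose2[of UNIV f]) (auto intro!: continuous_intros)

lemma conv_add:
  assumes "continuous_on UNIV p" "continuous_on UNIV q" "continuous_on UNIV f"
  shows "conv (\<lambda>y. p y + q y) f x = conv p f x + conv q f x"
  unfolding conv_def scaleR_add_left using assms shift_cont[OF assms(3), of x]
  by (intro integral_add cbox_integrable continuous_intros)

lemma conv_scale: "conv (\<lambda>y. c * q y) f x = c *\<^sub>R conv q f x"
  unfolding conv_def by (simp flip: scaleR_scaleR)

text \<open>
  Convolution with an even trigonometric polynomial is a linear combination of Fourier modes.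
\<close>

lemma conv_cosspan_induct [consumes 3, case_names mode add scale]:
  assumes "q \<in> cosspan" "periodic f" "continuous_on UNIV f"
    and "\<And>k. P (\<lambda>y. cos (freq k \<bullet> y)) (fourier_mode f k)"
    and "\<And>p q g h. p \<in> cosspan \<Longrightarrow> q \<in> cosspan \<Longrightarrow> P p g \<Longrightarrow> P q h \<Longrightarrow> P (\<lambda>y. p y + q y) (\<lambda>x. g x + h x)"
    and "\<And>c q g. q \<in> cosspan \<Longrightarrow> P q g \<Longrightarrow> P (\<lambda>y. c * q y) (\<lambda>x. c *\<^sub>R g x)"
  shows "P q (conv q f)"
  using assms(1)
proof induction
  case (cosspan_cos k)
  have "conv (\<lambda>y. cos (freq k \<bullet> y)) f = fourier_mode f k"
    using fourier_mode_conv[OF assms(2,3)] by (auto simp: conv_def)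
  then show ?case using assms(4) by simp
next
  case (cosspan_add p q)
  have "conv (\<lambda>y. p y + q y) f = (\<lambda>x. conv p f x + conv q f x)"
    using conv_add[OF cosspan_cont[OF cosspan_add(1)] cosspan_cont[OF cosspan_add(2)] assms(3)] by auto
  then show ?case using assms(5) cosspan_add by simp
next
  case (cosspan_scale p c)
  have "conv (\<lambda>y. c * p y) f = (\<lambda>x. c *\<^sub>R conv p f x)" by (auto simp: conv_scale)
  then show ?case using assms(6)[OF cosspan_scale] by simp
qed

lemma conv_pd:
  assumes "q \<in> cosspan" and f: "C1_periodic f"
  shows "pd i (conv q f) x = conv q (pd i f) x"
proof -
  have per: "periodic f" "continuous_on UNIV f" "periodic (pd i f)" "continuous_on UNIV (pd i f)"
    using f C1_periodic_cont C1_periodic_pd_periodic by (auto simp: C1_periodic_def)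
  have "smooth (conv q f) \<and> pd i (conv q f) x = conv q (pd i f) x"
    using assms(1) per(1,2)
  proof (induction rule: conv_cosspan_induct)
    case (mode k)
    then show ?case using pd_fourier_mode[OF f] fourier_mode_conv[OF per(3,4)] smooth_fourier_mode[of f k] by (simp add: conv_def)
  next
    case (add p q g h)
    then show ?case
      using conv_add[OF cosspan_cont[OF add(1)] cosspan_cont[OF add(2)] per(4)] smooth_add[of g h]
      by (simp add: pd_add smooth_imp_differentiable)
  next
    case (scale c q g)
    then show ?case using smooth_cmult[of g c] by (simp add: pd_cmult smooth_imp_differentiable conv_scale)
  qed
  then show ?thesis by simp
qed

section \<open>An approximate identity of trigonometric kernels\<close>

lemma content_unit [simp]: "measure lborel (cbox 0 (1::real^'n)) = 1"
  using measure_torus[where 'n='n] unfolding torus_def by (subst (asm) measure_restrict_space) auto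

text \<open>
  Equal to 1 on \<open>Z^d\<close> and smaller elsewhere, so that its normalized powers concentrate there.
\<close>

definition kernel_base :: "real^'n \<Rightarrow> real" where
  "kernel_base y = (\<Prod>i\<in>UNIV. (1 + cos (2 * pi * y $ i)) / 2)"

lemma kernel_base_cosspan: "kernel_base \<in> cosspan"
proof -
  have 1: "(\<lambda>y::real^'n. (1/2) * (1 + cos (freq (axis i 1) \<bullet> y))) \<in> cosspan" for i
    by (intro cosspan.intros cosspan_const)
  have 2: "freq (axis i 1) \<bullet> y = 2 * pi * y $ i" for i and y :: "real^'n"
  proof -
    have "freq (axis i 1) = (2 * pi) *\<^sub>R axis i (1::real)" by (simp add: freq_def axis_def vec_eq_iff)
    then show ?thesis by (simp add: inner_axis')
  qed
  have "(\<lambda>y::real^'n. (1 + cos (2 * pi * y $ i)) / 2) \<in> cosspan" for i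
    using 1[of i] unfolding 2 by simp
  then show ?thesis unfolding kernel_base_def[abs_def] by (intro cosspan_prod)
qed

lemma kernel_base_factor: "0 \<le> (1 + cos (x::real)) / 2" "(1 + cos x) / 2 \<le> 1"
proof -
  define c where "c = cos x"
  have "-1 \<le> c" "c \<le> 1" by (simp_all add: c_def)
  then have "0 \<le> (1 + c) / 2" "(1 + c) / 2 \<le> 1" by simp_all
  then show "0 \<le> (1 + cos x) / 2" "(1 + cos x) / 2 \<le> 1" by (simp_all only: c_def)
qed

lemma kernel_base_bounds: "0 \<le> kernel_base y" "kernel_base y \<le> 1"
  unfolding kernel_base_def by (rule prod_nonneg, rule kernel_base_factor, rule prod_le_1, blast intro: kernel_base_factor)

lemma kernel_base_0: "kernel_base 0 = 1" by (simp add: kernel_base_def)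

lemma kernel_base_less_1:
  assumes "\<And>n::'n\<Rightarrow>int. y \<noteq> (\<chi> i. of_int (n i))"
  shows "kernel_base (y::real^'n) < 1"
proof -
  obtain i where i: "y $ i \<notin> \<int>"
  proof (rule ccontr)
    assume "\<not> thesis"
    then have "\<forall>i. \<exists>n. y $ i = of_int n" using that Ints_cases by metis
    then obtain n where "\<forall>i. y $ i = of_int (n i)" by metis
    then show False using assms[of n] by (simp add: vec_eq_iff)
  qed
  have "cos (2 * pi * y $ i) \<noteq> 1"
  proof
    assume "cos (2 * pi * y $ i) = 1"
    then obtain m :: int where "2 * pi * y $ i = of_int m * 2 * pi" unfolding cos_one_2pi_int by blast
    then have "y $ i = of_int m" by simp
    then show False using i by simp
  qed
  then have "cos (2 * pi * y $ i) < 1" using cos_le_one[of "2 * pi * y $ i"] by (simp add: order_less_le)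
  then have lt: "(1 + cos (2 * pi * y $ i)) / 2 < 1" by simp
  have "kernel_base y = ((1 + cos (2 * pi * y $ i)) / 2) * (\<Prod>i\<in>UNIV-{i}. (1 + cos (2 * pi * y $ i)) / 2)"
    unfolding kernel_base_def by (subst prod.remove[of _ i]) auto
  also have "\<dots> \<le> (1 + cos (2 * pi * y $ i)) / 2"
    using kernel_base_factor by (intro mult_right_le_one_le prod_nonneg prod_le_1) auto
  finally show ?thesis using lt by simp
qed

text \<open>
  The dimension enters through a type argument.
\<close>

definition kernel_mass :: "'n::finite itself \<Rightarrow> nat \<Rightarrow> real" where
  "kernel_mass _ n = integral (cbox 0 1) (\<lambda>y::real^'n. kernel_base y ^ n)"

text \<open>
  The kernel of de la Vallee Poussin, an approximate identity.
\<close>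

definition vp_kernel :: "nat \<Rightarrow> real^'n \<Rightarrow> real" where
  "vp_kernel n y = (1 / kernel_mass TYPE('n) n) * kernel_base y ^ n"

lemma vp_kernel_cosspan: "vp_kernel n \<in> cosspan"
  unfolding vp_kernel_def[abs_def] by (intro cosspan_scale cosspan_power kernel_base_cosspan)

lemma kernel_base_cont: "continuous_on UNIV (\<lambda>y. kernel_base y ^ n)"
  using cosspan_cont[OF kernel_base_cosspan] by (intro continuous_intros)

lemma kernel_mass_lower:
  assumes "0 \<le> s" "s < 1"
  obtains c where "c > 0" "\<And>n. kernel_mass TYPE('n::finite) n \<ge> c * s ^ n"
proof -
  have ic: "isCont (kernel_base :: real^'n \<Rightarrow> real) 0"
    using cosspan_cont[OF kernel_base_cosspan] by (auto simp: continuous_on_eq_continuous_at)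
  have pos: "0 < 1 - s" using assms(2) by simp
  have "\<exists>d>0. \<forall>y::real^'n. dist y 0 < d \<longrightarrow> dist (kernel_base y) (kernel_base (0::real^'n)) < 1 - s"
    by (rule mp[OF spec[OF ic[unfolded continuous_at_eps_delta], of "1 - s"] pos])
  then obtain d where d: "d > 0" "\<forall>y::real^'n. dist y 0 < d \<longrightarrow> dist (kernel_base y) (kernel_base (0::real^'n)) < 1 - s"
    by (elim exE conjE)
  define r where "r = min 1 (d / (2 * real CARD('n)))"
  have r: "0 < r" "r \<le> 1" using d by (auto simp: r_def)
  define u :: "real^'n" where "u = (\<chi> i. r)"
  have big: "kernel_base y \<ge> s" if "y \<in> cbox 0 u" for y
  proof -
    have "norm y \<le> (\<Sum>i\<in>UNIV. \<bar>y $ i\<bar>)" by (rule norm_le_l1_cart)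
    also have "\<dots> \<le> (\<Sum>i\<in>(UNIV::'n set). r)"
      using that by (intro sum_mono) (auto simp: mem_box_cart u_def)
    also have "\<dots> = real CARD('n) * r" by simp
    also have "\<dots> \<le> real CARD('n) * (d / (2 * real CARD('n)))"
      unfolding r_def by (intro mult_left_mono) auto
    also have "\<dots> < d" using d by (simp add: field_simps)
    finally show ?thesis using spec[OF d(2), of y] by (simp add: kernel_base_0 dist_real_def)
  qed
  have sub: "cbox 0 u \<subseteq> cbox 0 1" using r by (auto simp: mem_box_cart u_def) (meson order_trans)
  have "measure lborel (cbox 0 u) > 0" using r by (simp add: content_pos_lt_eq u_def Basis_vec_def inner_axis)
  moreover have "kernel_mass TYPE('n::finite) n \<ge> measure lborel (cbox 0 u) * s ^ n" for n
  proof -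
    have "measure lborel (cbox 0 u) * s ^ n = integral (cbox 0 u) (\<lambda>y. s ^ n)" by simp
    also have "\<dots> \<le> integral (cbox 0 u) (\<lambda>y. kernel_base y ^ n)"
      using assms(1) big by (intro integral_le cbox_integrable kernel_base_cont continuous_intros power_mono) auto
    also have "\<dots> \<le> kernel_mass TYPE('n) n" unfolding kernel_mass_def
      using sub by (intro integral_subset_le cbox_integrable kernel_base_cont) (auto intro: zero_le_power kernel_base_bounds)
    finally show ?thesis .
  qed
  ultimately show ?thesis using that by blast
qed

lemma kernel_mass_pos: "kernel_mass TYPE('n::finite) n > 0"
proof -
  obtain c where c: "c > 0" "\<And>n. kernel_mass TYPE('n::finite) n \<ge> c * (1/2) ^ n"
    using kernel_mass_lower[of "1/2", where 'n='n] by auto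
  have "0 < c * (1/2) ^ n" using c(1) by simp
  then show ?thesis using c(2)[of n] by linarith
qed

lemma vp_kernel_nonneg: "vp_kernel n y \<ge> 0"
  unfolding vp_kernel_def using kernel_mass_pos[of n, where 'n='a] kernel_base_bounds(1)[of y] by simp

lemma vp_kernel_integral: "integral (cbox 0 1) (vp_kernel n :: real^'n \<Rightarrow> real) = 1"
  unfolding vp_kernel_def[abs_def] integral_mult_right using kernel_mass_pos[of n, where 'n='n]
  by (simp add: kernel_mass_def)

lemma vp_kernel_cont: "continuous_on UNIV (vp_kernel n)" by (rule cosspan_cont[OF vp_kernel_cosspan])

lemma conv_vp_kernel_bound:
  fixes f :: "real^'n \<Rightarrow> 'b::euclidean_space"
  assumes "continuous_on UNIV f" "\<And>x. norm (f x) \<le> C"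
  shows "norm (conv (vp_kernel n) f x) \<le> C"
proof -
  have "norm (conv (vp_kernel n) f x) \<le> integral (cbox 0 1) (\<lambda>y::real^'n. vp_kernel n y * C)"
    unfolding conv_def
    by (rule integral_norm_bound_integral; (intro cbox_integrable continuous_intros vp_kernel_cont shift_cont[OF assms(1)])?)
      (simp add: assms(2) mult_left_mono vp_kernel_nonneg)
  then show ?thesis by (simp add: vp_kernel_integral)
qed

text \<open>
  Away from the integer points where the oscillation \<open>|f(x + y) - f(x)|\<close> is small, \<open>kernel_base\<close> is at most
  some \<open>s < 1\<close>, while its \<open>n\<close>-th power has integral at least \<open>c ((1 + s)/2)^n\<close>.
\<close>

lemma conv_vp_kernel_tendsto:
  fixes f :: "real^'n \<Rightarrow> 'b::euclidean_space"
  assumes f: "periodic f" "continuous_on UNIV f"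
  shows "(\<lambda>n. conv (vp_kernel n) f x) \<longlonglongrightarrow> f x"
proof (rule LIMSEQ_I)
  fix e :: real assume e: "e > 0"
  define g where "g y = norm (f (x + y) - f x)" for y
  have gc: "continuous_on UNIV g" unfolding g_def by (intro continuous_intros shift_cont[OF f(2)] f(2))
  obtain C where C: "\<And>x. norm (f x) \<le> C" "C > 0" using periodic_bounded[OF f] by metis
  have gC: "g y \<le> 2 * C" for y unfolding g_def
    using norm_triangle_ineq4[of "f (x+y)" "f x"] C(1)[of "x+y"] C(1)[of x] by linarith
  define S where "S = cbox 0 1 \<inter> {y. e / 2 \<le> g y}"
  have "compact S" unfolding S_def
    by (intro compact_Int_closed compact_cbox closed_Collect_le continuous_intros gc)
  have S1: "kernel_base y < 1" if "y \<in> S" for y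
  proof (rule kernel_base_less_1)
    fix n :: "'n \<Rightarrow> int"
    show "y \<noteq> (\<chi> i. of_int (n i))"
      using periodic_int[OF f(1), of x n] that e by (auto simp: S_def g_def)
  qed
  obtain s where s: "0 \<le> s" "s < 1" "\<And>y. y \<in> S \<Longrightarrow> kernel_base y \<le> s"
  proof (cases "S = {}")
    case True
    then show ?thesis using that[of 0] by simp
  next
    case False
    obtain z where "z \<in> S" "\<forall>y\<in>S. kernel_base y \<le> kernel_base z"
      using continuous_attains_sup[OF \<open>compact S\<close> False continuous_on_subset[OF cosspan_cont[OF kernel_base_cosspan]]] by blast
    then show ?thesis using that[of "kernel_base z"] S1 kernel_base_bounds by blast
  qed
  obtain c where c: "c > 0" "\<And>n. kernel_mass TYPE('n) n \<ge> c * ((1 + s) / 2) ^ n"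
    using kernel_mass_lower[of "(1+s)/2", where 'n='n] s by auto
  let ?\<rho> = "s / ((1 + s) / 2)"
  have rho: "0 \<le> ?\<rho>" "?\<rho> < 1" using s by (auto simp: field_simps)
  have "(\<lambda>n. (2 * C / c) * ?\<rho> ^ n) \<longlonglongrightarrow> (2 * C / c) * 0"
    using rho by (intro tendsto_mult tendsto_const LIMSEQ_realpow_zero)
  then have "(\<lambda>n. (2 * C / c) * ?\<rho> ^ n) \<longlonglongrightarrow> 0" by (simp only: mult_zero_right)
  from LIMSEQ_D[OF this, of "e/2"] e
  obtain N where N: "\<And>n. n \<ge> N \<Longrightarrow> (2 * C / c) * ?\<rho> ^ n < e / 2"
    by (metis abs_less_iff diff_zero half_gt_zero real_norm_def)
  have "norm (conv (vp_kernel n) f x - f x) < e" if "n \<ge> N" for n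
  proof -
    let ?t = "(2 * C / c) * ?\<rho> ^ n"
    have "f x = integral (cbox 0 1) (\<lambda>y::real^'n. vp_kernel n y *\<^sub>R f x)"
      using integral_linear[OF cbox_integrable[OF vp_kernel_cont[of n, where 'a='n]] bounded_linear_scaleR_left[of "f x"], of 0 1]
      unfolding o_def vp_kernel_integral by (simp only: scaleR_one)
    then have "conv (vp_kernel n) f x - f x = conv (vp_kernel n) f x - integral (cbox 0 1) (\<lambda>y::real^'n. vp_kernel n y *\<^sub>R f x)" by simp
    also have "\<dots> = integral (cbox 0 1) (\<lambda>y. vp_kernel n y *\<^sub>R f (x + y) - vp_kernel n y *\<^sub>R f x)"
      unfolding conv_def by (intro integral_diff[symmetric] cbox_integrable continuous_intros vp_kernel_cont shift_cont[OF f(2)] f(2))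
    also have "norm \<dots> \<le> integral (cbox 0 1) (\<lambda>y::real^'n. vp_kernel n y * (e / 2) + ?t)"
    proof (intro integral_norm_bound_integral cbox_integrable continuous_intros vp_kernel_cont shift_cont[OF f(2)] f(2))
      fix y :: "real^'n" assume y: "y \<in> cbox 0 1"
      have eq: "norm (vp_kernel n y *\<^sub>R f (x + y) - vp_kernel n y *\<^sub>R f x) = vp_kernel n y * g y"
        using vp_kernel_nonneg[of n y] by (simp add: g_def flip: scaleR_diff_right)
      show "norm (vp_kernel n y *\<^sub>R f (x + y) - vp_kernel n y *\<^sub>R f x) \<le> vp_kernel n y * (e / 2) + ?t"
      proof (cases "y \<in> S")
        case True
        have "vp_kernel n y \<le> (1 / kernel_mass TYPE('n) n) * s ^ n"
          unfolding vp_kernel_def using s(3)[OF True] kernel_base_bounds(1) kernel_mass_pos[of n, where 'n='n]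
          by (intro mult_left_mono power_mono) auto
        also have "\<dots> \<le> (1 / (c * ((1 + s) / 2) ^ n)) * s ^ n"
          using s c kernel_mass_pos[of n, where 'n='n] by (intro mult_right_mono divide_left_mono) auto
        also have "\<dots> = (1 / c) * ?\<rho> ^ n" by (simp add: power_divide)
        finally have "vp_kernel n y * g y \<le> ((1 / c) * ?\<rho> ^ n) * (2 * C)"
          using gC[of y] c rho by (intro mult_mono) (auto simp: g_def)
        moreover have "vp_kernel n y * (e / 2) \<ge> 0" using vp_kernel_nonneg[of n y] e by simp
        ultimately show ?thesis unfolding eq by (simp add: mult_ac)
      next
        case False
        then have "g y \<le> e / 2" using y by (auto simp: S_def)
        then have "vp_kernel n y * g y \<le> vp_kernel n y * (e / 2)" using vp_kernel_nonneg[of n y] by (intro mult_left_mono)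
        moreover have "?t \<ge> 0" using C c rho by simp
        ultimately show ?thesis unfolding eq by linarith
      qed
    qed
    also have "\<dots> = e / 2 + ?t"
      by (subst integral_add) (auto intro!: cbox_integrable vp_kernel_cont continuous_intros simp: vp_kernel_integral simp del: power_divide)
    also have "\<dots> < e" using N[OF that] by linarith
    finally show ?thesis .
  qed
  then show "\<exists>no. \<forall>n\<ge>no. norm (conv (vp_kernel n) f x - f x) < e" by blast
qed

text \<open>
  Completeness of the trigonometric system.
\<close>

lemma fourier_mode_zero_imp_zero:
  fixes f :: "real^'n \<Rightarrow> 'b::euclidean_space"
  assumes f: "periodic f" "continuous_on UNIV f" and z: "\<And>k x. fourier_mode f k x = 0"
  shows "f x = 0"
proof -
  have "\<forall>x. conv (vp_kernel n) f x = 0" for n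
    using vp_kernel_cosspan f by (induction rule: conv_cosspan_induct) (auto simp: z)
  then show ?thesis using conv_vp_kernel_tendsto[OF f, of x] by (simp add: LIMSEQ_const_iff)
qed

section \<open>Fourier multipliers and Fourier inversion\<close>

lemma fourier_mode_bound:
  fixes f :: "real^'n \<Rightarrow> real"
  assumes "periodic f" "continuous_on UNIV f" "\<And>x. \<bar>f x\<bar> \<le> C"
  shows "\<bar>fourier_mode f k x\<bar> \<le> C"
proof -
  have "norm (integral (cbox 0 1) (\<lambda>y. cos (freq k \<bullet> y) *\<^sub>R f (x + y))) \<le> integral (cbox 0 1) (\<lambda>y::real^'n. C)"
  proof (rule integral_norm_bound_integral)
    show "(\<lambda>y. cos (freq k \<bullet> y) *\<^sub>R f (x + y)) integrable_on cbox 0 1"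
      by (intro cbox_integrable continuous_intros shift_cont[OF assms(2)])
    show "(\<lambda>y::real^'n. C) integrable_on cbox 0 1" by (intro cbox_integrable continuous_intros)
    fix y :: "real^'n"
    have "\<bar>cos (freq k \<bullet> y)\<bar> * \<bar>f (x + y)\<bar> \<le> 1 * C"
      using assms(3)[of "x + y"] by (intro mult_mono) auto
    then show "norm (cos (freq k \<bullet> y) *\<^sub>R f (x + y)) \<le> C" by (simp add: abs_mult)
  qed
  then show ?thesis unfolding fourier_mode_conv[OF assms(1,2), symmetric] by simp
qed

lemma fourier_mode_pd2:
  assumes "smooth f" "periodic f"
  shows "fourier_mode (pd i (pd i f)) k x = - (freq k $ i)\<^sup>2 * fourier_mode f k x"
proof -
  have 1: "C1_periodic f" by (intro C1_periodic_smooth assms)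
  have 2: "C1_periodic (pd i f)" by (intro C1_periodic_smooth smooth_pd assms C1_periodic_pd_periodic 1)
  show ?thesis by (simp add: fourier_mode_def coeff_pd[OF 1] coeff_pd[OF 2] freq_def power2_eq_square algebra_simps)
qed

lemma fourier_mode_diff:
  fixes f :: "real^'n \<Rightarrow> real"
  assumes "continuous_on UNIV f" "continuous_on UNIV g"
  shows "fourier_mode (\<lambda>x. f x - g x) k x = fourier_mode f k x - fourier_mode g k x"
proof -
  have 1: "cos_coeff (\<lambda>x. f x - g x) k = cos_coeff f k - cos_coeff g k"
    unfolding cos_coeff_def scaleR_diff_right by (intro integral_diff cbox_integrable continuous_intros assms)
  have 2: "sin_coeff (\<lambda>x. f x - g x) k = sin_coeff f k - sin_coeff g k"
    unfolding sin_coeff_def scaleR_diff_right by (intro integral_diff cbox_integrable continuous_intros assms)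
  show ?thesis unfolding fourier_mode_def 1 2 by (simp add: algebra_simps)
qed

text \<open>
  The weight \<open>\<Prod>_i (1 + (2\<pi>k_i)^2)\<close>, the symbol of the differential operator \<open>\<Prod>_i (1 - \<partial>_i^2)\<close>. Its inverse is
  summable over \<open>Z^d\<close>.
\<close>

definition freq_weight :: "int^'n \<Rightarrow> real" where
  "freq_weight k = (\<Prod>i\<in>UNIV. 1 + (freq k $ i)\<^sup>2)"

lemma freq_weight_pos: "freq_weight k > 0"
  unfolding freq_weight_def by (intro prod_pos) (auto intro: add_pos_nonneg)

text \<open>
  Induction over the coordinates, replacing \<open>f\<close> by \<open>f - \<partial>_i^2 f\<close> in each step.
\<close>

lemma fourier_mode_decay:
  fixes f :: "real^'n \<Rightarrow> real"
  assumes "smooth f" "periodic f"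
  obtains C where "\<And>k x. \<bar>fourier_mode f k x\<bar> \<le> C / freq_weight k" "C \<ge> 0"
proof -
  have "\<exists>C. \<forall>k x. \<bar>fourier_mode f k x\<bar> * (\<Prod>i\<in>I. 1 + (freq k $ i)\<^sup>2) \<le> C" if "finite I" for I
    using that assms
  proof (induction I arbitrary: f)
    case empty
    obtain C where "\<And>x. norm (f x) \<le> C" using periodic_bounded[OF empty(2) smooth_imp_continuous[OF empty(1)]] by metis
    then have "\<bar>fourier_mode f k x\<bar> \<le> C" for k x
      by (intro fourier_mode_bound[OF empty(2) smooth_imp_continuous[OF empty(1)]]) auto
    then show ?case by auto
  next
    case (insert i I)
    let ?g = "\<lambda>x. f x - pd i (pd i f) x"
    have 1: "C1_periodic f" by (intro C1_periodic_smooth insert)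
    have 2: "C1_periodic (pd i f)" by (intro C1_periodic_smooth smooth_pd insert C1_periodic_pd_periodic 1)
    have g: "smooth ?g" by (intro smooth_diff smooth_pd insert)
    have gp: "periodic ?g" using insert(5) C1_periodic_pd_periodic[OF 2, of i] by (simp add: periodic_def)
    obtain C where C: "\<And>k x. \<bar>fourier_mode ?g k x\<bar> * (\<Prod>i\<in>I. 1 + (freq k $ i)\<^sup>2) \<le> C"
      using insert(3)[OF g gp] by blast
    have "fourier_mode ?g k x = (1 + (freq k $ i)\<^sup>2) * fourier_mode f k x" for k x
      by (simp add: fourier_mode_diff smooth_imp_continuous smooth_pd insert fourier_mode_pd2 algebra_simps)
    then have "\<bar>fourier_mode f k x\<bar> * (\<Prod>i\<in>insert i I. 1 + (freq k $ i)\<^sup>2) = \<bar>fourier_mode ?g k x\<bar> * (\<Prod>i\<in>I. 1 + (freq k $ i)\<^sup>2)" for k x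
      using insert(1,2) by (simp add: abs_mult mult_ac)
    then show ?case using C by auto
  qed
  from this[of UNIV] obtain C where C: "\<And>k x. \<bar>fourier_mode f k x\<bar> * freq_weight k \<le> C" by (auto simp: freq_weight_def)
  have "\<bar>fourier_mode f 0 0\<bar> * freq_weight (0::int^'n) \<ge> 0" using freq_weight_pos[of "0::int^'n"] by (simp add: less_imp_le)
  then have "C \<ge> 0" using C[of 0 0] by linarith
  moreover have "\<bar>fourier_mode f k x\<bar> \<le> C / freq_weight k" for k x using C[of k x] freq_weight_pos[of k] by (simp add: field_simps)
  ultimately show ?thesis using that by blast
qed

lemma sum_freq_weight_bounded:
  obtains A where "\<And>F::(int^'n) set. finite F \<Longrightarrow> (\<Sum>k\<in>F. 1 / freq_weight k) \<le> A"
proof -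
  define a :: "int \<Rightarrow> real" where "a m = 1 / (1 + (2 * pi * of_int m)\<^sup>2)" for m
  have a0: "a m \<ge> 0" for m by (simp add: a_def)
  have am: "a (- m) = a m" for m by (simp add: a_def)
  have le: "a (int m) \<le> inverse (of_nat m ^ 2)" if "m > 0" for m
  proof -
    have "1 \<le> 2 * pi" using pi_gt3 by linarith
    then have "real m * 1 \<le> real m * (2 * pi)" by (intro mult_left_mono) auto
    then have "(real m)\<^sup>2 \<le> (2 * pi * real m)\<^sup>2" by (intro power_mono) (auto simp: mult_ac)
    then have "(real m)\<^sup>2 \<le> 1 + (2 * pi * real m)\<^sup>2" by linarith
    then show ?thesis using that by (simp add: a_def inverse_eq_divide frac_le)
  qed
  have "summable (\<lambda>m::nat. inverse (of_nat m ^ 2) :: real)" by (rule inverse_power_summable) simp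
  then have "summable (\<lambda>m::nat. a (int m))"
    by (rule summable_comparison_test'[where N=1]) (use le a0 in auto)
  then obtain S where S: "\<And>N. (\<Sum>m<N. a (int m)) \<le> S"
    using a0 sum_le_suminf[of "\<lambda>m. a (int m)"] by blast
  have int: "(\<Sum>m\<in>{-int N..int N}. a m) \<le> S + S" for N
  proof -
    have "(\<Sum>m\<in>{-int N..int N}. a m) \<le> (\<Sum>m\<in>(int ` {..<Suc N}) \<union> ((\<lambda>m. - int m) ` {..<Suc N}). a m)"
    proof (rule sum_mono2)
      show "{-int N..int N} \<subseteq> (int ` {..<Suc N}) \<union> ((\<lambda>m. - int m) ` {..<Suc N})"
      proof
        fix x assume x: "x \<in> {-int N..int N}"
        then show "x \<in> (int ` {..<Suc N}) \<union> ((\<lambda>m. - int m) ` {..<Suc N})"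
        proof (cases "x \<ge> 0")
          case True
          then have "x = int (nat x)" "nat x \<in> {..<Suc N}" using x by auto
          then show ?thesis by blast
        next
          case False
          then have "x = - int (nat (- x))" "nat (- x) \<in> {..<Suc N}" using x by auto
          then show ?thesis by blast
        qed
      qed
    qed (use a0 in auto)
    also have "\<dots> \<le> (\<Sum>m\<in>int ` {..<Suc N}. a m) + (\<Sum>m\<in>(\<lambda>m. - int m) ` {..<Suc N}. a m)"
      by (subst sum.union_inter[symmetric]) (auto intro!: sum_nonneg a0)
    also have "\<dots> = (\<Sum>m<Suc N. a (int m)) + (\<Sum>m<Suc N. a (int m))"
      by (subst (1 2) sum.reindex) (auto simp: inj_on_def am simp del: sum.lessThan_Suc)
    also have "\<dots> \<le> S + S" using S by (intro add_mono) blast+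
    finally show ?thesis .
  qed
  have "(\<Sum>k\<in>F. 1 / freq_weight k) \<le> (S + S) ^ CARD('n)" if F: "finite F" for F :: "(int^'n) set"
  proof -
    define N where "N = Max (insert 0 ((\<lambda>(k,i). nat \<bar>k $ i\<bar>) ` (F \<times> UNIV)))"
    have N: "\<bar>k $ i\<bar> \<le> int N" if "k \<in> F" for k i
    proof -
      have "nat \<bar>k $ i\<bar> \<le> N" unfolding N_def using F that by (intro Max_ge) (auto intro!: image_eqI[of _ _ "(k,i)"])
      then show ?thesis by linarith
    qed
    have "(\<Sum>k\<in>F. 1 / freq_weight k) = (\<Sum>k\<in>F. \<Prod>i\<in>UNIV. a (k $ i))"
      by (simp add: freq_weight_def a_def freq_def prod_dividef)
    also have "\<dots> = (\<Sum>g\<in>vec_nth ` F. \<Prod>i\<in>UNIV. a (g i))"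
      by (subst sum.reindex) (auto simp: inj_on_def vec_nth_inject)
    also have "\<dots> \<le> (\<Sum>g\<in>PiE (UNIV::'n set) (\<lambda>_. {-int N..int N}). \<Prod>i\<in>UNIV. a (g i))"
    proof (rule sum_mono2)
      show "vec_nth ` F \<subseteq> PiE (UNIV::'n set) (\<lambda>_. {-int N..int N})"
      proof
        fix g assume "g \<in> vec_nth ` F"
        then obtain k where "k \<in> F" "g = vec_nth k" by blast
        then have "g i \<in> {-int N..int N}" for i using N[of k i] by (simp add: abs_le_iff)
        then show "g \<in> PiE (UNIV::'n set) (\<lambda>_. {-int N..int N})" by (simp add: PiE_UNIV_domain)
      qed
      show "finite (PiE (UNIV::'n set) (\<lambda>_. {-int N..int N}))" by (intro finite_PiE) auto
    qed (simp add: prod_nonneg a0)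
    also have "\<dots> = (\<Prod>i\<in>(UNIV::'n set). \<Sum>m\<in>{-int N..int N}. a m)"
      by (subst prod_sum_PiE) auto
    also have "\<dots> = (\<Sum>m\<in>{-int N..int N}. a m) ^ CARD('n)" by simp
    also have "\<dots> \<le> (S + S) ^ CARD('n)" by (intro power_mono int sum_nonneg a0)
    finally show ?thesis .
  qed
  then show ?thesis using that by blast
qed

text \<open>
  An enumeration of \<open>Z^d\<close>, which turns sums over frequencies into series.
\<close>

definition freq_enum :: "nat \<Rightarrow> int^'n" where
  "freq_enum = from_nat_into UNIV"

lemma freq_enum_bij: "bij (freq_enum :: nat \<Rightarrow> int^'n)"
proof -
  have "inj (\<lambda>m::int. (\<chi> i. m) :: int^'n)" by (auto simp: inj_def vec_eq_iff)
  then have "infinite (UNIV :: (int^'n) set)"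
    using finite_subset[OF subset_UNIV] finite_imageD infinite_UNIV_int by blast
  then show ?thesis unfolding freq_enum_def by (intro bij_betw_from_nat_into countableI_type)
qed

lemma summable_freq_weight: "summable (\<lambda>n. C / freq_weight (freq_enum n :: int^'n))"
proof -
  obtain A where A: "\<And>F::(int^'n) set. finite F \<Longrightarrow> (\<Sum>k\<in>F. 1 / freq_weight k) \<le> A" using sum_freq_weight_bounded by blast
  have inj: "inj (freq_enum :: nat \<Rightarrow> int^'n)" by (rule bij_is_inj[OF freq_enum_bij])
  have "summable (\<lambda>n. 1 / freq_weight (freq_enum n :: int^'n))"
  proof (rule summableI_nonneg_bounded)
    show "0 \<le> 1 / freq_weight (freq_enum n :: int^'n)" for n using freq_weight_pos[of "freq_enum n :: int^'n"] by simp
    show "(\<Sum>i<n. 1 / freq_weight (freq_enum i :: int^'n)) \<le> A" for n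
      using A[of "freq_enum ` {..<n}"] sum.reindex[of "freq_enum :: nat \<Rightarrow> int^'n" "{..<n}" "\<lambda>k. 1 / freq_weight k"]
        inj_on_subset[OF inj, of "{..<n}"] by (simp add: o_def)
  qed
  then have "summable (\<lambda>n. C * (1 / freq_weight (freq_enum n :: int^'n)))" by (rule summable_mult)
  then show ?thesis by simp
qed

text \<open>
  The Fourier multiplier with symbol \<open>c\<close>. It commutes with derivatives, whence the smoothness of its values.
\<close>

definition multiplier :: "(int^'n \<Rightarrow> real) \<Rightarrow> (real^'n \<Rightarrow> real) \<Rightarrow> real^'n \<Rightarrow> real" where
  "multiplier c f x = (\<Sum>n. c (freq_enum n) * fourier_mode f (freq_enum n) x)"

context
  fixes c :: "int^'n \<Rightarrow> real"
  assumes c: "\<And>k. \<bar>c k\<bar> \<le> 1"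
begin

lemma multiplier_uniform:
  assumes "smooth f" "periodic f"
  shows "uniform_limit UNIV (\<lambda>N x. \<Sum>n<N. c (freq_enum n) * fourier_mode f (freq_enum n) x) (multiplier c f) sequentially"
    and "summable (\<lambda>n. c (freq_enum n) * fourier_mode f (freq_enum n) x)"
proof -
  obtain C where C: "\<And>k x. \<bar>fourier_mode f k x\<bar> \<le> C / freq_weight k" "C \<ge> 0" using fourier_mode_decay[OF assms] by metis
  have le: "norm (c (freq_enum n) * fourier_mode f (freq_enum n) x) \<le> C / freq_weight (freq_enum n :: int^'n)" for n x
  proof -
    have "\<bar>c (freq_enum n)\<bar> * \<bar>fourier_mode f (freq_enum n) x\<bar> \<le> 1 * (C / freq_weight (freq_enum n :: int^'n))"
      by (intro mult_mono c C) auto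
    then show ?thesis by (simp add: abs_mult)
  qed
  show "uniform_limit UNIV (\<lambda>N x. \<Sum>n<N. c (freq_enum n) * fourier_mode f (freq_enum n) x) (multiplier c f) sequentially"
    unfolding multiplier_def[abs_def] by (rule Weierstrass_m_test[OF le summable_freq_weight])
  show "summable (\<lambda>n. c (freq_enum n) * fourier_mode f (freq_enum n) x)"
    by (rule summable_comparison_test'[OF summable_freq_weight le])
qed

lemma multiplier_derivative:
  assumes f: "smooth f" "periodic f"
  shows "(multiplier c f has_derivative (\<lambda>h. \<Sum>i\<in>UNIV. h $ i * multiplier c (pd i f) x)) (at x)"
proof -
  have C1: "C1_periodic f" by (intro C1_periodic_smooth f)
  have pf: "smooth (pd i f)" "periodic (pd i f)" for i
    by (intro smooth_pd f C1_periodic_pd_periodic C1)+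
  have "\<exists>g. \<forall>x\<in>UNIV. (\<lambda>n. c (freq_enum n) * fourier_mode f (freq_enum n) x) sums (g x) \<and>
    (g has_derivative (\<lambda>h. \<Sum>i\<in>UNIV. h $ i * multiplier c (pd i f) x)) (at x within UNIV)"
  proof (rule has_derivative_series[where f' = "\<lambda>n x h. \<Sum>i\<in>UNIV. h $ i * (c (freq_enum n) * fourier_mode (pd i f) (freq_enum n) x)"])
    show "((\<lambda>x. c (freq_enum n) * fourier_mode f (freq_enum n) x) has_derivative
        (\<lambda>h. \<Sum>i\<in>UNIV. h $ i * (c (freq_enum n) * fourier_mode (pd i f) (freq_enum n) x))) (at x within UNIV)" for n x
    proof -
      have "smooth (\<lambda>x. c (freq_enum n) * fourier_mode f (freq_enum n) x)" by (intro smooth_cmult smooth_fourier_mode)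
      then have d: "(\<lambda>x. c (freq_enum n) * fourier_mode f (freq_enum n) x) differentiable (at x)" by (rule smooth_imp_differentiable)
      have "frechet_derivative (\<lambda>x. c (freq_enum n) * fourier_mode f (freq_enum n) x) (at x) =
        (\<lambda>h. \<Sum>i\<in>UNIV. h $ i * (c (freq_enum n) * fourier_mode (pd i f) (freq_enum n) x))"
        using frechet_derivative_sum_pd[OF d]
        by (auto simp: pd_cmult smooth_imp_differentiable[OF smooth_fourier_mode] pd_fourier_mode[OF C1])
      then show ?thesis using differentiable_derivative[OF d] by simp
    qed
    fix e :: real assume e: "e > 0"
    let ?d = "real CARD('n)"
    have "\<forall>\<^sub>F N in sequentially. \<forall>i. \<forall>x\<in>UNIV. dist (\<Sum>n<N. c (freq_enum n) * fourier_mode (pd i f) (freq_enum n) x) (multiplier c (pd i f) x) < e / ?d"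
      using e multiplier_uniform(1)[OF pf] unfolding uniform_limit_iff by (intro eventually_all_finite) auto
    then show "\<forall>\<^sub>F N in sequentially. \<forall>x\<in>UNIV. \<forall>h. norm ((\<Sum>n<N. \<Sum>i\<in>UNIV. h $ i * (c (freq_enum n) * fourier_mode (pd i f) (freq_enum n) x))
        - (\<Sum>i\<in>UNIV. h $ i * multiplier c (pd i f) x)) \<le> e * norm h"
    proof eventually_elim
      case (elim N)
      show ?case
      proof (intro ballI allI)
        fix x h :: "real^'n"
        have "(\<Sum>n<N. \<Sum>i\<in>UNIV. h $ i * (c (freq_enum n) * fourier_mode (pd i f) (freq_enum n) x)) - (\<Sum>i\<in>UNIV. h $ i * multiplier c (pd i f) x)
          = (\<Sum>i\<in>UNIV. h $ i * ((\<Sum>n<N. c (freq_enum n) * fourier_mode (pd i f) (freq_enum n) x) - multiplier c (pd i f) x))"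
          by (subst sum.swap) (simp add: right_diff_distrib sum_subtractf sum_distrib_left)
        also have "norm \<dots> \<le> (\<Sum>i\<in>(UNIV::'n set). norm h * (e / ?d))"
        proof (rule sum_norm_le)
          fix i
          have "\<bar>h $ i\<bar> * \<bar>(\<Sum>n<N. c (freq_enum n) * fourier_mode (pd i f) (freq_enum n) x) - multiplier c (pd i f) x\<bar> \<le> norm h * (e / ?d)"
          proof (intro mult_mono component_le_norm_cart)
            have "dist (\<Sum>n<N. c (freq_enum n) * fourier_mode (pd i f) (freq_enum n) x) (multiplier c (pd i f) x) < e / ?d"
              using elim by blast
            then show "\<bar>(\<Sum>n<N. c (freq_enum n) * fourier_mode (pd i f) (freq_enum n) x) - multiplier c (pd i f) x\<bar> \<le> e / ?d"
              by (simp add: dist_real_def)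
          qed auto
          then show "norm (h $ i * ((\<Sum>n<N. c (freq_enum n) * fourier_mode (pd i f) (freq_enum n) x) - multiplier c (pd i f) x)) \<le> norm h * (e / ?d)"
            by (simp add: abs_mult)
        qed
        also have "\<dots> = e * norm h" by simp
        finally show "norm ((\<Sum>n<N. \<Sum>i\<in>UNIV. h $ i * (c (freq_enum n) * fourier_mode (pd i f) (freq_enum n) x))
        - (\<Sum>i\<in>UNIV. h $ i * multiplier c (pd i f) x)) \<le> e * norm h" .
      qed
    qed
  qed (auto intro: summable_sums[OF multiplier_uniform(2)[OF f, of 0]])
  then obtain g where g: "\<And>x. (\<lambda>n. c (freq_enum n) * fourier_mode f (freq_enum n) x) sums (g x)"
    "\<And>x. (g has_derivative (\<lambda>h. \<Sum>i\<in>UNIV. h $ i * multiplier c (pd i f) x)) (at x)" by auto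
  have "g = multiplier c f" using g(1) by (auto simp: multiplier_def sums_iff)
  then show ?thesis using g(2) by simp
qed

lemma pd_multiplier:
  assumes f: "smooth f" "periodic f"
  shows "pd i (multiplier c f) = multiplier c (pd i f)"
  using pd_eq[OF multiplier_derivative[OF f]]
  by (auto simp: axis_def if_distrib[of "\<lambda>x. x * _"] cong: if_cong)

lemma multiplier_smooth:
  assumes f: "smooth f" "periodic f"
  shows "smooth (multiplier c f)"
proof (rule smooth_coinduct[of _ "{g. \<exists>f. smooth f \<and> periodic f \<and> g = multiplier c f}"])
  show "multiplier c f \<in> {g. \<exists>f. smooth f \<and> periodic f \<and> g = multiplier c f}" using f by blast
  fix g x assume "g \<in> {g. \<exists>f. smooth f \<and> periodic f \<and> g = multiplier c f}"
  then obtain f where "smooth f" "periodic f" "g = multiplier c f" by blast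
  then show "g differentiable (at x)" using multiplier_derivative by (auto simp: differentiable_def)
next
  fix g and b :: "real^'n" assume g: "g \<in> {g. \<exists>f. smooth f \<and> periodic f \<and> g = multiplier c f}" and b: "b \<in> Basis"
  then obtain f where f: "smooth f" "periodic f" "g = multiplier c f" by blast
  obtain i where i: "b = axis i 1" using b by (auto simp: Basis_vec_def)
  have "(\<lambda>x. frechet_derivative g (at x) b) = multiplier c (pd i f)"
    using pd_multiplier[OF f(1,2), of i] unfolding i f(3) pd_def by (simp add: fun_eq_iff pd_def)
  moreover have "smooth (pd i f)" "periodic (pd i f)"
    by (intro smooth_pd f C1_periodic_pd_periodic C1_periodic_smooth)+
  ultimately show "(\<lambda>x. frechet_derivative g (at x) b) \<in> {g. \<exists>f. smooth f \<and> periodic f \<and> g = multiplier c f}" by blast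
qed

lemma multiplier_periodic: "periodic (multiplier c f)"
  by (simp add: periodic_def multiplier_def periodicD[OF periodic_fourier_mode])

end

lemma integral_cos_freq: "integral (cbox 0 1) (\<lambda>x::real^'n. cos (freq k \<bullet> x)) = (if k = 0 then 1 else 0)"
  "integral (cbox 0 1) (\<lambda>x::real^'n. sin (freq k \<bullet> x)) = 0"
proof -
  have "integral (cbox 0 1) (\<lambda>x::real^'n. cos (freq k \<bullet> x)) = 0 \<and> integral (cbox 0 1) (\<lambda>x::real^'n. sin (freq k \<bullet> x)) = 0"
    if A: "k \<noteq> 0"
  proof -
    obtain i where i: "k $ i \<noteq> 0" using A by (auto simp: vec_eq_iff)
    let ?a = "2 * pi * of_int (k $ i) :: real"
    have p: "pd i (\<lambda>x. sin (freq k \<bullet> x)) = (\<lambda>x. ?a * cos (freq k \<bullet> x))"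
      "pd i (\<lambda>x. cos (freq k \<bullet> x)) = (\<lambda>x. - ?a * sin (freq k \<bullet> x))"
      by (auto simp: pd_cos_freq)
    have "0 = integral (cbox 0 1) (\<lambda>x::real^'n. ?a * cos (freq k \<bullet> x))"
      using C1_periodic_pd_integral[OF C1_periodic_trig(2)[of k], of i] unfolding p by simp
    moreover have "0 = integral (cbox 0 1) (\<lambda>x::real^'n. - ?a * sin (freq k \<bullet> x))"
      using C1_periodic_pd_integral[OF C1_periodic_trig(1)[of k], of i] unfolding p by simp
    ultimately show ?thesis using i unfolding integral_mult_right by simp
  qed
  then show "integral (cbox 0 1) (\<lambda>x::real^'n. cos (freq k \<bullet> x)) = (if k = 0 then 1 else 0)"
    "integral (cbox 0 1) (\<lambda>x::real^'n. sin (freq k \<bullet> x)) = 0" by (cases "k = 0"; simp)+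
qed

text \<open>
  Orthogonality of the trigonometric system.
\<close>

lemma fourier_mode_fourier_mode:
  fixes f :: "real^'n \<Rightarrow> real"
  shows "fourier_mode (fourier_mode f l) k x = ((if l = k then 1 else 0) + (if l = - k then 1 else 0)) / 2 * fourier_mode f l x"
proof -
  let ?B = "- sin (freq l \<bullet> x) * cos_coeff f l + cos (freq l \<bullet> x) * sin_coeff f l"
  have c: "continuous_on UNIV (\<lambda>y::real^'n. cos (freq m \<bullet> y))" "continuous_on UNIV (\<lambda>y::real^'n. sin (freq m \<bullet> y))" for m
    by (intro continuous_intros)+
  have "fourier_mode (fourier_mode f l) k x = integral (cbox 0 1) (\<lambda>y. cos (freq k \<bullet> y) *\<^sub>R fourier_mode f l (x + y))"
    by (intro fourier_mode_conv periodic_fourier_mode smooth_imp_continuous smooth_fourier_mode)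
  also have "(\<lambda>y. cos (freq k \<bullet> y) *\<^sub>R fourier_mode f l (x + y)) =
    (\<lambda>y. fourier_mode f l x / 2 * (cos (freq (l - k) \<bullet> y) + cos (freq (l + k) \<bullet> y)) + ?B / 2 * (sin (freq (l + k) \<bullet> y) + sin (freq (l - k) \<bullet> y)))"
    by (auto simp: fourier_mode_def freq_add freq_diff inner_add_right inner_add_left inner_diff_left cos_add sin_add cos_diff sin_diff field_simps)
  also have "integral (cbox 0 1) \<dots> = fourier_mode f l x / 2 * ((if l - k = 0 then 1 else 0) + (if l + k = 0 then 1 else 0))"
    by (subst integral_add, (intro cbox_integrable continuous_intros)+, subst (1 2) integral_mult_right,
      subst (1 2) integral_add, (intro cbox_integrable continuous_intros)+) (simp only: integral_cos_freq, simp)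
  finally show ?thesis by (simp add: eq_neg_iff_add_eq_0 mult_ac)
qed

theorem fourier_inversion:
  fixes f :: "real^'n \<Rightarrow> real"
  assumes f: "smooth f" "periodic f"
  shows "multiplier (\<lambda>_. 1) f x = f x"
proof -
  let ?m = "multiplier (\<lambda>_. 1) f"
  have ms: "smooth ?m" "periodic ?m" by (intro multiplier_smooth multiplier_periodic f; simp)+
  have u: "uniform_limit UNIV (\<lambda>N x. \<Sum>n<N. fourier_mode f (freq_enum n) x) ?m sequentially"
    using multiplier_uniform(1)[OF _ f, of "\<lambda>_. 1"] by simp
  have "fourier_mode ?m k x = fourier_mode f k x" for k x
  proof -
    have "uniform_limit (cbox 0 1) (\<lambda>N y. \<Sum>n<N. fourier_mode f (freq_enum n) (x + y)) (\<lambda>y. ?m (x + y)) sequentially"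
      using u by (rule uniform_limit_compose') auto
    then have "uniform_limit (cbox 0 1) (\<lambda>N y. cos (freq k \<bullet> y) * (\<Sum>n<N. fourier_mode f (freq_enum n) (x + y))) (\<lambda>y. cos (freq k \<bullet> y) * ?m (x + y)) sequentially"
      by (intro uniform_lim_mult uniform_limit_const)
         (auto intro!: compact_imp_bounded compact_continuous_image continuous_intros continuous_on_compose2[OF smooth_imp_continuous[OF ms(1)]])
    then obtain I J where IJ: "\<And>N. ((\<lambda>y. cos (freq k \<bullet> y) * (\<Sum>n<N. fourier_mode f (freq_enum n) (x + y))) has_integral I N) (cbox 0 1)"
      "((\<lambda>y. cos (freq k \<bullet> y) * ?m (x + y)) has_integral J) (cbox 0 1)" "I \<longlonglongrightarrow> J"
      by (rule uniform_limit_integral_cbox)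
        (auto intro!: continuous_intros continuous_on_compose2[OF smooth_imp_continuous[OF smooth_fourier_mode]])
    have J: "J = fourier_mode ?m k x"
      using integral_unique[OF IJ(2)] fourier_mode_conv[OF ms(2) smooth_imp_continuous[OF ms(1)], of k x] by simp
    have "I N = (\<Sum>n<N. fourier_mode (fourier_mode f (freq_enum n)) k x)" for N
    proof -
      have "I N = integral (cbox 0 1) (\<lambda>y. \<Sum>n<N. cos (freq k \<bullet> y) * fourier_mode f (freq_enum n) (x + y))"
        using integral_unique[OF IJ(1)[of N]] by (simp add: sum_distrib_left)
      also have "\<dots> = (\<Sum>n<N. integral (cbox 0 1) (\<lambda>y. cos (freq k \<bullet> y) *\<^sub>R fourier_mode f (freq_enum n) (x + y)))"
        unfolding real_scaleR_def
        by (intro integral_sum) (auto intro!: cbox_integrable continuous_intros continuous_on_compose2[OF smooth_imp_continuous[OF smooth_fourier_mode]])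
      also have "\<dots> = (\<Sum>n<N. fourier_mode (fourier_mode f (freq_enum n)) k x)"
        by (intro sum.cong refl fourier_mode_conv[symmetric] periodic_fourier_mode smooth_imp_continuous smooth_fourier_mode)
      finally show ?thesis .
    qed
    then have "I = (\<lambda>N. \<Sum>n<N. fourier_mode (fourier_mode f (freq_enum n)) k x)" by auto
    then have "(\<lambda>n. fourier_mode (fourier_mode f (freq_enum n)) k x) sums fourier_mode ?m k x"
      using IJ(3) unfolding sums_def J by simp
    moreover have "(\<lambda>n. fourier_mode (fourier_mode f (freq_enum n)) k x) sums fourier_mode f k x"
    proof -
      obtain n1 n2 where n: "freq_enum n1 = k" "freq_enum n2 = - k"
        using bij_is_surj[OF freq_enum_bij] by (metis surjD)
      have iff: "freq_enum n = k \<longleftrightarrow> n = n1" "freq_enum n = - k \<longleftrightarrow> n = n2" for n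
        using n inj_eq[OF bij_is_inj[OF freq_enum_bij]] by metis+
      have eq: "fourier_mode (fourier_mode f (freq_enum n)) k x = (if n = n1 then fourier_mode f k x / 2 else 0) + (if n = n2 then fourier_mode f k x / 2 else 0)" for n
      proof -
        have "fourier_mode f (- k) x = fourier_mode f k x" by (simp add: fourier_mode_def cos_coeff_def sin_coeff_def freq_minus)
        then show ?thesis unfolding fourier_mode_fourier_mode iff using n by auto
      qed
      have "(\<lambda>n. (if n = n1 then fourier_mode f k x / 2 else 0) + (if n = n2 then fourier_mode f k x / 2 else 0)) sums (fourier_mode f k x / 2 + fourier_mode f k x / 2)"
        by (intro sums_add sums_single)
      then show ?thesis unfolding eq by simp
    qed
    ultimately show ?thesis by (rule sums_unique2)
  qed
  then have "fourier_mode (\<lambda>x. f x - ?m x) k x = 0" for k x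
    by (subst fourier_mode_diff) (auto intro: smooth_imp_continuous f ms)
  moreover have "periodic (\<lambda>x. f x - ?m x)" using f(2) ms(2) by (simp add: periodic_def)
  moreover have "continuous_on UNIV (\<lambda>x. f x - ?m x)" by (intro continuous_intros smooth_imp_continuous f ms)
  ultimately have "f x - ?m x = 0" by (intro fourier_mode_zero_imp_zero[of "\<lambda>x. f x - ?m x"])
  then show ?thesis by simp
qed

section \<open>The Poisson equation on the torus\<close>

lemma fourier_mode_sum:
  fixes f :: "'a \<Rightarrow> real^'n \<Rightarrow> real"
  assumes "finite I" "\<And>i. i \<in> I \<Longrightarrow> continuous_on UNIV (f i)"
  shows "fourier_mode (\<lambda>x. \<Sum>i\<in>I. f i x) k x = (\<Sum>i\<in>I. fourier_mode (f i) k x)"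
proof -
  have 1: "cos_coeff (\<lambda>x. \<Sum>i\<in>I. f i x) k = (\<Sum>i\<in>I. cos_coeff (f i) k)"
    unfolding cos_coeff_def scaleR_sum_right by (intro integral_sum cbox_integrable continuous_intros assms)
  have 2: "sin_coeff (\<lambda>x. \<Sum>i\<in>I. f i x) k = (\<Sum>i\<in>I. sin_coeff (f i) k)"
    unfolding sin_coeff_def scaleR_sum_right by (intro integral_sum cbox_integrable continuous_intros assms)
  show ?thesis unfolding fourier_mode_def 1 2 by (simp add: sum.distrib sum_distrib_left)
qed

lemma freq_norm: "(\<Sum>i\<in>UNIV. (freq k $ i)\<^sup>2) = 0 \<longleftrightarrow> k = 0"
  by (subst sum_nonneg_eq_0_iff) (auto simp: freq_def vec_eq_iff)

lemma freq_norm_ge: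
  assumes "k \<noteq> 0" shows "(\<Sum>i\<in>UNIV. (freq k $ i)\<^sup>2) \<ge> 1"
proof -
  obtain i where i: "k $ i \<noteq> 0" using assms by (auto simp: vec_eq_iff)
  have "(freq k $ i)\<^sup>2 = (2 * pi)\<^sup>2 * (of_int (k $ i))\<^sup>2" by (simp add: freq_def power_mult_distrib)
  moreover have "(2 * pi)\<^sup>2 \<ge> (1::real)" using pi_gt3 by (intro one_le_power) linarith
  moreover have "(of_int (k $ i))\<^sup>2 \<ge> (1::real)"
  proof -
    have "1 \<le> \<bar>k $ i\<bar>" using i by simp
    then have "1 \<le> \<bar>real_of_int (k $ i)\<bar>" by linarith
    then have "1 \<le> \<bar>real_of_int (k $ i)\<bar>\<^sup>2" by (rule one_le_power)
    then show ?thesis by simp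
  qed
  ultimately have "(freq k $ i)\<^sup>2 \<ge> 1 * 1" by (metis mult_mono zero_le_one zero_le_power2)
  then show ?thesis using member_le_sum[of i UNIV "\<lambda>i. (freq k $ i)\<^sup>2"] by simp
qed

lemma periodic_pd_smooth: "smooth f \<Longrightarrow> periodic f \<Longrightarrow> periodic (pd i f)"
  by (intro C1_periodic_pd_periodic C1_periodic_smooth)

lemma periodic_sum: "(\<And>i. i \<in> I \<Longrightarrow> periodic (f i)) \<Longrightarrow> periodic (\<lambda>x. \<Sum>i\<in>I. f i x)"
  by (simp add: periodic_def)

lemma torus_integral_smooth:
  fixes f :: "real^'n \<Rightarrow> 'b::euclidean_space"
  shows "continuous_on UNIV f \<Longrightarrow> (\<integral>x. f x \<partial>torus) = integral (cbox 0 1) f"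
  by (rule torus_integral(2), erule continuous_on_subset) simp

lemma fourier_mode_0: "fourier_mode f 0 x = integral (cbox 0 1) f"
  by (simp add: fourier_mode_def cos_coeff_def)

lemma laplacian_diff:
  assumes "smooth f" "smooth g"
  shows "laplacian (\<lambda>x. f x - g x) x = laplacian f x - laplacian g x"
proof -
  have "pd i (\<lambda>x. f x - g x) = (\<lambda>x. pd i f x - pd i g x)" for i
    using assms by (auto simp: pd_diff smooth_imp_differentiable)
  then show ?thesis using assms
    by (simp add: laplacian_def pd_diff smooth_imp_differentiable smooth_pd sum_subtractf)
qed

lemma pd_const_fun: "pd i (\<lambda>x. c) = (\<lambda>x. 0)" by auto

lemma laplacian_const: "laplacian (\<lambda>x. c) x = 0"
  by (simp add: laplacian_def pd_const_fun)

lemma poisson_unique: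
  assumes "smooth \<phi>" "periodic \<phi>" "integral (cbox 0 1) \<phi> = 0" "\<And>x. laplacian \<phi> x = 0"
  shows "\<phi> x = 0"
proof (rule fourier_mode_zero_imp_zero[OF assms(2) smooth_imp_continuous[OF assms(1)]])
  fix k x
  show "fourier_mode \<phi> k x = 0"
  proof (cases "k = 0")
    case False
    have "fourier_mode (\<lambda>x. \<Sum>i\<in>UNIV. pd i (pd i \<phi>) x) k x = (\<Sum>i\<in>UNIV. fourier_mode (pd i (pd i \<phi>)) k x)"
      by (intro fourier_mode_sum smooth_imp_continuous smooth_pd assms) auto
    also have "\<dots> = - (\<Sum>i\<in>UNIV. (freq k $ i)\<^sup>2) * fourier_mode \<phi> k x"
      by (simp add: fourier_mode_pd2 assms sum_distrib_right sum_negf)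
    finally have "(\<Sum>i\<in>UNIV. (freq k $ i)\<^sup>2) * fourier_mode \<phi> k x = 0"
      using assms(4) by (simp add: laplacian_def[symmetric] fourier_mode_def cos_coeff_def sin_coeff_def)
    then show ?thesis using False freq_norm by auto
  qed (simp add: fourier_mode_0 assms)
qed

text \<open>
  The multiplier with symbol \<open>1/|2\<pi>k|^2\<close> (and 0 at \<open>k = 0\<close>), normalized to zero mean.
\<close>

lemma poisson_exists:
  fixes f :: "real^'n \<Rightarrow> real"
  assumes f: "smooth f" "periodic f" "integral (cbox 0 1) f = 0"
  shows "\<exists>\<phi>. smooth \<phi> \<and> periodic \<phi> \<and> integral (cbox 0 1) \<phi> = 0 \<and> (\<forall>x. - laplacian \<phi> x = f x)"
proof -
  define c where "c k = (if k = 0 then 0 else 1 / (\<Sum>i\<in>UNIV. (freq k $ i)\<^sup>2))" for k :: "int^'n"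
  have c1: "\<bar>c k\<bar> \<le> 1" for k using freq_norm_ge[of k] by (auto simp: c_def)
  let ?\<phi> = "multiplier c f"
  have \<phi>: "smooth ?\<phi>" "periodic ?\<phi>" by (intro multiplier_smooth multiplier_periodic f c1)+
  have lap: "- laplacian ?\<phi> x = f x" for x
  proof -
    have 2: "pd i (pd i ?\<phi>) x = multiplier c (pd i (pd i f)) x" for i
      by (simp add: pd_multiplier[OF c1] f smooth_pd periodic_pd_smooth)
    have "(\<lambda>n. c (freq_enum n) * fourier_mode (pd i (pd i f)) (freq_enum n) x) sums pd i (pd i ?\<phi>) x" for i
      unfolding 2 multiplier_def by (intro summable_sums multiplier_uniform(2) c1 smooth_pd periodic_pd_smooth f)
    then have "(\<lambda>n. \<Sum>i\<in>UNIV. c (freq_enum n) * fourier_mode (pd i (pd i f)) (freq_enum n) x) sums (\<Sum>i\<in>UNIV. pd i (pd i ?\<phi>) x)"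
      by (intro sums_sum)
    moreover have "(\<Sum>i\<in>UNIV. c k * fourier_mode (pd i (pd i f)) k x) = - fourier_mode f k x" for k
    proof (cases "k = 0")
      case True
      then show ?thesis using f(3) by (simp add: c_def fourier_mode_0)
    next
      case False
      have "(\<Sum>i\<in>UNIV. c k * fourier_mode (pd i (pd i f)) k x) = - (c k * (\<Sum>i\<in>UNIV. (freq k $ i)\<^sup>2)) * fourier_mode f k x"
        by (simp add: fourier_mode_pd2 f sum_distrib_right sum_distrib_left sum_negf mult_ac)
      then show ?thesis using False freq_norm[of k] by (simp add: c_def)
    qed
    ultimately have "(\<lambda>n. - fourier_mode f (freq_enum n) x) sums laplacian ?\<phi> x" by (simp add: laplacian_def)
    then have "(\<lambda>n. fourier_mode f (freq_enum n) x) sums (- laplacian ?\<phi> x)" using sums_minus by fastforce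
    then have "- laplacian ?\<phi> x = multiplier (\<lambda>_. 1) f x" by (simp add: multiplier_def sums_iff)
    then show ?thesis using fourier_inversion[OF f(1,2)] by simp
  qed
  let ?m = "integral (cbox 0 1) ?\<phi>"
  let ?\<psi> = "\<lambda>x. ?\<phi> x - ?m"
  have "smooth ?\<psi>" by (rule smooth_diff[OF \<phi>(1) smooth_const])
  moreover have "periodic ?\<psi>" using \<phi>(2) by (simp add: periodic_def)
  moreover have "integral (cbox 0 1) ?\<psi> = 0"
    by (subst integral_diff) (auto intro!: cbox_integrable continuous_intros smooth_imp_continuous[OF \<phi>(1)])
  moreover have "- laplacian ?\<psi> x = f x" for x
    using laplacian_diff[OF \<phi>(1) smooth_const[of ?m]] lap[of x] by (simp add: laplacian_const)
  ultimately show ?thesis by blast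
qed

lemma inv_neg_laplacian_eq:
  assumes "smooth \<phi>" "periodic \<phi>" "integral (cbox 0 1) \<phi> = 0" "\<And>x. - laplacian \<phi> x = f x"
  shows "inv_neg_laplacian f = \<phi>"
  unfolding inv_neg_laplacian_def
proof (rule the_equality)
  show "smooth \<phi> \<and> periodic \<phi> \<and> integral\<^sup>L torus \<phi> = 0 \<and> (\<forall>x. - laplacian \<phi> x = f x)"
    using assms by (simp add: torus_integral_smooth smooth_imp_continuous)
  fix \<eta> assume \<eta>: "smooth \<eta> \<and> periodic \<eta> \<and> integral\<^sup>L torus \<eta> = 0 \<and> (\<forall>x. - laplacian \<eta> x = f x)"
  have "\<eta> x - \<phi> x = 0" for x
  proof (rule poisson_unique[of "\<lambda>x. \<eta> x - \<phi> x"])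
    show "integral (cbox 0 1) (\<lambda>x. \<eta> x - \<phi> x) = 0"
    proof -
      have "integral (cbox 0 1) \<eta> = 0" using \<eta> torus_integral_smooth[OF smooth_imp_continuous, of \<eta>] by simp
      then show ?thesis using \<eta> assms by (subst integral_diff) (auto intro!: cbox_integrable smooth_imp_continuous)
    qed
    show "laplacian (\<lambda>x. \<eta> x - \<phi> x) x = 0" for x
    proof -
      have "- laplacian \<eta> x = - laplacian \<phi> x" using \<eta> unfolding assms(4) by blast
      then have "laplacian \<eta> x = laplacian \<phi> x" by simp
      then show ?thesis using \<eta> assms(1) by (subst laplacian_diff) auto
    qed
  qed (use \<eta> assms in \<open>auto intro: smooth_diff simp: periodic_def\<close>)
  then show "\<eta> = \<phi>" by auto
qed

lemma inv_neg_laplacian_props: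
  assumes f: "smooth f" "periodic f" "integral (cbox 0 1) f = 0"
  shows "smooth (inv_neg_laplacian f)" "periodic (inv_neg_laplacian f)"
    "integral (cbox 0 1) (inv_neg_laplacian f) = 0" "- laplacian (inv_neg_laplacian f) x = f x"
  using poisson_exists[OF f] inv_neg_laplacian_eq[of _ f] by auto

section \<open>The dual field of a matrix field\<close>

text \<open>
  Smooth matrix fields on the torus.
\<close>

definition smooth_field :: "(real^'n \<Rightarrow> real^'n^'n) \<Rightarrow> bool" where
  "smooth_field \<psi> \<longleftrightarrow> smooth \<psi> \<and> periodic \<psi>"

lemma bounded_linear_entry: "bounded_linear (\<lambda>A::real^'n^'n. A $ i $ j)"
  using bounded_linear_compose[OF bounded_linear_vec_nth bounded_linear_vec_nth] by blast

lemma smooth_field_entry: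
  assumes "smooth_field \<psi>" shows "smooth (\<lambda>x. \<psi> x $ i $ j)" "periodic (\<lambda>x. \<psi> x $ i $ j)"
  using assms smooth_bounded_linear[OF _ bounded_linear_entry] by (auto simp: smooth_field_def periodic_def)

text \<open>
  The \<open>k\<close>-th component \<open>\<partial>_j \<psi>^{kj}\<close> of the row divergence.
\<close>

definition mdiv :: "(real^'n \<Rightarrow> real^'n^'n) \<Rightarrow> 'n \<Rightarrow> real^'n \<Rightarrow> real" where
  "mdiv \<psi> k x = (\<Sum>j\<in>UNIV. pd j (\<lambda>y. \<psi> y $ k $ j) x)"

text \<open>
  The double divergence \<open>\<partial>_i \<partial>_j \<psi>^{ij}\<close>.
\<close>

definition ddiv :: "(real^'n \<Rightarrow> real^'n^'n) \<Rightarrow> real^'n \<Rightarrow> real" where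
  "ddiv \<psi> x = (\<Sum>i\<in>UNIV. \<Sum>j\<in>UNIV. pd i (pd j (\<lambda>z. \<psi> z $ i $ j)) x)"

lemma dual_field_eq: "dual_field \<psi> k x = mdiv \<psi> k x + pd k (inv_neg_laplacian (ddiv \<psi>)) x"
  by (simp add: dual_field_def mdiv_def ddiv_def[abs_def])

lemma mdiv_smooth: "smooth_field \<psi> \<Longrightarrow> smooth (mdiv \<psi> k)"
  unfolding mdiv_def[abs_def] by (intro smooth_sum smooth_pd smooth_field_entry)

lemma mdiv_periodic: "smooth_field \<psi> \<Longrightarrow> periodic (mdiv \<psi> k)"
  unfolding mdiv_def[abs_def] by (intro periodic_sum periodic_pd_smooth smooth_field_entry)

lemma ddiv_eq:
  assumes "smooth_field \<psi>" shows "ddiv \<psi> x = (\<Sum>i\<in>UNIV. pd i (mdiv \<psi> i) x)"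
  unfolding ddiv_def mdiv_def[abs_def]
  by (intro sum.cong refl pd_sum[symmetric] smooth_imp_differentiable smooth_pd smooth_field_entry assms)

lemma ddiv_smooth: "smooth_field \<psi> \<Longrightarrow> smooth (ddiv \<psi>)"
  unfolding ddiv_def[abs_def] by (intro smooth_sum smooth_pd smooth_field_entry)

lemma ddiv_periodic: "smooth_field \<psi> \<Longrightarrow> periodic (ddiv \<psi>)"
  unfolding ddiv_def[abs_def] by (intro periodic_sum periodic_pd_smooth smooth_pd smooth_field_entry)

lemma ddiv_integral: assumes "smooth_field \<psi>" shows "integral (cbox 0 1) (ddiv \<psi>) = 0"
proof -
  have "integral (cbox 0 1) (\<lambda>x. \<Sum>i\<in>UNIV. pd i (mdiv \<psi> i) x) = (\<Sum>i\<in>UNIV. integral (cbox 0 1) (pd i (mdiv \<psi> i)))"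
    by (intro integral_sum cbox_integrable smooth_imp_continuous smooth_pd mdiv_smooth assms) auto
  also have "\<dots> = 0"
    by (intro sum.neutral ballI C1_periodic_pd_integral C1_periodic_smooth mdiv_smooth mdiv_periodic assms)
  finally show ?thesis using ddiv_eq[OF assms] by (simp add: fun_eq_iff cong: integral_cong)
qed

context
  fixes \<psi> :: "real^'n \<Rightarrow> real^'n^'n"
  assumes \<psi>: "smooth_field \<psi>"
begin

lemmas inv_ddiv = inv_neg_laplacian_props[OF ddiv_smooth[OF \<psi>] ddiv_periodic[OF \<psi>] ddiv_integral[OF \<psi>]]

lemma dual_field_smooth: "smooth (dual_field \<psi> k)"
  unfolding dual_field_eq[abs_def] by (intro smooth_add mdiv_smooth \<psi> smooth_pd inv_ddiv)

text \<open>
  The dual field is \<open>w + \<nabla>\<phi>\<close> with \<open>-\<Delta>\<phi> = div w\<close>, the projection of \<open>w\<close> on divergence-free fields; so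
  \<open>\<integral>|w + \<nabla>\<phi>|^2 = \<integral>|w|^2 - \<integral>|\<nabla>\<phi>|^2\<close>.
\<close>

lemma dual_field_energy:
  "integral (cbox 0 1) (\<lambda>x. \<Sum>k\<in>UNIV. (dual_field \<psi> k x)\<^sup>2) \<le> integral (cbox 0 1) (\<lambda>x. \<Sum>k\<in>UNIV. (mdiv \<psi> k x)\<^sup>2)"
proof -
  let ?\<phi> = "inv_neg_laplacian (ddiv \<psi>)"
  let ?I = "\<lambda>f. integral (cbox 0 1) f :: real"
  note s = smooth_imp_continuous
  have C\<phi>: "C1_periodic ?\<phi>" and Cp: "C1_periodic (pd k ?\<phi>)" and Cw: "C1_periodic (mdiv \<psi> k)" for k
    by (intro C1_periodic_smooth inv_ddiv smooth_pd periodic_pd_smooth mdiv_smooth mdiv_periodic \<psi>)+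
  have c: "continuous_on UNIV ?\<phi>" "\<And>k. continuous_on UNIV (pd k ?\<phi>)" "\<And>k. continuous_on UNIV (mdiv \<psi> k)"
    "\<And>k l. continuous_on UNIV (pd l (pd k ?\<phi>))" "\<And>k l. continuous_on UNIV (pd l (mdiv \<psi> k))"
    by (intro s smooth_pd inv_ddiv mdiv_smooth \<psi>)+
  have int: "continuous_on UNIV f \<Longrightarrow> f integrable_on cbox 0 1" for f :: "real^'n \<Rightarrow> real" by (rule cbox_integrable)
  have 1: "?I (\<lambda>x. \<Sum>k\<in>UNIV. mdiv \<psi> k x * pd k ?\<phi> x) = - ?I (\<lambda>x. ?\<phi> x * ddiv \<psi> x)"
  proof -
    have "?I (\<lambda>x. \<Sum>k\<in>UNIV. mdiv \<psi> k x * pd k ?\<phi> x) = (\<Sum>k\<in>UNIV. ?I (\<lambda>x. mdiv \<psi> k x * pd k ?\<phi> x))"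
      by (intro integral_sum int continuous_intros c) auto
    also have "\<dots> = (\<Sum>k\<in>UNIV. - ?I (\<lambda>x. pd k (mdiv \<psi> k) x * ?\<phi> x))"
      by (intro sum.cong refl integration_by_parts Cw C\<phi>)
    also have "\<dots> = - ?I (\<lambda>x. \<Sum>k\<in>UNIV. pd k (mdiv \<psi> k) x * ?\<phi> x)"
      unfolding sum_negf by (intro arg_cong[of _ _ uminus] integral_sum[symmetric] int continuous_intros c) auto
    also have "(\<lambda>x. \<Sum>k\<in>UNIV. pd k (mdiv \<psi> k) x * ?\<phi> x) = (\<lambda>x. ?\<phi> x * ddiv \<psi> x)"
    proof
      fix x show "(\<Sum>k\<in>UNIV. pd k (mdiv \<psi> k) x * ?\<phi> x) = ?\<phi> x * ddiv \<psi> x"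
        using ddiv_eq[OF \<psi>, of x] by (simp add: mult.commute sum_distrib_left)
    qed
    finally show ?thesis .
  qed
  have 2: "?I (\<lambda>x. \<Sum>k\<in>UNIV. (pd k ?\<phi> x)\<^sup>2) = ?I (\<lambda>x. ?\<phi> x * ddiv \<psi> x)"
  proof -
    have "?I (\<lambda>x. \<Sum>k\<in>UNIV. (pd k ?\<phi> x)\<^sup>2) = (\<Sum>k\<in>UNIV. ?I (\<lambda>x. pd k ?\<phi> x * pd k ?\<phi> x))"
      unfolding power2_eq_square by (intro integral_sum int continuous_intros c) auto
    also have "\<dots> = (\<Sum>k\<in>UNIV. - ?I (\<lambda>x. pd k (pd k ?\<phi>) x * ?\<phi> x))"
      by (intro sum.cong refl integration_by_parts Cp C\<phi>)
    also have "\<dots> = - ?I (\<lambda>x. \<Sum>k\<in>UNIV. pd k (pd k ?\<phi>) x * ?\<phi> x)"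
      unfolding sum_negf by (intro arg_cong[of _ _ uminus] integral_sum[symmetric] int continuous_intros c) auto
    also have "\<dots> = ?I (\<lambda>x. - (\<Sum>k\<in>UNIV. pd k (pd k ?\<phi>) x * ?\<phi> x))" by simp
    also have "(\<lambda>x. - (\<Sum>k\<in>UNIV. pd k (pd k ?\<phi>) x * ?\<phi> x)) = (\<lambda>x. ?\<phi> x * ddiv \<psi> x)"
    proof
      fix x show "- (\<Sum>k\<in>UNIV. pd k (pd k ?\<phi>) x * ?\<phi> x) = ?\<phi> x * ddiv \<psi> x"
        unfolding inv_ddiv(4)[of x, symmetric, unfolded laplacian_def] sum_distrib_right[symmetric] by simp
    qed
    finally show ?thesis .
  qed
  have "?I (\<lambda>x. \<Sum>k\<in>UNIV. (dual_field \<psi> k x)\<^sup>2) = ?I (\<lambda>x. (\<Sum>k\<in>UNIV. (mdiv \<psi> k x)\<^sup>2) +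
    (2 * (\<Sum>k\<in>UNIV. mdiv \<psi> k x * pd k ?\<phi> x) + (\<Sum>k\<in>UNIV. (pd k ?\<phi> x)\<^sup>2)))"
    by (intro integral_cong) (simp add: dual_field_eq power2_sum sum.distrib sum_distrib_left mult_ac)
  also have "\<dots> = ?I (\<lambda>x. \<Sum>k\<in>UNIV. (mdiv \<psi> k x)\<^sup>2) + (2 * ?I (\<lambda>x. \<Sum>k\<in>UNIV. mdiv \<psi> k x * pd k ?\<phi> x)
      + ?I (\<lambda>x. \<Sum>k\<in>UNIV. (pd k ?\<phi> x)\<^sup>2))"
    by (subst integral_add, (intro int continuous_intros c)+, subst integral_add, (intro int continuous_intros c)+, simp)
  also have "\<dots> = ?I (\<lambda>x. \<Sum>k\<in>UNIV. (mdiv \<psi> k x)\<^sup>2) - ?I (\<lambda>x. \<Sum>k\<in>UNIV. (pd k ?\<phi> x)\<^sup>2)"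
    using 1 2 by simp
  also have "\<dots> \<le> ?I (\<lambda>x. \<Sum>k\<in>UNIV. (mdiv \<psi> k x)\<^sup>2)"
    by (simp add: integral_nonneg int continuous_intros c sum_nonneg)
  finally show ?thesis .
qed

end

lemma mdiv_lin:
  assumes "smooth_field \<psi>" "smooth_field \<eta>"
  shows "mdiv (\<lambda>x. a *\<^sub>R \<psi> x + b *\<^sub>R \<eta> x) k x = a * mdiv \<psi> k x + b * mdiv \<eta> k x"
proof -
  have "pd j (\<lambda>y. (a *\<^sub>R \<psi> y + b *\<^sub>R \<eta> y) $ k $ j) x = a * pd j (\<lambda>y. \<psi> y $ k $ j) x + b * pd j (\<lambda>y. \<eta> y $ k $ j) x" for j
    using assms by (simp add: pd_add pd_cmult smooth_imp_differentiable smooth_field_entry smooth_cmult)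
  then show ?thesis by (simp add: mdiv_def sum.distrib sum_distrib_left)
qed

lemma smooth_field_lin:
  assumes "smooth_field \<psi>" "smooth_field \<eta>" shows "smooth_field (\<lambda>x. a *\<^sub>R \<psi> x + b *\<^sub>R \<eta> x)"
  using assms by (auto simp: smooth_field_def periodic_def intro!: smooth_add smooth_scaleR)

lemma dual_field_lin:
  assumes "smooth_field \<psi>" "smooth_field \<eta>"
  shows "dual_field (\<lambda>x. a *\<^sub>R \<psi> x + b *\<^sub>R \<eta> x) k x = a * dual_field \<psi> k x + b * dual_field \<eta> k x"
proof -
  let ?f = "inv_neg_laplacian (ddiv \<psi>)" and ?g = "inv_neg_laplacian (ddiv \<eta>)"
  note f = inv_ddiv[OF assms(1)] and g = inv_ddiv[OF assms(2)]
  have "inv_neg_laplacian (ddiv (\<lambda>x. a *\<^sub>R \<psi> x + b *\<^sub>R \<eta> x)) = (\<lambda>x. a * ?f x + b * ?g x)"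
  proof (rule inv_neg_laplacian_eq)
    show "smooth (\<lambda>x. a * ?f x + b * ?g x)" by (rule smooth_add[OF smooth_cmult[OF f(1)] smooth_cmult[OF g(1)]])
    show "periodic (\<lambda>x. a * ?f x + b * ?g x)" using f(2) g(2) by (simp add: periodic_def)
    show "integral (cbox 0 1) (\<lambda>x. a * ?f x + b * ?g x) = 0"
      by (subst integral_add) (auto intro!: cbox_integrable continuous_intros smooth_imp_continuous[OF f(1)] smooth_imp_continuous[OF g(1)] simp: f(3) g(3))
    have p1: "pd i (\<lambda>x. a * ?f x + b * ?g x) = (\<lambda>x. a * pd i ?f x + b * pd i ?g x)" for i
      using f(1) g(1) by (auto simp: pd_add pd_cmult smooth_imp_differentiable smooth_cmult)
    have "laplacian (\<lambda>x. a * ?f x + b * ?g x) x = a * laplacian ?f x + b * laplacian ?g x" for x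
      using f(1) g(1) by (simp add: laplacian_def p1 pd_add pd_cmult smooth_imp_differentiable smooth_cmult smooth_pd
          sum.distrib sum_distrib_left)
    moreover have "ddiv (\<lambda>x. a *\<^sub>R \<psi> x + b *\<^sub>R \<eta> x) x = a * ddiv \<psi> x + b * ddiv \<eta> x" for x
    proof -
      have "mdiv (\<lambda>x. a *\<^sub>R \<psi> x + b *\<^sub>R \<eta> x) i = (\<lambda>x. a * mdiv \<psi> i x + b * mdiv \<eta> i x)" for i
        using mdiv_lin[OF assms] by auto
      then show ?thesis unfolding ddiv_eq[OF smooth_field_lin[OF assms]] ddiv_eq[OF assms(1)] ddiv_eq[OF assms(2)]
        using assms by (simp add: pd_add pd_cmult smooth_imp_differentiable smooth_cmult mdiv_smooth sum.distrib sum_distrib_left)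
    qed
    ultimately show "- laplacian (\<lambda>x. a * ?f x + b * ?g x) x = ddiv (\<lambda>x. a *\<^sub>R \<psi> x + b *\<^sub>R \<eta> x) x" for x
      using f(4)[of x] g(4)[of x] by (simp add: algebra_simps flip: f(4) g(4))
  qed
  then show ?thesis using f(1) g(1)
    by (simp add: dual_field_eq mdiv_lin[OF assms] pd_add pd_cmult smooth_imp_differentiable smooth_cmult algebra_simps)
qed

text \<open>
  For \<open>\<psi> = g I\<close> the divergence is the gradient of \<open>g\<close>, which the projection annihilates.
\<close>

lemma dual_field_trace:
  fixes g :: "real^'n \<Rightarrow> real"
  assumes "smooth g" "periodic g"
  shows "dual_field (\<lambda>x. g x *\<^sub>R mat 1) k x = 0"
proof -
  have e: "(\<lambda>y. (g y *\<^sub>R mat 1 :: real^'n^'n) $ i $ j) = (if i = j then g else (\<lambda>_. 0))" for i j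
    by (auto simp: mat_def)
  have m: "mdiv (\<lambda>x. g x *\<^sub>R mat 1) i x = pd i g x" for i x
  proof -
    have "mdiv (\<lambda>x. g x *\<^sub>R mat 1) i x = (\<Sum>j\<in>UNIV. if i = j then pd i g x else 0)"
      unfolding mdiv_def e by (intro sum.cong refl) auto
    then show ?thesis by simp
  qed
  let ?m = "integral (cbox 0 1) g"
  have "inv_neg_laplacian (ddiv (\<lambda>x. g x *\<^sub>R mat 1)) = (\<lambda>x. ?m - g x)"
  proof (rule inv_neg_laplacian_eq)
    show "smooth (\<lambda>x. ?m - g x)" by (intro smooth_diff smooth_const assms)
    show "periodic (\<lambda>x. ?m - g x)" using assms by (simp add: periodic_def)
    show "integral (cbox 0 1) (\<lambda>x. ?m - g x) = 0"
      by (subst integral_diff) (auto intro!: cbox_integrable continuous_intros smooth_imp_continuous assms)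
    have "ddiv (\<lambda>x. g x *\<^sub>R mat 1) x = laplacian g x" for x
    proof -
      have "pd i (pd j (\<lambda>z. (g z *\<^sub>R mat 1 :: real^'n^'n) $ i $ j)) x = (if i = j then pd i (pd i g) x else 0)" for i j
        unfolding e by (auto simp: pd_const_fun)
      then show ?thesis by (simp add: ddiv_def laplacian_def)
    qed
    then show "- laplacian (\<lambda>x. ?m - g x) x = ddiv (\<lambda>x. g x *\<^sub>R mat 1) x" for x
      using laplacian_diff[OF smooth_const[of ?m] assms(1)] by (simp add: laplacian_const)
  qed
  then show ?thesis using assms
    by (simp add: dual_field_eq m pd_diff smooth_imp_differentiable)
qed

section \<open>Lebesgue measure on the cylinder\<close>

lemma sets_pair_restrict_space:
  assumes A: "A \<in> sets M" and B: "B \<in> sets N"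
  shows "sets (restrict_space M A \<Otimes>\<^sub>M restrict_space N B) = sets (restrict_space (M \<Otimes>\<^sub>M N) (A \<times> B))"
    (is "sets ?L = sets ?R")
proof -
  have AB: "A \<times> B \<in> sets (M \<Otimes>\<^sub>M N)" using assms by simp
  have sp: "space ?L = A \<times> B" "space ?R = A \<times> B"
    using A B AB by (simp_all add: space_pair_measure)
  have fst: "fst \<in> measurable ?L M" and snd: "snd \<in> measurable ?L N"
  proof -
    have "id \<circ> fst \<in> measurable ?L M" "id \<circ> snd \<in> measurable ?L N"
      by (rule measurable_comp[OF measurable_fst measurable_restrict_space1], simp,
          rule measurable_comp[OF measurable_snd measurable_restrict_space1], simp)
    then show "fst \<in> measurable ?L M" "snd \<in> measurable ?L N" by simp_all
  qed
  have 1: "(\<lambda>x. x) \<in> measurable ?L ?R"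
  proof (rule measurable_restrict_space2)
    show "(\<lambda>x. x) \<in> space ?L \<rightarrow> A \<times> B" using sp by auto
    have "(\<lambda>x. (fst x, snd x)) \<in> measurable ?L (M \<Otimes>\<^sub>M N)" by (intro measurable_Pair fst snd)
    then show "(\<lambda>x. x) \<in> measurable ?L (M \<Otimes>\<^sub>M N)" by simp
  qed
  have 2: "(\<lambda>x. x) \<in> measurable ?R ?L"
  proof -
    have "fst \<in> measurable ?R (restrict_space M A)" "snd \<in> measurable ?R (restrict_space N B)"
      by (rule measurable_restrict_space2, simp only: sp, force, rule measurable_restrict_space1, simp)+
    then have "(\<lambda>x. (fst x, snd x)) \<in> measurable ?R ?L" by (intro measurable_Pair)
    then show ?thesis by simp
  qed
  show ?thesis
  proof (intro equalityI subsetI)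
    fix X assume X: "X \<in> sets ?L"
    have "(\<lambda>x. x) -` X \<inter> space ?R \<in> sets ?R" by (rule measurable_sets[OF 2 X])
    then show "X \<in> sets ?R" using sets.sets_into_space[OF X] sp by (simp add: Int_absorb2)
  next
    fix X assume X: "X \<in> sets ?R"
    have "(\<lambda>x. x) -` X \<inter> space ?L \<in> sets ?L" by (rule measurable_sets[OF 1 X])
    then show "X \<in> sets ?L" using sets.sets_into_space[OF X] sp by (simp add: Int_absorb2)
  qed
qed

lemma sigma_finite_restrict_lborel: "A \<in> sets lborel \<Longrightarrow> sigma_finite_measure (restrict_space lborel A)"
  by (rule sigma_finite_measure_restrict_space) (auto intro: lborel.sigma_finite_measure_axioms)

lemma cylinder_eq:
  "cylinder T = restrict_space lborel ({0..T} \<times> cbox 0 (1::real^'n))"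
  unfolding cylinder_def torus_def
proof (rule pair_measure_eqI)
  let ?A = "{0..T}" and ?B = "cbox 0 (1::real^'n)"
  show "sigma_finite_measure (restrict_space lborel ?A)" "sigma_finite_measure (restrict_space lborel ?B)"
    by (intro sigma_finite_restrict_lborel; simp)+
  show "sets (restrict_space lborel ?A \<Otimes>\<^sub>M restrict_space lborel ?B) = sets (restrict_space lborel (?A \<times> ?B))"
    using sets_pair_restrict_space[of ?A lborel ?B lborel] by (simp add: lborel_prod)
  fix X Y assume X: "X \<in> sets (restrict_space lborel ?A)" and Y: "Y \<in> sets (restrict_space lborel ?B)"
  have X': "X \<in> sets lborel" "X \<subseteq> ?A" and Y': "Y \<in> sets lborel" "Y \<subseteq> ?B"
    using X Y by (auto simp: sets_restrict_space_iff)
  have m: "?A \<times> ?B \<in> sets (lborel :: (real \<times> (real^'n)) measure)"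
    unfolding sets_lborel by (intro borel_closed closed_Times) auto
  have "emeasure (restrict_space lborel (?A \<times> ?B)) (X \<times> Y) = emeasure lborel (X \<times> Y)"
    by (rule emeasure_restrict_space) (use m X' Y' in auto)
  also have "\<dots> = emeasure lborel X * emeasure lborel Y"
    unfolding lborel_prod[symmetric] by (intro lborel.emeasure_pair_measure_Times X' Y')
  finally show "emeasure (restrict_space lborel ?A) X * emeasure (restrict_space lborel ?B) Y =
    emeasure (restrict_space lborel (?A \<times> ?B)) (X \<times> Y)"
    using X' Y' by (simp add: emeasure_restrict_space)
qed

lemma space_cylinder [simp]: "space (cylinder T) = {0..T} \<times> cbox 0 1"
  unfolding cylinder_def by (simp add: space_pair_measure space_restrict_space)

lemma time_finite: "finite_measure (restrict_space lborel {0..T::real})"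
  by (intro finite_measureI) (simp add: emeasure_restrict_space emeasure_lborel_Icc_eq)

interpretation cyl: pair_sigma_finite "restrict_space lborel {0..T::real}" "torus :: (real^'n) measure"
  by (intro pair_sigma_finite.intro finite_measure.axioms(1) time_finite finite_torus)

lemma cylinder_finite: "finite_measure (cylinder T :: (real \<times> (real^'n)) measure)"
  unfolding cylinder_def by (intro finite_measure_pair_measure time_finite finite_torus)

lemma cylinder_measurable_cont:
  fixes f :: "real \<times> (real^'n) \<Rightarrow> 'b::euclidean_space"
  assumes "continuous_on ({0..T} \<times> UNIV) f"
  shows "f \<in> borel_measurable (cylinder T)"
proof -
  have "f \<in> borel_measurable (restrict_space borel ({0..T} \<times> cbox 0 1))"
    by (intro borel_measurable_continuous_on_restrict continuous_on_subset[OF assms]) auto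
  then show ?thesis unfolding cylinder_eq by (simp cong: measurable_cong_sets sets_restrict_space_cong)
qed

lemma cylinder_cont_bounded:
  fixes f :: "real \<times> (real^'n) \<Rightarrow> 'b::euclidean_space"
  assumes "continuous_on ({0..T} \<times> UNIV) f"
  obtains C where "\<And>p. p \<in> space (cylinder T) \<Longrightarrow> norm (f p) \<le> C" "C > 0"
proof -
  have "compact ({0..T} \<times> cbox 0 (1::real^'n))" by (intro compact_Times) auto
  then have "compact (f ` ({0..T} \<times> cbox 0 1))"
    by (intro compact_continuous_image continuous_on_subset[OF assms]) auto
  then obtain C where "\<forall>y \<in> f ` ({0..T} \<times> cbox 0 1). norm y \<le> C" "C > 0"
    by (meson bounded_pos compact_imp_bounded)
  then show ?thesis using that[of C] by auto
qed

section \<open>Density of continuous periodic functions\<close>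

text \<open>
  Bounded measurable functions are almost everywhere limits of continuous functions with the same bound.
\<close>

lemma continuous_approx:
  fixes f :: "'a::euclidean_space \<Rightarrow> 'b::euclidean_space"
  assumes f: "f \<in> borel_measurable (restrict_space lborel S)" and S: "S \<in> sets borel"
    and C: "\<And>x. x \<in> S \<Longrightarrow> norm (f x) \<le> C" "C \<ge> 0"
  obtains g where "\<And>n. continuous_on UNIV (g n)" "\<And>n x. norm (g n x) \<le> C"
    "AE x in restrict_space lborel S. (\<lambda>n. g n x) \<longlonglongrightarrow> f x"
proof -
  let ?F = "\<lambda>x. indicator S x *\<^sub>R f x"
  have "?F \<in> borel_measurable lborel" using f S by (simp add: borel_measurable_restrict_space_iff)
  then have "?F measurable_on UNIV"
    by (intro lebesgue_measurable_imp_measurable_on) (auto intro: measurable_completion)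
  then obtain N g where N: "negligible N" and g: "\<And>n. continuous_on UNIV (g n)" "\<And>x. x \<notin> N \<Longrightarrow> (\<lambda>n. g n x) \<longlonglongrightarrow> ?F x"
    unfolding measurable_on_def by auto
  define h where "h n x = closest_point (cball 0 C) (g n x)" for n x
  have cc: "continuous_on UNIV (closest_point (cball (0::'b) C))"
    using C by (intro continuous_on_closest_point) auto
  have "continuous_on UNIV (h n)" for n
    unfolding h_def by (rule continuous_on_compose2[OF cc g(1)]) auto
  moreover have "norm (h n x) \<le> C" for n x
    using closest_point_in_set[of "cball (0::'b) C" "g n x"] C(2) unfolding h_def by auto
  moreover have "AE x in restrict_space lborel S. (\<lambda>n. h n x) \<longlonglongrightarrow> f x"
  proof -
    have "AE x in lebesgue. x \<notin> N" using N by (simp add: negligible_iff_null_sets AE_not_in)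
    then have "AE x in lborel. x \<notin> N" by (simp add: AE_completion_iff)
    moreover have "(\<lambda>n. h n x) \<longlonglongrightarrow> f x" if "x \<notin> N" "x \<in> S" for x
    proof -
      have "(\<lambda>n. h n x) \<longlonglongrightarrow> closest_point (cball 0 C) (?F x)"
        unfolding h_def by (rule continuous_on_tendsto_compose[OF cc g(2)[OF that(1)]]) auto
      moreover have "closest_point (cball 0 C) (?F x) = f x"
        using that(2) C by (simp add: closest_point_self)
      ultimately show ?thesis by simp
    qed
    ultimately show ?thesis using S by (auto simp: AE_restrict_space_iff elim!: eventually_mono)
  qed
  ultimately show ?thesis using that by blast
qed

text \<open>
  Continuous functions that are periodic in the space variable.
\<close>

definition testfun :: "(real \<times> (real^'n) \<Rightarrow> 'b::euclidean_space) \<Rightarrow> bool" where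
  "testfun h \<longleftrightarrow> continuous_on UNIV h \<and> (\<forall>t. periodic (\<lambda>x. h (t, x)))"

lemma isCont_frac:
  fixes x :: real assumes "x \<notin> \<int>" shows "isCont frac x"
proof -
  have "of_int \<lfloor>x\<rfloor> < x" using assms by (metis Ints_of_int of_int_floor_le order_le_less)
  moreover have "x < of_int \<lfloor>x\<rfloor> + 1" by linarith
  ultimately have "eventually (\<lambda>y. y \<in> {of_int \<lfloor>x\<rfloor> <..< of_int \<lfloor>x\<rfloor> + 1}) (nhds x)"
    by (intro eventually_nhds_in_open) auto
  then have "eventually (\<lambda>y. frac y = y - of_int \<lfloor>x\<rfloor>) (nhds x)"
    by eventually_elim (auto simp: frac_def floor_eq_iff)
  then show ?thesis by (subst isCont_cong) (auto intro: continuous_intros)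
qed

text \<open>
  A continuous periodic function that vanishes on the faces of the unit cube and tends to 1 in its interior.
  Multiplication by it makes the periodic extension of a continuous function continuous.
\<close>

definition cutoff :: "nat \<Rightarrow> real^'n \<Rightarrow> real" where
  "cutoff n x = (\<Prod>i\<in>UNIV. min 1 (real n * \<bar>sin (pi * x $ i)\<bar>))"

lemma cutoff_bounds: "0 \<le> cutoff n x" "cutoff n x \<le> 1"
  unfolding cutoff_def by (auto intro!: prod_nonneg prod_le_1)

lemma cutoff_cont: "continuous_on UNIV (cutoff n)"
  unfolding cutoff_def[abs_def] by (intro continuous_intros)

lemma cutoff_eq_0: assumes "x $ i \<in> \<int>" shows "cutoff n x = 0"
proof -
  have "sin (pi * x $ i) = 0" using assms by (auto simp: Ints_def sin_zero_iff_int2 mult.commute)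
  then have "min 1 (real n * \<bar>sin (pi * x $ i)\<bar>) = 0" by simp
  then show ?thesis unfolding cutoff_def by (meson UNIV_I finite prod_zero)
qed

lemma cutoff_tendsto: fixes x :: "real^'n" assumes "\<And>i. x $ i \<notin> \<int>" shows "(\<lambda>n. cutoff n x) \<longlonglongrightarrow> 1"
proof -
  have A: "(\<lambda>n. min 1 (real n * \<bar>sin (pi * x $ i)\<bar>)) \<longlonglongrightarrow> 1" for i
  proof -
    have s: "\<bar>sin (pi * x $ i)\<bar> > 0"
    proof -
      have "sin (pi * x $ i) \<noteq> 0"
      proof
        assume "sin (pi * x $ i) = 0"
        then obtain m :: int where "pi * x $ i = of_int m * pi" unfolding sin_zero_iff_int2 by blast
        then have "x $ i = of_int m" by simp
        then show False using assms[of i] by simp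
      qed
      then show ?thesis by simp
    qed
    obtain N where N: "real N * \<bar>sin (pi * x $ i)\<bar> > 1" using reals_Archimedean3[OF s] by blast
    have "eventually (\<lambda>n. min 1 (real n * \<bar>sin (pi * x $ i)\<bar>) = 1) sequentially"
      unfolding eventually_sequentially
    proof (intro exI[of _ N] allI impI)
      fix n assume "N \<le> n"
      then have "real N * \<bar>sin (pi * x $ i)\<bar> \<le> real n * \<bar>sin (pi * x $ i)\<bar>" by (intro mult_right_mono) auto
      then show "min 1 (real n * \<bar>sin (pi * x $ i)\<bar>) = 1" using N by simp
    qed
    then show ?thesis by (rule tendsto_eventually)
  qed
  have "(\<lambda>n. cutoff n x) \<longlonglongrightarrow> (\<Prod>i\<in>(UNIV::'n set). 1)" unfolding cutoff_def by (rule tendsto_prod) (rule A)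
  then show ?thesis by simp
qed

lemma vfrac_shift: "vfrac (x + axis i 1) = vfrac x"
proof -
  have "frac (x $ j + (if j = i then 1 else 0)) = frac (x $ j)" for j
    by (auto simp: frac_def)
  then show ?thesis by (simp add: vfrac_def vec_eq_iff axis_def)
qed

lemma vfrac_id: assumes "x \<in> box 0 (1::real^'n)" shows "vfrac x = x"
  using assms by (simp add: vfrac_def vec_eq_iff mem_box_cart frac_eq less_imp_le)

lemma box_not_int: assumes "x \<in> box 0 (1::real^'n)" shows "x $ i \<notin> \<int>"
proof
  assume "x $ i \<in> \<int>"
  then obtain m :: int where "x $ i = of_int m" by (auto simp: Ints_def)
  moreover have "0 < x $ i" "x $ i < 1" using assms by (auto simp: mem_box_cart)
  ultimately have "0 < m" "m < 1" by simp_all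
  then show False by linarith
qed

lemma periodize_cont:
  fixes g :: "real \<times> (real^'n) \<Rightarrow> 'b::euclidean_space"
  assumes g: "continuous_on UNIV g" "\<And>p. norm (g p) \<le> C"
  shows "testfun (\<lambda>(t, x). cutoff n x *\<^sub>R g (t, vfrac x))"
proof -
  have "isCont (\<lambda>(t, x). cutoff n x *\<^sub>R g (t, vfrac x)) p" for p
  proof (cases p)
    case (Pair t0 x0)
    have ic: "isCont (\<lambda>p. cutoff n (snd p)) q" for q :: "real \<times> (real^'n)"
      by (rule isCont_o2[where f=snd]) (use cutoff_cont[of n] in \<open>auto simp: continuous_on_eq_continuous_at\<close>)
    show ?thesis
    proof (cases "\<forall>i. x0 $ i \<notin> \<int>")
      case True
      have "isCont (\<lambda>p. vfrac (snd p)) p"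
        unfolding vfrac_def
      proof (rule isCont_o2[where f=snd])
        show "isCont (\<lambda>x::real^'n. \<chi> i. frac (x $ i)) (snd p)"
          unfolding isCont_def
        proof (rule vec_tendstoI)
          fix i
          have "isCont (\<lambda>x::real^'n. frac (x $ i)) (snd p)"
            by (rule isCont_o2[where f="\<lambda>x. x $ i"]) (use True Pair in \<open>auto intro!: isCont_frac continuous_intros\<close>)
          then show "((\<lambda>x. (\<chi> i. frac (x $ i)) $ i) \<longlongrightarrow> (\<chi> i. frac (snd p $ i)) $ i) (at (snd p))"
            by (simp add: isCont_def)
        qed
      qed (intro continuous_intros)
      then have "isCont (\<lambda>p. (fst p, vfrac (snd p))) p" by (intro continuous_intros)
      then have "isCont (\<lambda>p. g (fst p, vfrac (snd p))) p"
        by (rule isCont_o2) (use g(1) in \<open>auto simp: continuous_on_eq_continuous_at\<close>)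
      then show ?thesis unfolding split_beta by (intro continuous_scaleR ic)
    next
      case False
      then obtain i where "x0 $ i \<in> \<int>" by blast
      then have z: "cutoff n x0 = 0" by (rule cutoff_eq_0)
      have "((\<lambda>p. cutoff n (snd p) *\<^sub>R g (fst p, vfrac (snd p))) \<longlongrightarrow> 0) (at p)"
      proof (rule Lim_null_comparison)
        show "\<forall>\<^sub>F q in at p. norm (cutoff n (snd q) *\<^sub>R g (fst q, vfrac (snd q))) \<le> cutoff n (snd q) * C"
          by (intro always_eventually allI) (simp add: cutoff_bounds mult_left_mono g(2))
        have "((\<lambda>q. cutoff n (snd q) * C) \<longlongrightarrow> cutoff n (snd p) * C) (at p)"
          using ic[of p] by (intro tendsto_intros) (simp add: isCont_def)
        then show "((\<lambda>q. cutoff n (snd q) * C) \<longlongrightarrow> 0) (at p)" using z Pair by simp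
      qed
      then show ?thesis unfolding split_beta isCont_def using z Pair by simp
    qed
  qed
  moreover have "cutoff n (x + axis i 1) = cutoff n x" for x :: "real^'n" and i
  proof -
    have "\<bar>sin (pi * (x $ j + (if j = i then 1 else 0)))\<bar> = \<bar>sin (pi * x $ j)\<bar>" for j
      by (auto simp: distrib_left)
    then show ?thesis unfolding cutoff_def by (simp add: axis_def)
  qed
  ultimately show ?thesis
    by (simp add: testfun_def continuous_at_imp_continuous_on periodic_def vfrac_shift)
qed

text \<open>
  The approximants are cut off near the faces of the unit cube and extended periodically.
\<close>

lemma testfun_approx:
  fixes f :: "real \<times> (real^'n) \<Rightarrow> 'b::euclidean_space"
  assumes f: "f \<in> borel_measurable (cylinder T)" and C: "\<And>p. p \<in> space (cylinder T) \<Longrightarrow> norm (f p) \<le> C" "C \<ge> 0"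
  obtains h where "\<And>n. testfun (h n)" "\<And>n p. norm (h n p) \<le> C" "AE p in cylinder T. (\<lambda>n. h n p) \<longlonglongrightarrow> f p"
proof -
  let ?S = "{0..T} \<times> cbox 0 (1::real^'n)"
  have S: "?S \<in> sets borel" by (intro borel_closed closed_Times) auto
  obtain g where g: "\<And>n. continuous_on UNIV (g n)" "\<And>n x. norm (g n x) \<le> C"
    "AE x in restrict_space lborel ?S. (\<lambda>n. g n x) \<longlonglongrightarrow> f x"
    using continuous_approx[OF f[unfolded cylinder_eq] S C[unfolded space_cylinder]] by blast
  let ?h = "\<lambda>n (t, x). cutoff n x *\<^sub>R g n (t, vfrac x)"
  have "testfun (?h n)" for n by (rule periodize_cont[OF g(1,2)])
  moreover have "norm (?h n p) \<le> C" for n p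
  proof -
    have "cutoff n (snd p) * norm (g n (fst p, vfrac (snd p))) \<le> 1 * C"
      by (intro mult_mono g cutoff_bounds) auto
    then show ?thesis by (simp add: split_beta cutoff_bounds)
  qed
  moreover have "AE p in cylinder T. (\<lambda>n. ?h n p) \<longlonglongrightarrow> f p"
  proof -
    have eq: "?S = cbox (0, 0) (T, 1)" by (simp add: cbox_Pair_eq)
    \<comment> \<open>on the null set of boundary points the cutoff does not tend to 1\<close>
    have "AE p in lebesgue. p \<notin> cbox (0, 0) (T, 1::real^'n) - box (0, 0) (T, 1)"
      by (rule AE_not_in) (simp only: negligible_iff_null_sets[symmetric] negligible_frontier_interval)
    then have "AE p in lborel. p \<in> ?S \<longrightarrow> p \<in> box (0, 0) (T, 1::real^'n)"
      unfolding AE_completion_iff eq by (auto elim!: eventually_mono)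
    then have "AE p in cylinder T. p \<in> box (0, 0) (T, 1::real^'n)"
      unfolding cylinder_eq using S by (simp add: AE_restrict_space_iff)
    then show ?thesis using g(3)[folded cylinder_eq]
    proof eventually_elim
      case (elim p)
      obtain t x where p: "p = (t, x)" by (cases p)
      have x: "x \<in> box 0 1" using elim(1) by (simp add: p mem_box Basis_prod_def ball_Un)
      have "(\<lambda>n. cutoff n x *\<^sub>R g n (t, x)) \<longlonglongrightarrow> 1 *\<^sub>R f p"
        using elim(2) by (intro tendsto_scaleR cutoff_tendsto box_not_int[OF x]) (simp add: p)
      then show ?case by (simp add: p vfrac_id[OF x])
    qed
  qed
  ultimately show ?thesis using that[of ?h] by blast
qed

lemma testfun_cont: "testfun h \<Longrightarrow> continuous_on S h"
  by (auto simp: testfun_def intro: continuous_on_subset)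

lemma bounded_conv_integral:
  fixes g :: "'a \<Rightarrow> 'b::euclidean_space"
  assumes g: "integrable M g" and h: "\<And>n. h n \<in> borel_measurable M" "\<And>n p. p \<in> space M \<Longrightarrow> norm (h n p) \<le> C"
    and f: "f \<in> borel_measurable M" "AE p in M. (\<lambda>n. h n p) \<longlonglongrightarrow> f p"
  shows "(\<lambda>n. \<integral>p. g p \<bullet> h n p \<partial>M) \<longlonglongrightarrow> (\<integral>p. g p \<bullet> f p \<partial>M)"
proof (rule integral_dominated_convergence[where w="\<lambda>p. norm (g p) * C"])
  show "integrable M (\<lambda>p. norm (g p) * C)" using g by simp
  show "AE p in M. (\<lambda>n. g p \<bullet> h n p) \<longlonglongrightarrow> g p \<bullet> f p"
    using f(2) by eventually_elim (intro tendsto_intros)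
  show "AE p in M. norm (g p \<bullet> h n p) \<le> norm (g p) * C" for n
    using h(2) by (intro AE_I2) (metis Cauchy_Schwarz_ineq2 mult_left_mono norm_ge_zero order_trans real_norm_def)
qed (use g h f in \<open>auto intro!: borel_measurable_inner\<close>)

lemma AE_zero_if_orthogonal:
  fixes g :: "real \<times> (real^'n) \<Rightarrow> real"
  assumes g: "integrable (cylinder T) g" and z: "\<And>h. testfun h \<Longrightarrow> (\<integral>p. g p * h p \<partial>cylinder T) = 0"
  shows "AE p in cylinder T. g p = 0"
proof -
  have gm [measurable]: "g \<in> borel_measurable (cylinder T)" using g by auto
  have sm: "(\<lambda>p. sgn (g p)) \<in> borel_measurable (cylinder T)" by measurable
  obtain h where h: "\<And>n. testfun (h n)" "\<And>n p. norm (h n p) \<le> 1" "AE p in cylinder T. (\<lambda>n. h n p) \<longlonglongrightarrow> sgn (g p)"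
    using testfun_approx[OF sm, of 1] by (auto simp: abs_sgn_eq)
  have "(\<lambda>n. \<integral>p. g p \<bullet> h n p \<partial>cylinder T) \<longlonglongrightarrow> (\<integral>p. g p \<bullet> sgn (g p) \<partial>cylinder T)"
    by (rule bounded_conv_integral[OF g _ h(2) sm h(3)]) (intro cylinder_measurable_cont testfun_cont h)
  then have "(\<integral>p. \<bar>g p\<bar> \<partial>cylinder T) = 0"
    using z[OF h(1)] by (simp add: LIMSEQ_const_iff mult_sgn_abs abs_sgn[symmetric])
  then show ?thesis using g by (subst (asm) integral_nonneg_eq_0_iff_AE) auto
qed

lemma AE_nonneg_if_test:
  fixes g :: "real \<times> (real^'n) \<Rightarrow> real"
  assumes g: "integrable (cylinder T) g" and z: "\<And>h::real \<times> (real^'n) \<Rightarrow> real. testfun h \<Longrightarrow> (\<integral>p. g p * (h p)\<^sup>2 \<partial>cylinder T) \<ge> 0"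
  shows "AE p in cylinder T. g p \<ge> 0"
proof -
  have gm [measurable]: "g \<in> borel_measurable (cylinder T)" using g by auto
  let ?f = "\<lambda>p. if g p < 0 then 1 else 0 :: real"
  have sm: "?f \<in> borel_measurable (cylinder T)" by measurable
  obtain h where h: "\<And>n. testfun (h n)" "\<And>n p. norm (h n p) \<le> 1" "AE p in cylinder T. (\<lambda>n. h n p) \<longlonglongrightarrow> ?f p"
    by (rule testfun_approx[OF sm, of 1]) auto
  have "(\<lambda>n. \<integral>p. g p \<bullet> (h n p)\<^sup>2 \<partial>cylinder T) \<longlonglongrightarrow> (\<integral>p. g p \<bullet> (?f p)\<^sup>2 \<partial>cylinder T)"
  proof (rule bounded_conv_integral[OF g])
    show "norm ((h n p)\<^sup>2) \<le> 1" for n p using h(2)[of n p] by (simp add: power_le_one abs_square_le_1)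
    show "AE p in cylinder T. (\<lambda>n. (h n p)\<^sup>2) \<longlonglongrightarrow> (?f p)\<^sup>2"
      using h(3) by eventually_elim (rule tendsto_power)
    show "(\<lambda>p. (h n p)\<^sup>2) \<in> borel_measurable (cylinder T)" for n
      by (intro borel_measurable_power cylinder_measurable_cont testfun_cont h)
  qed (use sm in measurable)
  then have "(\<integral>p. g p \<bullet> (?f p)\<^sup>2 \<partial>cylinder T) \<ge> 0"
    by (rule LIMSEQ_le_const) (use z[OF h(1)] in auto)
  moreover have "g p \<bullet> (?f p)\<^sup>2 = - \<bar>min 0 (g p)\<bar>" for p by auto
  ultimately have "(\<integral>p. \<bar>min 0 (g p)\<bar> \<partial>cylinder T) \<le> 0" by simp
  then have "(\<integral>p. \<bar>min 0 (g p)\<bar> \<partial>cylinder T) = 0" by (intro antisym integral_nonneg_AE) auto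
  moreover have "integrable (cylinder T) (\<lambda>p. \<bar>min 0 (g p)\<bar>)"
    by (rule Bochner_Integration.integrable_bound[OF g]) auto
  ultimately have "AE p in cylinder T. \<bar>min 0 (g p)\<bar> = 0" by (subst (asm) integral_nonneg_eq_0_iff_AE) auto
  then show ?thesis by eventually_elim (auto simp: min_def split: if_splits)
qed

section \<open>Moments determine a function of time\<close>

text \<open>
  By the theorem of Weierstrass, \<open>u\<close> is orthogonal to all continuous functions.
\<close>

lemma time_AE_zero:
  fixes u :: "real \<Rightarrow> real"
  assumes u: "integrable (restrict_space lborel {0..T}) u"
    and z: "\<And>m. (\<integral>t. u t * t ^ m \<partial>restrict_space lborel {0..T}) = 0"
  shows "AE t in restrict_space lborel {0..T}. u t = 0"
proof -
  let ?M = "restrict_space lborel {0..T}"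
  have gm [measurable]: "u \<in> borel_measurable ?M" using u by auto
  have sm: "(\<lambda>p. sgn (u p)) \<in> borel_measurable ?M" by measurable
  have M: "f \<in> borel_measurable ?M" if "continuous_on UNIV f" for f :: "real \<Rightarrow> real"
    by (rule measurable_restrict_space1) (use that in \<open>simp add: borel_measurable_continuous_onI\<close>)
  have ub: "integrable ?M (\<lambda>t. u t * f t)" if "continuous_on UNIV f" for f
  proof -
    have "compact (f ` {0..T})" by (intro compact_continuous_image continuous_on_subset[OF that]) auto
    then obtain B where B: "\<forall>y\<in>f ` {0..T}. norm y \<le> B" by (meson bounded_pos compact_imp_bounded)
    have nb: "norm (u t * f t) \<le> norm (B * u t)" if t: "t \<in> {0..T}" for t
    proof -
      have "\<bar>f t\<bar> \<le> B" using B t by auto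
      then have "\<bar>u t\<bar> * \<bar>f t\<bar> \<le> \<bar>u t\<bar> * \<bar>B\<bar>" by (intro mult_left_mono) auto
      then show ?thesis by (simp add: abs_mult mult.commute)
    qed
    show ?thesis
      by (rule Bochner_Integration.integrable_bound[of _ "\<lambda>t. B * u t"]) (use nb u M[OF that] in \<open>auto simp: space_restrict_space\<close>)
  qed
  have poly: "(\<integral>t. u t * p t \<partial>?M) = 0" if p: "real_polynomial_function p" for p
  proof -
    obtain a n where p: "p = (\<lambda>x. \<Sum>i\<le>n. a i * x^i)" using p unfolding real_polynomial_function_iff_sum by blast
    have "(\<integral>t. u t * p t \<partial>?M) = (\<integral>t. (\<Sum>i\<le>n. a i * (u t * t^i)) \<partial>?M)"
      by (simp add: p sum_distrib_left mult_ac)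
    also have "\<dots> = (\<Sum>i\<le>n. \<integral>t. a i * (u t * t^i) \<partial>?M)"
      by (intro Bochner_Integration.integral_sum integrable_mult_right ub continuous_intros)
    also have "\<dots> = 0" by (simp add: z)
    finally show ?thesis .
  qed
  have cont: "(\<integral>t. u t * f t \<partial>?M) = 0" if f: "continuous_on UNIV f" for f
  proof (rule ccontr)
    let ?I = "\<bar>\<integral>t. u t * f t \<partial>?M\<bar>" and ?U = "\<integral>t. \<bar>u t\<bar> \<partial>?M"
    assume "(\<integral>t. u t * f t \<partial>?M) \<noteq> 0"
    then have I: "?I > 0" by simp
    have U: "?U \<ge> 0" by simp
    define e where "e = ?I / (2 * (?U + 1))"
    have "2 * (?U + 1) > 0" by (intro mult_pos_pos add_nonneg_pos U) auto
    then have e: "e > 0" unfolding e_def by (rule divide_pos_pos[OF I])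
    obtain p where p: "real_polynomial_function p" "\<And>t. t \<in> {0..T} \<Longrightarrow> \<bar>f t - p t\<bar> < e"
      using Stone_Weierstrass_real_polynomial_function[OF _ continuous_on_subset[OF f] e, of "{0..T}"] by auto
    have pc: "continuous_on UNIV p" using p(1) continuous_on_polymonial_function real_polynomial_function_eq by blast
    have "(\<integral>t. u t * f t \<partial>?M) = (\<integral>t. u t * f t \<partial>?M) - (\<integral>t. u t * p t \<partial>?M)" using poly[OF p(1)] by simp
    also have "\<dots> = (\<integral>t. u t * f t - u t * p t \<partial>?M)"
      by (intro Bochner_Integration.integral_diff[symmetric] ub f pc)
    finally have "?I \<le> (\<integral>t. \<bar>u t * f t - u t * p t\<bar> \<partial>?M)" by (simp add: integral_abs_bound)
    also have "\<dots> \<le> (\<integral>t. e * \<bar>u t\<bar> \<partial>?M)"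
    proof (rule integral_mono)
      show "\<bar>u t * f t - u t * p t\<bar> \<le> e * \<bar>u t\<bar>" if "t \<in> space ?M" for t
      proof -
        have "\<bar>f t - p t\<bar> * \<bar>u t\<bar> \<le> e * \<bar>u t\<bar>"
          using p(2)[of t] that by (intro mult_right_mono) (auto simp: space_restrict_space)
        then show ?thesis by (simp add: abs_mult[symmetric] algebra_simps)
      qed
    qed (use u ub[OF f] ub[OF pc] in auto)
    also have "\<dots> = e * ?U" by simp
    also have "\<dots> \<le> e * (?U + 1)" using e by (intro mult_left_mono) auto
    also have "\<dots> = ?I / 2"
    proof -
      have "?U + 1 \<noteq> 0" using add_nonneg_pos[OF U zero_less_one] by (rule less_imp_neq[symmetric])
      moreover have "v \<noteq> 0 \<Longrightarrow> i / (2 * v) * v = i / 2" for i v :: real by simp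
      ultimately show ?thesis unfolding e_def by blast
    qed
    finally show False using I by linarith
  qed
  obtain h where h: "\<And>n. continuous_on UNIV (h n)" "\<And>n p. norm (h n p) \<le> 1" "AE p in ?M. (\<lambda>n. h n p) \<longlonglongrightarrow> sgn (u p)"
    using continuous_approx[OF sm, of 1] by (auto simp: abs_sgn_eq)
  have "(\<lambda>n. \<integral>p. u p \<bullet> h n p \<partial>?M) \<longlonglongrightarrow> (\<integral>p. u p \<bullet> sgn (u p) \<partial>?M)"
    by (rule bounded_conv_integral[OF u _ h(2) sm h(3)]) (intro M h)
  then have "(\<integral>p. \<bar>u p\<bar> \<partial>?M) = 0"
    using cont[OF h(1)] by (simp add: LIMSEQ_const_iff abs_sgn[symmetric])
  then show ?thesis using u by (subst (asm) integral_nonneg_eq_0_iff_AE) auto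
qed

section \<open>Square integrable functions\<close>

text \<open>
  Square integrability for functions with values in any Euclidean space.
\<close>

definition Lsq :: "'a measure \<Rightarrow> ('a \<Rightarrow> 'b::euclidean_space) \<Rightarrow> bool" where
  "Lsq M f \<longleftrightarrow> f \<in> borel_measurable M \<and> integrable M (\<lambda>x. (norm (f x))\<^sup>2)"

lemma Lsq_meas: "Lsq M f \<Longrightarrow> f \<in> borel_measurable M" by (simp add: Lsq_def)

lemma Lsq_int: "Lsq M f \<Longrightarrow> integrable M (\<lambda>x. (norm (f x))\<^sup>2)" by (simp add: Lsq_def)

lemma Lsq_bound:
  assumes "f \<in> borel_measurable M" "integrable M h" "AE x in M. (norm (f x))\<^sup>2 \<le> h x"
  shows "Lsq M f"
  unfolding Lsq_def
proof
  show "integrable M (\<lambda>x. (norm (f x))\<^sup>2)"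
    by (rule Bochner_Integration.integrable_bound[OF assms(2)]) (use assms in auto)
qed fact

lemma norm_sq_add_le: "(norm (a + b))\<^sup>2 \<le> 2 * (norm a)\<^sup>2 + 2 * (norm (b::'a::real_inner))\<^sup>2"
proof -
  have "(norm (a + b))\<^sup>2 + (norm (a - b))\<^sup>2 = 2 * (norm a)\<^sup>2 + 2 * (norm b)\<^sup>2"
    by (simp add: power2_norm_eq_inner inner_add_left inner_add_right inner_diff_left inner_diff_right)
  then show ?thesis using zero_le_power2[of "norm (a - b)"] by linarith
qed

lemma Lsq_add: assumes "Lsq M f" "Lsq M g" shows "Lsq M (\<lambda>x. f x + g x)"
proof (rule Lsq_bound)
  show "(\<lambda>x. f x + g x) \<in> borel_measurable M" by (intro borel_measurable_add Lsq_meas assms)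
  show "integrable M (\<lambda>x. 2 * (norm (f x))\<^sup>2 + 2 * (norm (g x))\<^sup>2)" using assms by (simp add: Lsq_def)
qed (simp add: norm_sq_add_le)

lemma Lsq_scale: assumes "Lsq M f" shows "Lsq M (\<lambda>x. c *\<^sub>R f x)"
  using assms by (auto simp: Lsq_def power_mult_distrib)

lemma Lsq_diff: assumes "Lsq M f" "Lsq M g" shows "Lsq M (\<lambda>x. f x - g x)"
  using Lsq_add[OF assms(1) Lsq_scale[OF assms(2), of "-1"]] by simp

lemma Lsq_bounded:
  assumes "finite_measure M" "f \<in> borel_measurable M" "AE x in M. norm (f x) \<le> C"
  shows "Lsq M f"
proof (rule Lsq_bound[OF assms(2)])
  interpret finite_measure M by fact
  show "integrable M (\<lambda>x. C\<^sup>2)" by simp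
  show "AE x in M. (norm (f x))\<^sup>2 \<le> C\<^sup>2" using assms(3) by eventually_elim (auto intro: power_mono)
qed

lemma inner_le_sq: "\<bar>a \<bullet> b\<bar> \<le> (norm a)\<^sup>2 + (norm (b::'a::real_inner))\<^sup>2"
proof -
  have "\<bar>a \<bullet> b\<bar> \<le> norm a * norm b" by (rule Cauchy_Schwarz_ineq2)
  also have "\<dots> \<le> (norm a)\<^sup>2 + (norm b)\<^sup>2"
    using sum_squares_bound[of "norm a" "norm b"] mult_nonneg_nonneg[OF norm_ge_zero norm_ge_zero, of a b] by linarith
  finally show ?thesis .
qed

lemma Lsq_inner: assumes "Lsq M f" "Lsq M g" shows "integrable M (\<lambda>x. f x \<bullet> g x)"
proof (rule Bochner_Integration.integrable_bound)
  show "integrable M (\<lambda>x. (norm (f x))\<^sup>2 + (norm (g x))\<^sup>2)" using assms by (simp add: Lsq_def)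
  show "(\<lambda>x. f x \<bullet> g x) \<in> borel_measurable M" using assms by (simp add: Lsq_def borel_measurable_inner)
qed (simp add: inner_le_sq)

lemma Lsq_integral_comb:
  assumes "Lsq M f" "Lsq M g" "Lsq M h"
  shows "(\<integral>x. (a *\<^sub>R f x + b *\<^sub>R g x) \<bullet> h x \<partial>M) = a * (\<integral>x. f x \<bullet> h x \<partial>M) + b * (\<integral>x. g x \<bullet> h x \<partial>M)"
  using Lsq_inner[OF assms(1,3)] Lsq_inner[OF assms(2,3)] by (simp add: inner_add_left)

lemma Lsq_integrable: assumes "finite_measure M" "Lsq M f" shows "integrable M f"
proof -
  interpret finite_measure M by fact
  show ?thesis
  proof (rule Bochner_Integration.integrable_bound)
    show "integrable M (\<lambda>x. 1 + (norm (f x))\<^sup>2)" using assms by (simp add: Lsq_def)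
    have "norm (f x) \<le> 1 + (norm (f x))\<^sup>2" for x
      using sum_squares_bound[of 1 "norm (f x)"] norm_ge_zero[of "f x"] by (simp del: norm_ge_zero)
    then show "AE x in M. norm (f x) \<le> norm (1 + (norm (f x))\<^sup>2)" by simp
  qed (use assms in \<open>simp add: Lsq_def\<close>)
qed

text \<open>
  The square of the norm in \<open>L^2\<close>.
\<close>

definition nsq :: "'a measure \<Rightarrow> ('a \<Rightarrow> 'b::euclidean_space) \<Rightarrow> real" where
  "nsq M f = (\<integral>x. (norm (f x))\<^sup>2 \<partial>M)"

lemma nsq_nonneg: "nsq M f \<ge> 0" by (simp add: nsq_def)

lemma nsq_comb:
  assumes "Lsq M f" "Lsq M g"
  shows "nsq M (\<lambda>x. f x + c *\<^sub>R g x) = nsq M f + 2 * c * (\<integral>x. f x \<bullet> g x \<partial>M) + c\<^sup>2 * nsq M g"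
proof -
  have "(norm (f x + c *\<^sub>R g x))\<^sup>2 = (norm (f x))\<^sup>2 + (2 * c) * (f x \<bullet> g x) + c\<^sup>2 * (norm (g x))\<^sup>2" for x
    unfolding power2_norm_eq_inner
    by (simp add: inner_add_left inner_add_right inner_commute power2_eq_square algebra_simps)
  then have "nsq M (\<lambda>x. f x + c *\<^sub>R g x) = (\<integral>x. (norm (f x))\<^sup>2 + (2 * c) * (f x \<bullet> g x) + c\<^sup>2 * (norm (g x))\<^sup>2 \<partial>M)"
    by (simp add: nsq_def)
  also have "\<dots> = nsq M f + 2 * c * (\<integral>x. f x \<bullet> g x \<partial>M) + c\<^sup>2 * nsq M g"
    using assms Lsq_inner[OF assms] by (simp add: nsq_def Lsq_def)
  finally show ?thesis .
qed

lemma quadratic_nonneg: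
  fixes a b c :: real
  assumes q: "\<And>t. 0 \<le> a + 2 * t * c + t\<^sup>2 * b" and b0: "b \<ge> 0"
  shows "c\<^sup>2 \<le> a * b"
proof (cases "b = 0")
  case True
  have "c = 0"
  proof (rule ccontr)
    assume c: "c \<noteq> 0"
    have "2 * (- (a + 1) / (2 * c)) * c = - (a + 1)" using c by (simp add: field_simps)
    then show False using q[of "- (a + 1) / (2 * c)"] True by simp
  qed
  then show ?thesis using True by simp
next
  case False
  have b: "b > 0" using b0 False by simp
  have "a + 2 * (- c / b) * c + (- c / b)\<^sup>2 * b = a - c\<^sup>2 / b"
    using b by (simp add: field_simps power2_eq_square)
  then have "c\<^sup>2 / b \<le> a" using q[of "- c / b"] by linarith
  then show ?thesis using b by (simp add: field_simps)
qed

lemma Lsq_Cauchy_Schwarz: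
  assumes "Lsq M f" "Lsq M g"
  shows "(\<integral>x. f x \<bullet> g x \<partial>M)\<^sup>2 \<le> nsq M f * nsq M g"
proof (rule quadratic_nonneg)
  show "0 \<le> nsq M f + 2 * t * (\<integral>x. f x \<bullet> g x \<partial>M) + t\<^sup>2 * nsq M g" for t
    using nsq_comb[OF assms, of t] nsq_nonneg[of M "\<lambda>x. f x + t *\<^sub>R g x"] by simp
qed (rule nsq_nonneg)

lemma Lsq_Cauchy_Schwarz_abs:
  assumes "Lsq M f" "Lsq M g"
  shows "\<bar>\<integral>x. f x \<bullet> g x \<partial>M\<bar> \<le> sqrt (nsq M f) * sqrt (nsq M g)"
  using Lsq_Cauchy_Schwarz[OF assms] by (metis real_sqrt_abs real_sqrt_le_mono real_sqrt_mult)

lemma Lsq_tendsto_inner: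
  assumes x: "\<And>n. Lsq M (x n)" and F: "Lsq M F" and g: "Lsq M g"
    and lim: "(\<lambda>n. nsq M (\<lambda>p. x n p - F p)) \<longlonglongrightarrow> 0"
  shows "(\<lambda>n. \<integral>p. x n p \<bullet> g p \<partial>M) \<longlonglongrightarrow> (\<integral>p. F p \<bullet> g p \<partial>M)"
proof -
  have "(\<lambda>n. (\<integral>p. x n p \<bullet> g p \<partial>M) - (\<integral>p. F p \<bullet> g p \<partial>M)) \<longlonglongrightarrow> 0"
  proof (rule Lim_null_comparison)
    show "\<forall>\<^sub>F n in sequentially. norm ((\<integral>p. x n p \<bullet> g p \<partial>M) - (\<integral>p. F p \<bullet> g p \<partial>M)) \<le> sqrt (nsq M (\<lambda>p. x n p - F p)) * sqrt (nsq M g)"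
    proof (intro always_eventually allI)
      fix n
      have "(\<integral>p. x n p \<bullet> g p \<partial>M) - (\<integral>p. F p \<bullet> g p \<partial>M) = (\<integral>p. (x n p - F p) \<bullet> g p \<partial>M)"
        by (simp add: inner_diff_left Lsq_inner x F g)
      then show "norm ((\<integral>p. x n p \<bullet> g p \<partial>M) - (\<integral>p. F p \<bullet> g p \<partial>M)) \<le> sqrt (nsq M (\<lambda>p. x n p - F p)) * sqrt (nsq M g)"
        using Lsq_Cauchy_Schwarz_abs[OF Lsq_diff[OF x F] g, of n] by simp
    qed
    have "(\<lambda>n. sqrt (nsq M (\<lambda>p. x n p - F p)) * sqrt (nsq M g)) \<longlonglongrightarrow> sqrt 0 * sqrt (nsq M g)"
      by (intro tendsto_intros lim)
    then show "(\<lambda>n. sqrt (nsq M (\<lambda>p. x n p - F p)) * sqrt (nsq M g)) \<longlonglongrightarrow> 0" by simp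
  qed
  then show ?thesis by (simp add: LIM_zero_iff)
qed

section \<open>Almost minimal elements of nested convex sets\<close>

text \<open>
  The theorem of Riesz and Fischer, with almost everywhere convergence of a subsequence.
\<close>

lemma nsq_cauchy_imp_limit:
  fixes y :: "nat \<Rightarrow> 'a \<Rightarrow> 'b::euclidean_space"
  assumes fin: "finite_measure M" and y: "\<And>n. Lsq M (y n)"
    and cau: "\<And>e. e > 0 \<Longrightarrow> \<exists>N. \<forall>n\<ge>N. \<forall>m\<ge>N. nsq M (\<lambda>p. y n p - y m p) \<le> e"
  obtains s F where "strict_mono s" "Lsq M F" "(\<lambda>n. nsq M (\<lambda>p. y (s n) p - F p)) \<longlonglongrightarrow> 0"
    "AE p in M. (\<lambda>n. y (s n) p) \<longlonglongrightarrow> F p"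
proof -
  interpret finite_measure M by fact
  have one: "Lsq M (\<lambda>x. 1 :: real)" by (simp add: Lsq_def)
  have L1: "(\<integral>x. norm (f x) \<partial>M)\<^sup>2 \<le> nsq M f * measure M (space M)" if "Lsq M f" for f :: "'a \<Rightarrow> 'b"
  proof -
    have "Lsq M (\<lambda>x. norm (f x))" using that by (auto simp: Lsq_def)
    from Lsq_Cauchy_Schwarz[OF this one] show ?thesis by (simp add: nsq_def)
  qed
  have "\<exists>N. \<forall>i\<ge>N. \<forall>j\<ge>N. (\<integral>x. norm (y i x - y j x) \<partial>M) < e" if e: "e > 0" for e
  proof -
    let ?m = "measure M (space M) + 1"
    have m: "?m > 0" using measure_nonneg[of M "space M"] by linarith
    obtain N where N: "\<And>n m. n \<ge> N \<Longrightarrow> m \<ge> N \<Longrightarrow> nsq M (\<lambda>p. y n p - y m p) \<le> (e / 2)\<^sup>2 / ?m"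
      using cau[of "(e / 2)\<^sup>2 / ?m"] e m by auto
    have "(\<integral>x. norm (y i x - y j x) \<partial>M) < e" if "i \<ge> N" "j \<ge> N" for i j
    proof -
      have "(\<integral>x. norm (y i x - y j x) \<partial>M)\<^sup>2 \<le> nsq M (\<lambda>p. y i p - y j p) * measure M (space M)"
        by (rule L1[OF Lsq_diff[OF y y]])
      also have "\<dots> \<le> ((e / 2)\<^sup>2 / ?m) * ?m"
        using N[OF that] m by (intro mult_mono) auto
      also have "\<dots> = (e / 2)\<^sup>2" using m by simp
      finally have "(\<integral>x. norm (y i x - y j x) \<partial>M) \<le> e / 2" using e by (simp add: power2_le_iff_abs_le)
      then show ?thesis using e by linarith
    qed
    then show ?thesis by blast
  qed
  then obtain s where s: "strict_mono s" "AE x in M. Cauchy (\<lambda>i. y (s i) x)"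
    by (rule cauchy_L1_AE_cauchy_subseq[OF Lsq_integrable[OF fin y]])
  define F where "F x = lim (\<lambda>i. y (s i) x)" for x
  have ym [measurable]: "y n \<in> borel_measurable M" for n using y by (simp add: Lsq_def)
  have Fm [measurable]: "F \<in> borel_measurable M" unfolding F_def by measurable
  have ae: "AE p in M. (\<lambda>n. y (s n) p) \<longlonglongrightarrow> F p"
    using s(2) by eventually_elim (simp add: F_def Cauchy_convergent convergent_LIMSEQ_iff[symmetric])
  \<comment> \<open>by the lemma of Fatou\<close>
  have key: "Lsq M (\<lambda>p. y (s n) p - F p) \<and> nsq M (\<lambda>p. y (s n) p - F p) \<le> e"
    if e: "e > 0" and N: "\<And>n m. n \<ge> N \<Longrightarrow> m \<ge> N \<Longrightarrow> nsq M (\<lambda>p. y n p - y m p) \<le> e" and n: "n \<ge> N" for e N n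
  proof -
    have sn: "s k \<ge> k" for k using s(1) by (rule seq_suble)
    have "(\<integral>\<^sup>+ p. ennreal ((norm (y (s n) p - F p))\<^sup>2) \<partial>M)
      = (\<integral>\<^sup>+ p. liminf (\<lambda>m. ennreal ((norm (y (s n) p - y (s m) p))\<^sup>2)) \<partial>M)"
    proof (rule nn_integral_cong_AE)
      show "AE p in M. ennreal ((norm (y (s n) p - F p))\<^sup>2) = liminf (\<lambda>m. ennreal ((norm (y (s n) p - y (s m) p))\<^sup>2))"
        using ae
      proof eventually_elim
        case (elim p)
        have "(\<lambda>m. ennreal ((norm (y (s n) p - y (s m) p))\<^sup>2)) \<longlonglongrightarrow> ennreal ((norm (y (s n) p - F p))\<^sup>2)"
          using elim by (intro tendsto_ennrealI tendsto_intros)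
        then show ?case by (intro lim_imp_Liminf[symmetric]) auto
      qed
    qed
    also have "\<dots> \<le> liminf (\<lambda>m. \<integral>\<^sup>+ p. ennreal ((norm (y (s n) p - y (s m) p))\<^sup>2) \<partial>M)"
      by (rule nn_integral_liminf) measurable
    also have "\<dots> \<le> limsup (\<lambda>m. \<integral>\<^sup>+ p. ennreal ((norm (y (s n) p - y (s m) p))\<^sup>2) \<partial>M)"
      by (rule Liminf_le_Limsup) simp
    also have "\<dots> \<le> ennreal e"
    proof (rule Limsup_bounded)
      show "\<forall>\<^sub>F m in sequentially. (\<integral>\<^sup>+ p. ennreal ((norm (y (s n) p - y (s m) p))\<^sup>2) \<partial>M) \<le> ennreal e"
        unfolding eventually_sequentially
      proof (intro exI[of _ N] allI impI)
        fix m assume "m \<ge> N"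
        then have "nsq M (\<lambda>p. y (s n) p - y (s m) p) \<le> e" using N sn n by (meson order_trans)
        moreover have "(\<integral>\<^sup>+ p. ennreal ((norm (y (s n) p - y (s m) p))\<^sup>2) \<partial>M) = ennreal (nsq M (\<lambda>p. y (s n) p - y (s m) p))"
          unfolding nsq_def by (intro nn_integral_eq_integral Lsq_int Lsq_diff y) auto
        ultimately show "(\<integral>\<^sup>+ p. ennreal ((norm (y (s n) p - y (s m) p))\<^sup>2) \<partial>M) \<le> ennreal e"
          by (simp add: ennreal_leI)
      qed
    qed
    finally have le: "(\<integral>\<^sup>+ p. ennreal ((norm (y (s n) p - F p))\<^sup>2) \<partial>M) \<le> ennreal e" .
    have L: "Lsq M (\<lambda>p. y (s n) p - F p)" unfolding Lsq_def
    proof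
      show "integrable M (\<lambda>x. (norm (y (s n) x - F x))\<^sup>2)"
        by (rule integrableI_nonneg) (use le in \<open>auto simp: order.strict_trans1\<close>)
    qed measurable
    moreover have "ennreal (nsq M (\<lambda>p. y (s n) p - F p)) \<le> ennreal e"
      using le nn_integral_eq_integral[OF Lsq_int[OF L]] by (simp add: nsq_def)
    ultimately show ?thesis using e by (simp add: ennreal_le_iff)
  qed
  obtain N where "\<forall>n\<ge>N. \<forall>m\<ge>N. nsq M (\<lambda>p. y n p - y m p) \<le> 1" using cau[of 1] by auto
  then have "Lsq M (\<lambda>p. y (s N) p - F p)" using key[of 1 N N] by auto
  from Lsq_diff[OF y this, of "s N"] have "Lsq M F" by simp
  moreover have "(\<lambda>n. nsq M (\<lambda>p. y (s n) p - F p)) \<longlonglongrightarrow> 0"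
  proof (rule LIMSEQ_I)
    fix e :: real assume e: "e > 0"
    obtain N where N: "\<forall>n\<ge>N. \<forall>m\<ge>N. nsq M (\<lambda>p. y n p - y m p) \<le> e / 2" using cau[of "e / 2"] e by auto
    have "norm (nsq M (\<lambda>p. y (s n) p - F p) - 0) < e" if "n \<ge> N" for n
      using key[of "e / 2" N n] N e that nsq_nonneg[of M "\<lambda>p. y (s n) p - F p"] by auto
    then show "\<exists>no. \<forall>n\<ge>no. norm (nsq M (\<lambda>p. y (s n) p - F p) - 0) < e" by blast
  qed
  ultimately show ?thesis using that[OF s(1) _ _ ae] by blast
qed

text \<open>
  This replaces weak compactness. The minimal norms of the sets \<open>C n\<close> increase to a limit, so by the
  parallelogram identity elements of almost minimal norm are a Cauchy sequence in \<open>L^2\<close>.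
\<close>

lemma nested_midconvex_limit:
  fixes C :: "nat \<Rightarrow> ('a \<Rightarrow> 'b::euclidean_space) set"
  assumes fin: "finite_measure M"
    and ne: "\<And>n. C n \<noteq> {}" and dec: "\<And>n. C (Suc n) \<subseteq> C n"
    and mid: "\<And>n f g. f \<in> C n \<Longrightarrow> g \<in> C n \<Longrightarrow> (\<lambda>x. (1/2) *\<^sub>R (f x + g x)) \<in> C n"
    and L: "\<And>n f. f \<in> C n \<Longrightarrow> Lsq M f"
    and bd: "\<And>n f. f \<in> C n \<Longrightarrow> nsq M f \<le> R"
  obtains x F where "\<And>n. x n \<in> C n" "Lsq M F" "(\<lambda>n. nsq M (\<lambda>p. x n p - F p)) \<longlonglongrightarrow> 0"
    "AE p in M. (\<lambda>n. x n p) \<longlonglongrightarrow> F p"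
proof -
  define r where "r n = Inf (nsq M ` C n)" for n
  have bb: "bdd_below (nsq M ` C n)" for n by (rule bdd_belowI[of _ 0]) (auto simp: nsq_nonneg)
  have mono: "C m \<subseteq> C n" if "n \<le> m" for n m using that by (rule lift_Suc_antimono_le[of C, OF dec])
  have rmono: "r n \<le> r m" if "n \<le> m" for n m
    unfolding r_def by (intro cInf_superset_mono image_mono mono that bb) (use ne in auto)
  have rle: "r n \<le> nsq M f" if "f \<in> C n" for n f
    unfolding r_def by (intro cInf_lower bb imageI that)
  have "r n \<le> R" for n
  proof -
    obtain f where "f \<in> C n" using ne by blast
    then show ?thesis using rle bd by (meson order_trans)
  qed
  moreover have "incseq r" using rmono by (simp add: incseq_def)
  ultimately obtain l where "r \<longlonglongrightarrow> l" by (metis incseq_convergent)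
  then have "Cauchy r" by (rule LIMSEQ_imp_Cauchy)
  have "\<exists>f\<in>C n. nsq M f < r n + 1 / real (Suc n)" for n
    using cInf_lessD[of "nsq M ` C n" "r n + 1 / real (Suc n)"] ne by (auto simp: r_def)
  then obtain y where y: "\<And>n. y n \<in> C n" "\<And>n. nsq M (y n) < r n + 1 / real (Suc n)" by metis
  have yL: "Lsq M (y n)" for n by (rule L[OF y(1)])
  have step: "nsq M (\<lambda>p. y n p - y m p) \<le> 2 * (r m - r n) + 4 / real (Suc n)" if "n \<le> m" for n m
  proof -
    have "y m \<in> C n" using mono[OF that] y(1) by blast
    then have "r n \<le> nsq M (\<lambda>x. (1/2) *\<^sub>R (y n x + y m x))" by (intro rle mid y(1))
    also have "\<dots> = nsq M (\<lambda>x. y n x + 1 *\<^sub>R y m x) / 4"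
      by (simp add: nsq_def power_mult_distrib power2_eq_square)
    finally have 1: "4 * r n \<le> nsq M (y n) + 2 * (\<integral>x. y n x \<bullet> y m x \<partial>M) + nsq M (y m)"
      unfolding nsq_comb[OF yL yL] by simp
    have 2: "nsq M (\<lambda>p. y n p - y m p) = nsq M (y n) - 2 * (\<integral>x. y n x \<bullet> y m x \<partial>M) + nsq M (y m)"
      using nsq_comb[OF yL[of n] yL[of m], of "-1"] by simp
    have "1 / real (Suc m) \<le> 1 / real (Suc n)" using that by (intro divide_left_mono) auto
    then have "nsq M (y m) < r m + 1 / real (Suc n)" using y(2)[of m] by linarith
    moreover have "4 / real (Suc n) = 4 * (1 / real (Suc n))" by simp
    ultimately show ?thesis using 1 2 y(2)[of n] unfolding right_diff_distrib by linarith
  qed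
  have cau: "\<exists>N. \<forall>n\<ge>N. \<forall>m\<ge>N. nsq M (\<lambda>p. y n p - y m p) \<le> e" if e: "e > 0" for e
  proof -
    obtain N1 where N1: "\<And>n m. n \<ge> N1 \<Longrightarrow> m \<ge> N1 \<Longrightarrow> \<bar>r n - r m\<bar> < e / 4"
      using CauchyD[OF \<open>Cauchy r\<close>, of "e / 4"] e by auto
    obtain N2 where N2: "1 / real (Suc N2) < e / 8" using nat_approx_posE[of "e / 8"] e by auto
    have main: "nsq M (\<lambda>p. y n p - y m p) \<le> e" if "n \<ge> max N1 N2" "n \<le> m" for n m
    proof -
      have "\<bar>r m - r n\<bar> < e / 4" using N1[of m n] that by simp
      moreover have "1 / real (Suc n) \<le> 1 / real (Suc N2)" using that by (intro divide_left_mono) auto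
      moreover have "4 / real (Suc n) = 4 * (1 / real (Suc n))" by simp
      ultimately show ?thesis using step[OF that(2)] N2 unfolding right_diff_distrib by linarith
    qed
    have "nsq M (\<lambda>p. y n p - y m p) \<le> e" if "n \<ge> max N1 N2" "m \<ge> max N1 N2" for n m
    proof (cases "n \<le> m")
      case False
      then show ?thesis using main[of m n] that by (simp add: nsq_def norm_minus_commute)
    qed (use main that in auto)
    then show ?thesis by blast
  qed
  obtain s F where sF: "strict_mono s" "Lsq M F" "(\<lambda>n. nsq M (\<lambda>p. y (s n) p - F p)) \<longlonglongrightarrow> 0"
    "AE p in M. (\<lambda>n. y (s n) p) \<longlonglongrightarrow> F p"
    using nsq_cauchy_imp_limit[OF fin yL cau] by blast
  have "y (s n) \<in> C n" for n using y(1) mono[OF seq_suble[OF sF(1), of n]] by blast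
  then show ?thesis using that[of "\<lambda>n. y (s n)" F] sF by blast
qed

section \<open>Positive semidefinite matrices\<close>

lemma contract_inner: "contract A M = A \<bullet> M"
  by (simp add: contract_def inner_vec_def)

lemma contract_tensor: "contract A (tensor v v) = v \<bullet> (A *v v)"
  by (simp add: contract_def tensor_def inner_vec_def matrix_vector_mult_def sum_distrib_left mult_ac)

lemma contract_mat1: "contract B (c *\<^sub>R mat 1) = c * trace B"
  by (simp add: contract_def mat_def trace_def if_distrib[of "\<lambda>x. _ * x"] sum_distrib_left mult_ac cong: if_cong)

text \<open>
  Only used for symmetric matrices.
\<close>

definition psd :: "real^'n^'n \<Rightarrow> bool" where
  "psd A \<longleftrightarrow> (\<forall>v. 0 \<le> v \<bullet> (A *v v))"

lemma sym_mat_inner: "sym_mat A \<Longrightarrow> v \<bullet> (A *v w) = w \<bullet> (A *v v)"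
  unfolding sym_mat_def by (metis dot_lmul_matrix inner_commute transpose_matrix_vector vector_transpose_matrix)

lemma psd_Cauchy_Schwarz:
  assumes "sym_mat A" "psd A"
  shows "(v \<bullet> (A *v w))\<^sup>2 \<le> (v \<bullet> (A *v v)) * (w \<bullet> (A *v w))"
proof (rule quadratic_nonneg)
  fix t
  have "0 \<le> (v + t *\<^sub>R w) \<bullet> (A *v (v + t *\<^sub>R w))" using assms(2) by (simp add: psd_def)
  also have "\<dots> = v \<bullet> (A *v v) + 2 * t * (v \<bullet> (A *v w)) + t\<^sup>2 * (w \<bullet> (A *v w))"
    by (simp add: matrix_vector_right_distrib matrix_vector_mult_scaleR inner_add_left inner_add_right
        sym_mat_inner[OF assms(1), of w v] power2_eq_square algebra_simps)
  finally show "0 \<le> v \<bullet> (A *v v) + 2 * t * (v \<bullet> (A *v w)) + t\<^sup>2 * (w \<bullet> (A *v w))" .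
qed (use assms(2) in \<open>simp add: psd_def\<close>)

lemma axis_mat: "axis i 1 \<bullet> (A *v axis j 1) = (A::real^'n^'n) $ i $ j"
  by (simp add: inner_axis' matrix_vector_mult_basis column_def)

text \<open>
  By the Cauchy-Schwarz inequality, \<open>|A v|^2 = \<Sum>_i (v \<cdot> A e_i)^2 \<le> (v \<cdot> A v) tr A\<close>.
\<close>

lemma psd_le_trace:
  assumes A: "sym_mat A" "psd A"
  shows "v \<bullet> (A *v v) \<le> trace A * (norm v)\<^sup>2"
proof -
  let ?q = "v \<bullet> (A *v v)"
  have q0: "?q \<ge> 0" using A by (simp add: psd_def)
  have "(norm (A *v v))\<^sup>2 = (\<Sum>i\<in>UNIV. ((A *v v) $ i)\<^sup>2)"
    unfolding power2_norm_eq_inner inner_vec_def by (simp add: power2_eq_square)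
  also have "\<dots> = (\<Sum>i\<in>UNIV. (v \<bullet> (A *v axis i 1))\<^sup>2)"
    by (intro sum.cong refl) (simp add: sym_mat_inner[OF A(1), of v] inner_axis')
  also have "\<dots> \<le> (\<Sum>i\<in>UNIV. ?q * A $ i $ i)"
    using psd_Cauchy_Schwarz[OF A, of v] by (intro sum_mono) (metis axis_mat)
  also have "\<dots> = ?q * trace A" by (simp add: trace_def sum_distrib_left)
  finally have 1: "(norm (A *v v))\<^sup>2 \<le> ?q * trace A" .
  have "?q\<^sup>2 \<le> (norm v * norm (A *v v))\<^sup>2"
    using q0 by (intro power_mono norm_cauchy_schwarz) auto
  also have "\<dots> \<le> (norm v)\<^sup>2 * (?q * trace A)"
    unfolding power_mult_distrib by (intro mult_left_mono 1) auto
  finally have 2: "?q * ?q \<le> ?q * (trace A * (norm v)\<^sup>2)" by (simp add: power2_eq_square mult_ac)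
  have tr: "trace A \<ge> 0" unfolding trace_def using A(2) axis_mat[of _ A] by (intro sum_nonneg) (metis psd_def)
  show ?thesis
  proof (cases "?q = 0")
    case False
    then have "?q > 0" using q0 by simp
    then show ?thesis using 2 by (simp only: mult_le_cancel_left_pos)
  qed (use tr in simp)
qed

lemma psd_entry_le:
  assumes A: "sym_mat A" "psd A"
  shows "\<bar>A $ i $ j\<bar> \<le> trace A"
proof -
  have d0: "A $ k $ k \<ge> 0" for k using A(2) axis_mat[of k A k] by (metis psd_def)
  have dt: "A $ k $ k \<le> trace A" for k
    unfolding trace_def by (rule member_le_sum) (auto simp: d0)
  have "(A $ i $ j)\<^sup>2 \<le> A $ i $ i * A $ j $ j" using psd_Cauchy_Schwarz[OF A, of "axis i 1" "axis j 1"] by (simp add: axis_mat)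
  also have "\<dots> \<le> trace A * trace A" using d0 dt order_trans[OF d0 dt] by (intro mult_mono) auto
  finally have "\<bar>A $ i $ j\<bar>\<^sup>2 \<le> (trace A)\<^sup>2" by (simp add: power2_eq_square)
  then show ?thesis using order_trans[OF d0 dt] by (meson abs_ge_zero power2_le_imp_le)
qed

text \<open>The matrices to which the values of \<open>B\<close> belong almost everywhere when \<open>K[E,B]\<close> is finite.\<close>

definition constrained :: "real^'n^'n \<Rightarrow> bool" where
  "constrained B \<longleftrightarrow> sym_mat B \<and> psd (mat 1 + 2 *\<^sub>R B) \<and> trace B = 0"

lemma constrained_A:
  assumes "constrained (B::real^'n^'n)"
  shows "sym_mat (mat 1 + 2 *\<^sub>R B)" "trace (mat 1 + 2 *\<^sub>R B) = real CARD('n)"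
proof -
  show "sym_mat (mat 1 + 2 *\<^sub>R B)" using assms
    by (simp add: constrained_def sym_mat_def transpose_def vec_eq_iff mat_def)
  show "trace (mat 1 + 2 *\<^sub>R B) = real CARD('n)"
    using assms by (simp add: constrained_def trace_def sum.distrib mat_def flip: sum_distrib_left)
qed

lemma constrained_upper:
  assumes "constrained (B::real^'n^'n)"
  shows "v \<bullet> ((mat 1 + 2 *\<^sub>R B) *v v) \<le> real CARD('n) * (norm v)\<^sup>2"
  using psd_le_trace[OF constrained_A(1)[OF assms], of v] assms constrained_A(2)[OF assms] by (simp add: constrained_def)

lemma constrained_spect:
  assumes "constrained (B::real^'n^'n)"
  shows "spect B \<subseteq> {- 1/2 .. (real CARD('n) - 1) / 2}"
proof
  fix c assume "c \<in> spect B"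
  then obtain v where v: "v \<noteq> 0" "B *v v = c *\<^sub>R v" by (auto simp: spect_def)
  have "(mat 1 + 2 *\<^sub>R B) *v v = v + 2 *\<^sub>R (B *v v)"
    by (simp add: matrix_vector_mult_add_rdistrib scaleR_matrix_vector_assoc)
  then have eq: "v \<bullet> ((mat 1 + 2 *\<^sub>R B) *v v) = (1 + 2 * c) * (norm v)\<^sup>2"
    by (simp add: v(2) inner_add_right power2_norm_eq_inner algebra_simps)
  have n: "(norm v)\<^sup>2 > 0" using v by simp
  have "0 \<le> (1 + 2 * c) * (norm v)\<^sup>2" using assms unfolding eq[symmetric] by (simp add: constrained_def psd_def)
  then have "0 \<le> 1 + 2 * c" using n by (simp add: zero_le_mult_iff)
  moreover have "1 + 2 * c \<le> real CARD('n)"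
    using constrained_upper[OF assms, of v] n unfolding eq by simp
  ultimately show "c \<in> {- 1/2 .. (real CARD('n) - 1) / 2}" by simp
qed

text \<open>
  A bound on the norm of constrained matrices, far from optimal.
\<close>

definition constrained_bound :: "'n::finite itself \<Rightarrow> real" where
  "constrained_bound _ = (real CARD('n))\<^sup>2 * (real CARD('n) + 1)"

lemma constrained_norm:
  assumes "constrained (B::real^'n^'n)"
  shows "norm B \<le> constrained_bound TYPE('n)"
proof -
  let ?d = "real CARD('n)"
  have e: "\<bar>B $ i $ j\<bar> \<le> ?d + 1" for i j
  proof -
    have "\<bar>(mat 1 + 2 *\<^sub>R B) $ i $ j\<bar> \<le> ?d"
      using psd_entry_le[OF constrained_A(1)[OF assms], of i j] assms constrained_A(2)[OF assms] by (simp add: constrained_def)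
    then show ?thesis by (auto simp: mat_def split: if_splits)
  qed
  have "norm B \<le> (\<Sum>i\<in>UNIV. norm (B $ i))" unfolding norm_vec_def by (rule L2_set_le_sum) auto
  also have "\<dots> \<le> (\<Sum>i\<in>(UNIV::'n set). \<Sum>j\<in>(UNIV::'n set). \<bar>B $ i $ j\<bar>)" by (intro sum_mono norm_le_l1_cart)
  also have "\<dots> \<le> (\<Sum>i\<in>(UNIV::'n set). \<Sum>j\<in>(UNIV::'n set). ?d + 1)" by (intro sum_mono e)
  also have "\<dots> = constrained_bound TYPE('n)" by (simp add: constrained_bound_def power2_eq_square)
  finally show ?thesis .
qed

section \<open>Iterated integrals on the cylinder\<close>

lemma time_measure: "T \<ge> 0 \<Longrightarrow> measure (restrict_space lborel {0..T::real}) {0..T} = T"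
  by (simp add: measure_restrict_space)

lemma cylinder_fubini:
  fixes f :: "real \<times> (real^'n) \<Rightarrow> 'b::euclidean_space"
  assumes "integrable (cylinder T) f"
  shows "AE t in restrict_space lborel {0..T}. integrable torus (\<lambda>x. f (t, x))"
    and "integrable (restrict_space lborel {0..T}) (\<lambda>t. \<integral>x. f (t, x) \<partial>torus)"
    and "(\<integral>t. (\<integral>x. f (t, x) \<partial>torus) \<partial>restrict_space lborel {0..T}) = (\<integral>p. f p \<partial>cylinder T)"
  using assms unfolding cylinder_def
  by (auto intro: cyl.AE_integrable_fst' cyl.integrable_fst' cyl.integral_fst')

lemma snd_meas: "snd \<in> measurable (cylinder T) torus" unfolding cylinder_def by simp

lemma cylinder_snd:
  fixes h :: "real^'n \<Rightarrow> real"
  assumes h: "integrable torus h" and T: "T \<ge> 0"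
  shows "integrable (cylinder T) (\<lambda>p. h (snd p))" "(\<integral>p. h (snd p) \<partial>cylinder T) = T * (\<integral>x. h x \<partial>torus)"
proof -
  interpret t: finite_measure "restrict_space lborel {0..T}" by (rule time_finite)
  have hm: "h \<in> borel_measurable torus" using h by auto
  have m: "(\<lambda>p. h (snd p)) \<in> borel_measurable (cylinder T)"
    by (rule measurable_compose[OF snd_meas hm])
  show i: "integrable (cylinder T) (\<lambda>p. h (snd p))"
    unfolding cylinder_def
  proof (rule cyl.Fubini_integrable)
    show "(\<lambda>p. h (snd p)) \<in> borel_measurable (restrict_space lborel {0..T} \<Otimes>\<^sub>M torus)" using m by (simp add: cylinder_def)
  qed (use h in simp_all)
  show "(\<integral>p. h (snd p) \<partial>cylinder T) = T * (\<integral>x. h x \<partial>torus)"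
    using cylinder_fubini(3)[OF i] time_measure[OF T] by simp
qed

section \<open>The class of competitors and the functional K\<close>

lemma square_integrable_Lsq: "square_integrable M f \<longleftrightarrow> Lsq M f"
  by (simp add: square_integrable_def Lsq_def)

lemma cont_Lsq:
  fixes f :: "real \<times> (real^'n) \<Rightarrow> 'b::euclidean_space"
  assumes "continuous_on ({0..T} \<times> UNIV) f"
  shows "Lsq (cylinder T) f"
proof -
  obtain C where "\<And>p. p \<in> space (cylinder T) \<Longrightarrow> norm (f p) \<le> C" using cylinder_cont_bounded[OF assms] by metis
  then show ?thesis by (intro Lsq_bounded[OF cylinder_finite cylinder_measurable_cont[OF assms]] AE_I2)
qed

lemma EB_Lsq:
  assumes "(E, B) \<in> EB_class T"
  shows "Lsq (cylinder T) E" "Lsq (cylinder T) B"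
proof -
  show "Lsq (cylinder T) E" using assms by (simp add: EB_class_def square_integrable_Lsq)
  obtain C where "AE p in cylinder T. norm (B p) \<le> C" "B \<in> borel_measurable (cylinder T)"
    using assms by (auto simp: EB_class_def)
  then show "Lsq (cylinder T) B" by (intro Lsq_bounded[OF cylinder_finite])
qed

lemma smooth_deriv:
  fixes \<zeta> :: "real \<Rightarrow> real" assumes "smooth \<zeta>"
  shows "continuous_on UNIV (deriv \<zeta>)" "(\<zeta> has_field_derivative deriv \<zeta> t) (at t)"
proof -
  have d: "\<zeta> differentiable (at t)" for t using assms by (rule smooth_imp_differentiable)
  then show D: "(\<zeta> has_field_derivative deriv \<zeta> t) (at t)" for t
    by (metis DERIV_imp_deriv real_differentiable_def)
  have "frechet_derivative \<zeta> (at t) 1 = deriv \<zeta> t" for t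
    using frechet_derivative_eq[OF D[of t, unfolded has_field_derivative_def]] by simp
  then show "continuous_on UNIV (deriv \<zeta>)"
    using smooth_imp_continuous[OF smooth_frechet_derivative[OF assms, of 1]] by simp
qed

text \<open>
  The dual field as a vector field.
\<close>

definition dualv :: "(real^'n \<Rightarrow> real^'n^'n) \<Rightarrow> real^'n \<Rightarrow> real^'n" where
  "dualv \<psi> x = (\<chi> k. dual_field \<psi> k x)"

lemma dualv_cont: assumes "smooth_field \<psi>" shows "continuous_on UNIV (dualv \<psi>)"
  unfolding dualv_def[abs_def]
  by (intro continuous_on_vec_lambda smooth_imp_continuous dual_field_smooth assms)

lemma constraint_integral:
  fixes E :: "real \<times> (real^'n) \<Rightarrow> real^'n"
  assumes L: "Lsq (cylinder T) E" "Lsq (cylinder T) B" and \<zeta>: "smooth \<zeta>" and \<psi>: "smooth_field \<psi>"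
  shows "(\<integral>(t, x). contract (B (t, x)) (\<psi> x) * deriv \<zeta> t
            - (\<Sum>k\<in>UNIV. E (t, x) $ k * \<zeta> t * dual_field \<psi> k x) \<partial>cylinder T) =
    (\<integral>p. B p \<bullet> (deriv \<zeta> (fst p) *\<^sub>R \<psi> (snd p)) \<partial>cylinder T) - (\<integral>p. E p \<bullet> (\<zeta> (fst p) *\<^sub>R dualv \<psi> (snd p)) \<partial>cylinder T)"
    and "Lsq (cylinder T) (\<lambda>p. deriv \<zeta> (fst p) *\<^sub>R \<psi> (snd p))"
    and "Lsq (cylinder T) (\<lambda>p. \<zeta> (fst p) *\<^sub>R dualv \<psi> (snd p))"
proof -
  have c1: "continuous_on UNIV \<psi>" using \<psi> by (simp add: smooth_field_def smooth_imp_continuous)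
  show 1: "Lsq (cylinder T) (\<lambda>p. deriv \<zeta> (fst p) *\<^sub>R \<psi> (snd p))"
    by (intro cont_Lsq continuous_intros continuous_on_compose2[OF smooth_deriv(1)[OF \<zeta>]] continuous_on_compose2[OF c1]) auto
  show 2: "Lsq (cylinder T) (\<lambda>p. \<zeta> (fst p) *\<^sub>R dualv \<psi> (snd p))"
    by (intro cont_Lsq continuous_intros continuous_on_compose2[OF smooth_imp_continuous[OF \<zeta>]] continuous_on_compose2[OF dualv_cont[OF \<psi>]]) auto
  have eq: "(case p of (t, x) \<Rightarrow> contract (B (t, x)) (\<psi> x) * deriv \<zeta> t - (\<Sum>k\<in>UNIV. E (t, x) $ k * \<zeta> t * dual_field \<psi> k x))
    = B p \<bullet> (deriv \<zeta> (fst p) *\<^sub>R \<psi> (snd p)) - E p \<bullet> (\<zeta> (fst p) *\<^sub>R dualv \<psi> (snd p))" for p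
    by (cases p) (simp add: contract_inner inner_vec_def[of "E _"] dualv_def sum_distrib_left mult_ac)
  show "(\<integral>(t, x). contract (B (t, x)) (\<psi> x) * deriv \<zeta> t
            - (\<Sum>k\<in>UNIV. E (t, x) $ k * \<zeta> t * dual_field \<psi> k x) \<partial>cylinder T) =
    (\<integral>p. B p \<bullet> (deriv \<zeta> (fst p) *\<^sub>R \<psi> (snd p)) \<partial>cylinder T) - (\<integral>p. E p \<bullet> (\<zeta> (fst p) *\<^sub>R dualv \<psi> (snd p)) \<partial>cylinder T)"
    unfolding eq by (rule Bochner_Integration.integral_diff[OF Lsq_inner[OF L(2) 1] Lsq_inner[OF L(1) 2]])
qed

text \<open>
  The test functions of the evolution equation.
\<close>

definition testpair :: "(real \<Rightarrow> real) \<Rightarrow> (real^'n \<Rightarrow> real^'n^'n) \<Rightarrow> bool" where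
  "testpair \<zeta> \<psi> \<longleftrightarrow> smooth \<zeta> \<and> \<zeta> 0 = 0 \<and> smooth_field \<psi> \<and> (\<forall>x. sym_mat (\<psi> x))"

lemma EB_constraint_iff:
  assumes "Lsq (cylinder T) E" "Lsq (cylinder T) B"
  shows "EB_constraint T E B \<longleftrightarrow> (\<forall>\<zeta> \<psi>. testpair \<zeta> \<psi> \<longrightarrow>
    (\<integral>p. B p \<bullet> (deriv \<zeta> (fst p) *\<^sub>R \<psi> (snd p)) \<partial>cylinder T) = (\<integral>p. E p \<bullet> (\<zeta> (fst p) *\<^sub>R dualv \<psi> (snd p)) \<partial>cylinder T))"
  unfolding EB_constraint_def testpair_def
  by (intro iff_allI) (auto simp: constraint_integral(1)[OF assms] smooth_field_def)

lemma EB_class_iff: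
  "(E, B) \<in> EB_class T \<longleftrightarrow> Lsq (cylinder T) E \<and> B \<in> borel_measurable (cylinder T) \<and>
     (\<exists>C. AE p in cylinder T. norm (B p) \<le> C) \<and> (AE p in cylinder T. sym_mat (B p)) \<and>
    (\<forall>\<zeta> \<psi>. testpair \<zeta> \<psi> \<longrightarrow>
    (\<integral>p. B p \<bullet> (deriv \<zeta> (fst p) *\<^sub>R \<psi> (snd p)) \<partial>cylinder T) = (\<integral>p. E p \<bullet> (\<zeta> (fst p) *\<^sub>R dualv \<psi> (snd p)) \<partial>cylinder T))"
proof -
  have "Lsq (cylinder T) B" if "B \<in> borel_measurable (cylinder T)" "\<exists>C. AE p in cylinder T. norm (B p) \<le> C"
    using that Lsq_bounded[OF cylinder_finite] by blast
  then show ?thesis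
    unfolding EB_class_def mem_Collect_eq prod.case square_integrable_Lsq using EB_constraint_iff[of T E B] by blast
qed

lemma EB_class_comb:
  fixes E E' :: "real \<times> (real^'n) \<Rightarrow> real^'n"
  assumes 1: "(E, B) \<in> EB_class T" and 2: "(E', B') \<in> EB_class T"
  shows "((\<lambda>p. a *\<^sub>R E p + b *\<^sub>R E' p), (\<lambda>p. a *\<^sub>R B p + b *\<^sub>R B' p)) \<in> EB_class T"
  unfolding EB_class_iff
proof (intro conjI allI impI)
  note L1 = EB_Lsq[OF 1] and L2 = EB_Lsq[OF 2]
  show "Lsq (cylinder T) (\<lambda>p. a *\<^sub>R E p + b *\<^sub>R E' p)" by (intro Lsq_add Lsq_scale L1 L2)
  show "(\<lambda>p. a *\<^sub>R B p + b *\<^sub>R B' p) \<in> borel_measurable (cylinder T)"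
    by (intro Lsq_meas Lsq_add Lsq_scale L1 L2)
  obtain C C' where C: "AE p in cylinder T. norm (B p) \<le> C" "AE p in cylinder T. norm (B' p) \<le> C'"
    using 1 2 by (auto simp: EB_class_iff)
  show "\<exists>C. AE p in cylinder T. norm (a *\<^sub>R B p + b *\<^sub>R B' p) \<le> C"
    using C
  proof (intro exI, eventually_elim)
    case (elim p)
    then show "norm (a *\<^sub>R B p + b *\<^sub>R B' p) \<le> \<bar>a\<bar> * C + \<bar>b\<bar> * C'"
      by (intro norm_triangle_le add_mono) (auto intro: mult_left_mono)
  qed
  have "AE p in cylinder T. sym_mat (B p)" "AE p in cylinder T. sym_mat (B' p)"
    using 1 2 by (auto simp: EB_class_iff)
  then show "AE p in cylinder T. sym_mat (a *\<^sub>R B p + b *\<^sub>R B' p)"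
    by eventually_elim (simp add: sym_mat_def transpose_def vec_eq_iff)
  fix \<zeta> and \<psi> :: "real^'n \<Rightarrow> real^'n^'n" assume t: "testpair \<zeta> \<psi>"
  then have ts: "smooth \<zeta>" "smooth_field \<psi>" by (auto simp: testpair_def)
  note G = constraint_integral(2,3)[OF L1 ts]
  have e: "(\<integral>p. B p \<bullet> (deriv \<zeta> (fst p) *\<^sub>R \<psi> (snd p)) \<partial>cylinder T) = (\<integral>p. E p \<bullet> (\<zeta> (fst p) *\<^sub>R dualv \<psi> (snd p)) \<partial>cylinder T)"
    "(\<integral>p. B' p \<bullet> (deriv \<zeta> (fst p) *\<^sub>R \<psi> (snd p)) \<partial>cylinder T) = (\<integral>p. E' p \<bullet> (\<zeta> (fst p) *\<^sub>R dualv \<psi> (snd p)) \<partial>cylinder T)"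
    using 1 2 t unfolding EB_class_iff by blast+
  show "(\<integral>p. (a *\<^sub>R B p + b *\<^sub>R B' p) \<bullet> (deriv \<zeta> (fst p) *\<^sub>R \<psi> (snd p)) \<partial>cylinder T) =
    (\<integral>p. (a *\<^sub>R E p + b *\<^sub>R E' p) \<bullet> (\<zeta> (fst p) *\<^sub>R dualv \<psi> (snd p)) \<partial>cylinder T)"
    unfolding Lsq_integral_comb[OF L1(2) L2(2) G(1)] Lsq_integral_comb[OF L1(1) L2(1) G(2)] e ..
qed

text \<open>
  The quantity whose supremum over \<open>(Z, M)\<close> is \<open>K\<close>; it is affine in \<open>(E, B)\<close>.
\<close>

definition K_value :: "real \<Rightarrow> (real \<times> (real^'n) \<Rightarrow> real^'n) \<Rightarrow> (real \<times> (real^'n) \<Rightarrow> real^'n^'n) \<Rightarrow>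
   (real \<times> (real^'n) \<Rightarrow> real^'n) \<Rightarrow> (real \<times> (real^'n) \<Rightarrow> real^'n^'n) \<Rightarrow> real" where
  "K_value T E B Z M = 1/2 * (\<integral>p. 2 * (E p \<bullet> Z p) - contract (mat 1 + 2 *\<^sub>R B p) (M p) \<partial>cylinder T)"

lemma K_eq_SUP: "K T E B = (SUP (Z, M) \<in> K_admissible T. ereal (K_value T E B Z M))"
  by (simp add: K_def K_value_def)

lemma K_value_eq:
  assumes L: "Lsq (cylinder T) E" "Lsq (cylinder T) B" and Z: "Lsq (cylinder T) Z" and M: "Lsq (cylinder T) M"
  shows "K_value T E B Z M = (\<integral>p. E p \<bullet> Z p \<partial>cylinder T) - (\<integral>p. B p \<bullet> M p \<partial>cylinder T) - 1/2 * (\<integral>p. mat 1 \<bullet> M p \<partial>cylinder T)"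
proof -
  have one: "Lsq (cylinder T) (\<lambda>p::real \<times> (real^'a). mat 1 :: real^'a^'a)" by (intro cont_Lsq continuous_intros)
  have "(\<integral>p. 2 * (E p \<bullet> Z p) - contract (mat 1 + 2 *\<^sub>R B p) (M p) \<partial>cylinder T) =
    (\<integral>p. 2 * (E p \<bullet> Z p) - (mat 1 \<bullet> M p + 2 * (B p \<bullet> M p)) \<partial>cylinder T)"
    by (simp add: contract_inner inner_add_left)
  also have "\<dots> = 2 * (\<integral>p. E p \<bullet> Z p \<partial>cylinder T) - ((\<integral>p. mat 1 \<bullet> M p \<partial>cylinder T) + 2 * (\<integral>p. B p \<bullet> M p \<partial>cylinder T))"
    using Lsq_inner[OF L(1) Z] Lsq_inner[OF L(2) M] Lsq_inner[OF one M] by simp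
  finally show ?thesis unfolding K_value_def by simp
qed

lemma K_admissible_Lsq: "(Z, M) \<in> K_admissible T \<Longrightarrow> Lsq (cylinder T) Z \<and> Lsq (cylinder T) M"
  by (auto simp: K_admissible_def intro: cont_Lsq)

lemma K_le_iff: "K T E B \<le> ereal c \<longleftrightarrow> (\<forall>(Z, M) \<in> K_admissible T. K_value T E B Z M \<le> c)"
  unfolding K_eq_SUP by (auto simp: SUP_le_iff)

lemma K_admissible_zero: "((\<lambda>_. 0), (\<lambda>_. 0)) \<in> K_admissible T"
  by (auto simp: K_admissible_def periodic_def sym_mat_def mat_ge_def tensor_def transpose_def vec_eq_iff zero_vec_def
      matrix_vector_mult_def inner_vec_def)

lemma K_nonneg: "K T E B \<ge> 0"
proof -
  have "ereal (K_value T E B (\<lambda>_. 0) (\<lambda>_. 0)) \<le> K T E B"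
    unfolding K_eq_SUP by (rule SUP_upper2[OF K_admissible_zero]) simp
  then show ?thesis by (simp add: K_value_def contract_inner zero_ereal_def)
qed

text \<open>
  The linear part of the objective, \<open>\<integral>P \<cdot> E\<close>.
\<close>

definition P_pairing :: "real \<Rightarrow> (real^'n \<Rightarrow> real^'n) \<Rightarrow> (real \<times> (real^'n) \<Rightarrow> real^'n) \<Rightarrow> real" where
  "P_pairing T P E = (\<integral>p. E p \<bullet> P (snd p) \<partial>cylinder T)"

lemma objective_eq: "objective T P E B = - K T E B - ereal (P_pairing T P E)"
proof -
  have "(\<lambda>(t, x). P x \<bullet> E (t, x)) = (\<lambda>p. E p \<bullet> P (snd p))" by (auto simp: inner_commute)
  then show ?thesis by (simp add: objective_def P_pairing_def)
qed

lemma objective_ge_iff: "ereal c \<le> objective T P E B \<longleftrightarrow> K T E B \<le> ereal (- c - P_pairing T P E)"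
  unfolding objective_eq by (cases "K T E B") auto

lemma K_value_comb:
  assumes 1: "(E, B) \<in> EB_class T" and 2: "(E', B') \<in> EB_class T" and zm: "(Z, M) \<in> K_admissible T" and ab: "a + b = 1"
  shows "K_value T (\<lambda>p. a *\<^sub>R E p + b *\<^sub>R E' p) (\<lambda>p. a *\<^sub>R B p + b *\<^sub>R B' p) Z M = a * K_value T E B Z M + b * K_value T E' B' Z M"
proof -
  note L1 = EB_Lsq[OF 1] and L2 = EB_Lsq[OF 2]
  have Z: "Lsq (cylinder T) Z" and M: "Lsq (cylinder T) M" using K_admissible_Lsq[OF zm] by auto
  have b: "b = 1 - a" using ab by simp
  show ?thesis
    unfolding K_value_eq[OF Lsq_add[OF Lsq_scale[OF L1(1)] Lsq_scale[OF L2(1)]] Lsq_add[OF Lsq_scale[OF L1(2)] Lsq_scale[OF L2(2)]] Z M]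
      K_value_eq[OF L1 Z M] K_value_eq[OF L2 Z M] Lsq_integral_comb[OF L1(1) L2(1) Z] Lsq_integral_comb[OF L1(2) L2(2) M]
    by (simp add: b field_simps)
qed

lemma P_pairing_comb:
  assumes P: "Lsq (cylinder T) (\<lambda>p. P (snd p))" and 1: "Lsq (cylinder T) E" and 2: "Lsq (cylinder T) E'"
  shows "P_pairing T P (\<lambda>p. a *\<^sub>R E p + b *\<^sub>R E' p) = a * P_pairing T P E + b * P_pairing T P E'"
  unfolding P_pairing_def using Lsq_inner[OF 1 P] Lsq_inner[OF 2 P] by (simp add: inner_add_left)

section \<open>Concavity\<close>

lemma objective_concave:
  fixes P :: "real^'n \<Rightarrow> real^'n"
  assumes P: "Lsq (cylinder T) (\<lambda>p. P (snd p))"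
    and 1: "(E, B) \<in> EB_class T" and 2: "(E', B') \<in> EB_class T" and u: "u \<in> {0..1}"
  shows "(\<lambda>p. (1 - u) *\<^sub>R E p + u *\<^sub>R E' p, \<lambda>p. (1 - u) *\<^sub>R B p + u *\<^sub>R B' p) \<in> EB_class T \<and>
     ereal (1 - u) * objective T P E B + ereal u * objective T P E' B'
     \<le> objective T P (\<lambda>p. (1 - u) *\<^sub>R E p + u *\<^sub>R E' p) (\<lambda>p. (1 - u) *\<^sub>R B p + u *\<^sub>R B' p)"
proof
    show "(\<lambda>p. (1 - u) *\<^sub>R E p + u *\<^sub>R E' p, \<lambda>p. (1 - u) *\<^sub>R B p + u *\<^sub>R B' p) \<in> EB_class T"
      by (rule EB_class_comb[OF 1 2])
    let ?E = "\<lambda>p. (1 - u) *\<^sub>R E p + u *\<^sub>R E' p" and ?B = "\<lambda>p. (1 - u) *\<^sub>R B p + u *\<^sub>R B' p"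
    have ni: "objective T P E B \<noteq> \<infinity>" for E B
      using K_nonneg[of T E B] unfolding objective_eq by (cases "K T E B") auto
    consider "u = 0" | "u = 1" | "0 < u" "u < 1" using u by fastforce
    then show "ereal (1 - u) * objective T P E B + ereal u * objective T P E' B' \<le> objective T P ?E ?B"
    proof cases
      case 1
      then show ?thesis by (simp flip: zero_ereal_def one_ereal_def)
    next
      case 2
      then show ?thesis by (simp flip: zero_ereal_def one_ereal_def)
    next
      case 3
      show ?thesis
      proof (cases "objective T P E B = - \<infinity> \<or> objective T P E' B' = - \<infinity>")
        case True
        have "ereal (1 - u) * objective T P E B + ereal u * objective T P E' B' = - \<infinity>"
          using True 3 ni[of E B] ni[of E' B'] by (cases "objective T P E B"; cases "objective T P E' B'") auto
        then show ?thesis by (metis ereal_infty_less_eq(2) uminus_ereal.simps(2) ereal_less_eq(2) order.refl)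
      next
        case False
        then obtain \<alpha> \<beta> where ab: "objective T P E B = ereal \<alpha>" "objective T P E' B' = ereal \<beta>"
          using ni[of E B] ni[of E' B'] by (cases "objective T P E B"; cases "objective T P E' B'") auto
        have k1: "\<forall>(Z, M) \<in> K_admissible T. K_value T E B Z M \<le> - \<alpha> - P_pairing T P E"
          using ab(1) unfolding K_le_iff[symmetric] objective_ge_iff[symmetric] by simp
        have k2: "\<forall>(Z, M) \<in> K_admissible T. K_value T E' B' Z M \<le> - \<beta> - P_pairing T P E'"
          using ab(2) unfolding K_le_iff[symmetric] objective_ge_iff[symmetric] by simp
        have "ereal ((1 - u) * \<alpha> + u * \<beta>) \<le> objective T P ?E ?B"
          unfolding objective_ge_iff K_le_iff
        proof (intro ballI, clarify)
          fix Z :: "real \<times> (real^'n) \<Rightarrow> real^'n" and M assume zm: "(Z, M) \<in> K_admissible T"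
          have "K_value T ?E ?B Z M = (1 - u) * K_value T E B Z M + u * K_value T E' B' Z M"
            by (rule K_value_comb[OF 1 2 zm]) simp
          also have "\<dots> \<le> (1 - u) * (- \<alpha> - P_pairing T P E) + u * (- \<beta> - P_pairing T P E')"
            using k1 k2 zm 3 by (intro add_mono mult_left_mono) auto
          also have "\<dots> = - ((1 - u) * \<alpha> + u * \<beta>) - P_pairing T P ?E"
            unfolding P_pairing_comb[OF P EB_Lsq(1)[OF 1] EB_Lsq(1)[OF 2]] by (simp add: algebra_simps)
          finally show "K_value T ?E ?B Z M \<le> - ((1 - u) * \<alpha> + u * \<beta>) - P_pairing T P ?E" .
        qed
        then show ?thesis using ab by simp
      qed
    qed
qed

lemma concave_problem:
  assumes P: "Lsq (cylinder T) (\<lambda>p. P (snd p))"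
  shows "concave_problem T P"
  using objective_concave[OF P] unfolding concave_problem_def Let_def by fast

section \<open>Consequences of a finite value of K\<close>

lemma Lsq_A:
  assumes "Lsq (cylinder T) B"
  shows "Lsq (cylinder T) (\<lambda>p. mat 1 + 2 *\<^sub>R B p)"
  by (intro Lsq_add Lsq_scale assms cont_Lsq continuous_intros)

lemma tensor_cont: "continuous_on S f \<Longrightarrow> continuous_on S g \<Longrightarrow> continuous_on S (\<lambda>p. tensor (f p) (g p))"
  unfolding tensor_def by (intro continuous_on_vec_lambda continuous_intros)

lemma tensor_quad: "w \<bullet> (tensor v v *v w) = (v \<bullet> w)\<^sup>2"
  by (simp add: tensor_def inner_vec_def matrix_vector_mult_def power2_eq_square sum_product sum_distrib_left mult_ac)

lemma sym_tensor: "sym_mat (c *\<^sub>R tensor v v)"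
  by (simp add: sym_mat_def transpose_def vec_eq_iff tensor_def)

lemma K_psd:
  fixes B :: "real \<times> (real^'n) \<Rightarrow> real^'n^'n"
  assumes EB: "(E, B) \<in> EB_class T" and K: "K T E B \<le> ereal \<kappa>"
  shows "AE p in cylinder T. psd (mat 1 + 2 *\<^sub>R B p)"
proof -
  note L = EB_Lsq[OF EB]
  have k0: "\<kappa> \<ge> 0" using order_trans[OF K_nonneg K] by simp
  have v: "AE p in cylinder T. v \<bullet> ((mat 1 + 2 *\<^sub>R B p) *v v) \<ge> 0" for v :: "real^'n"
  proof (rule AE_nonneg_if_test)
    let ?g = "\<lambda>p. v \<bullet> ((mat 1 + 2 *\<^sub>R B p) *v v)"
    have g: "?g p = (mat 1 + 2 *\<^sub>R B p) \<bullet> tensor v v" for p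
      by (simp add: contract_tensor[symmetric] contract_inner)
    have "Lsq (cylinder T) (\<lambda>p. tensor v v)" by (intro cont_Lsq continuous_intros)
    from Lsq_inner[OF Lsq_A[OF L(2)] this] show "integrable (cylinder T) ?g" unfolding g .
    fix h :: "real \<times> (real^'n) \<Rightarrow> real" assume h: "testfun h"
    let ?I = "\<integral>p. ?g p * (h p)\<^sup>2 \<partial>cylinder T"
    show "0 \<le> ?I"
    proof (rule ccontr)
      assume "\<not> 0 \<le> ?I"
      then have neg: "?I < 0" by simp
      \<comment> \<open>chosen such that \<open>M = s h^2 v \<otimes> v\<close> alone gives the value \<open>\<kappa> + 1\<close>\<close>
      define s where "s = 2 * (\<kappa> + 1) / (- ?I)"
      have s0: "s \<ge> 0" using neg k0 by (simp add: s_def divide_nonneg_neg)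
      let ?M = "\<lambda>p. (s * (h p)\<^sup>2) *\<^sub>R tensor v v"
      have "((\<lambda>_. 0), ?M) \<in> K_admissible T"
        unfolding K_admissible_def
      proof (clarify, intro conjI ballI)
        show "continuous_on ({0..T} \<times> UNIV) ?M" by (intro continuous_intros testfun_cont h)
        show "periodic (\<lambda>x. ?M (t, x))" for t using h by (auto simp: testfun_def periodic_def)
        show "sym_mat (?M p)" for p by (rule sym_tensor)
        have "0 \<le> w \<bullet> (?M p *v w)" for p w
          using s0 by (simp add: scaleR_matrix_vector_assoc[symmetric] tensor_quad)
        then show "mat_ge (?M p) (tensor 0 0)" for p
          by (simp add: mat_ge_def tensor_quad)
      qed (auto simp: periodic_def)
      then have "K_value T E B (\<lambda>_. 0) ?M \<le> \<kappa>" using K unfolding K_le_iff by blast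
      moreover have "K_value T E B (\<lambda>_. 0) ?M = - (s / 2) * ?I"
      proof -
        have "contract (mat 1 + 2 *\<^sub>R B p) (?M p) = s * (?g p * (h p)\<^sup>2)" for p
          unfolding g contract_inner by simp
        then show ?thesis by (simp add: K_value_def)
      qed
      moreover have "- (s / 2) * ?I = \<kappa> + 1" using neg by (simp add: s_def field_simps)
      ultimately show False by simp
    qed
  qed
  \<comment> \<open>the null sets for the vectors of a countable dense set suffice, by continuity in \<open>v\<close>\<close>
  obtain D :: "(real^'n) set" where D: "countable D" "\<And>X. open X \<Longrightarrow> X \<noteq> {} \<Longrightarrow> \<exists>d\<in>D. d \<in> X"
    using countable_dense_exists by blast
  have "AE p in cylinder T. \<forall>v\<in>D. v \<bullet> ((mat 1 + 2 *\<^sub>R B p) *v v) \<ge> 0"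
    using D(1) v by (simp add: AE_ball_countable)
  then show ?thesis
  proof eventually_elim
    case (elim p)
    let ?A = "mat 1 + 2 *\<^sub>R B p"
    have op: "open {v. v \<bullet> (?A *v v) < 0}"
      by (intro open_Collect_less continuous_intros linear_continuous_on matrix_vector_mul_bounded_linear)
    show ?case unfolding psd_def
    proof (rule ccontr)
      assume "\<not> (\<forall>v. 0 \<le> v \<bullet> (?A *v v))"
      then obtain v where "v \<bullet> (?A *v v) < 0" by (meson not_le)
      then have "{v. v \<bullet> (?A *v v) < 0} \<noteq> {}" by blast
      then obtain d where "d \<in> D" "d \<bullet> (?A *v d) < 0" using D(2)[OF op] by auto
      then show False using elim by force
    qed
  qed
qed

text \<open>
  A function all of whose Fourier coefficients vanish is orthogonal to all continuous periodic functions.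
\<close>

lemma torus_orthogonal:
  fixes b :: "real^'n \<Rightarrow> real"
  assumes b: "integrable torus b"
    and c: "\<And>k. (\<integral>x. b x * cos (freq k \<bullet> x) \<partial>torus) = 0" and s: "\<And>k. (\<integral>x. b x * sin (freq k \<bullet> x) \<partial>torus) = 0"
    and f: "periodic f" "continuous_on UNIV f"
  shows "(\<integral>x. b x * f x \<partial>torus) = 0"
proof -
  have bi: "integrable torus (\<lambda>x. b x * g x)" if "continuous_on UNIV g" for g
  proof -
    have "compact (g ` cbox 0 1)" by (intro compact_continuous_image continuous_on_subset[OF that]) auto
    then obtain C where C: "\<forall>y \<in> g ` cbox 0 1. norm y \<le> C" by (meson bounded_pos compact_imp_bounded)
    have gm: "g \<in> borel_measurable torus"
      using torus_integral(1)[OF continuous_on_subset[OF that]] by auto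
    have bm: "b \<in> borel_measurable torus" using b by auto
    show ?thesis
    proof (rule Bochner_Integration.integrable_bound[of _ "\<lambda>x. C * b x"])
      show "(\<lambda>x. b x * g x) \<in> borel_measurable torus" by (intro borel_measurable_times bm gm)
      have "norm (b x * g x) \<le> norm (C * b x)" if "x \<in> cbox 0 1" for x
      proof -
        have "\<bar>g x\<bar> \<le> \<bar>C\<bar>" using C that by force
        then have "\<bar>b x\<bar> * \<bar>g x\<bar> \<le> \<bar>b x\<bar> * \<bar>C\<bar>" by (intro mult_left_mono) auto
        then show ?thesis by (simp add: abs_mult mult.commute)
      qed
      then show "AE x in torus. norm (b x * g x) \<le> norm (C * b x)" by (intro AE_I2) simp
    qed (use b in simp)
  qed
  have z: "continuous_on UNIV (conv q f) \<and> (\<integral>x. b x * conv q f x \<partial>torus) = 0" if "q \<in> cosspan" for q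
    using that f
  proof (induction rule: conv_cosspan_induct)
    case (mode k)
    have ci: "integrable torus (\<lambda>x. b x * cos (freq k \<bullet> x))" "integrable torus (\<lambda>x. b x * sin (freq k \<bullet> x))"
      by (intro bi continuous_intros)+
    have "(\<integral>x. b x * fourier_mode f k x \<partial>torus) = (\<integral>x. cos_coeff f k * (b x * cos (freq k \<bullet> x)) + sin_coeff f k * (b x * sin (freq k \<bullet> x)) \<partial>torus)"
      by (simp add: fourier_mode_def algebra_simps)
    also have "\<dots> = 0" using ci c s by simp
    finally show ?case using smooth_imp_continuous[OF smooth_fourier_mode] by blast
  next
    case (add p q g h)
    then show ?case using bi[of g] bi[of h] by (auto simp: distrib_left intro!: continuous_intros)
  next
    case (scale c q g)
    then show ?case using bi[of g] by (auto simp: mult.left_commute intro!: continuous_intros)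
  qed
  obtain C where C: "\<And>x. norm (f x) \<le> C" using periodic_bounded[OF f] by metis
  have meas: "g \<in> borel_measurable torus" if "continuous_on UNIV g" for g :: "real^'n \<Rightarrow> real"
    using torus_integral(1)[OF continuous_on_subset[OF that]] by auto
  have "(\<lambda>n. \<integral>x. b x \<bullet> conv (vp_kernel n) f x \<partial>torus) \<longlonglongrightarrow> (\<integral>x. b x \<bullet> f x \<partial>torus)"
  proof (rule bounded_conv_integral[OF b])
    show "norm (conv (vp_kernel n) f x) \<le> C" for n x by (rule conv_vp_kernel_bound[OF f(2) C])
    show "AE x in torus. (\<lambda>n. conv (vp_kernel n) f x) \<longlonglongrightarrow> f x" by (intro AE_I2 conv_vp_kernel_tendsto f)
  qed (use meas f z[OF vp_kernel_cosspan] in auto)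
  then show ?thesis using z[OF vp_kernel_cosspan] by (simp add: LIMSEQ_const_iff)
qed

lemma trig_smooth: "smooth (\<lambda>x. cos (freq k \<bullet> x))" "smooth (\<lambda>x. sin (freq k \<bullet> x))"
  using smooth_trig[of "freq k" "1::real" 0] smooth_trig[of "freq k" "0::real" 1] by simp_all

lemma trig_periodic: "periodic (\<lambda>x. cos (freq k \<bullet> x))" "periodic (\<lambda>x. sin (freq k \<bullet> x))"
  by (simp_all add: periodic_def cos_freq_shift)

lemma sym_mat1: "sym_mat (c *\<^sub>R mat 1)"
  by (simp add: sym_mat_def transpose_def vec_eq_iff mat_def)

text \<open>
  Test functions in time that vanish at 0 and have the monomials as derivatives.
\<close>

lemma power_primitive: "smooth (\<lambda>t::real. t ^ Suc m / real (Suc m))" "deriv (\<lambda>t::real. t ^ Suc m / real (Suc m)) t = t ^ m"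
proof -
  show "smooth (\<lambda>t::real. t ^ Suc m / real (Suc m))"
    using smooth_cmult[OF smooth_power[of "Suc m"], of "1 / real (Suc m)"] by simp
  have "((\<lambda>t::real. t ^ Suc m / real (Suc m)) has_field_derivative (real (Suc m) * t ^ m) / real (Suc m)) (at t)"
    by (rule DERIV_cdivide) (use DERIV_pow[of "Suc m" t] in simp)
  then show "deriv (\<lambda>t::real. t ^ Suc m / real (Suc m)) t = t ^ m"
    by (intro DERIV_imp_deriv) simp
qed

lemma EB_trace_zero:
  fixes B :: "real \<times> (real^'n) \<Rightarrow> real^'n^'n"
  assumes EB: "(E, B) \<in> EB_class T"
  shows "AE p in cylinder T. trace (B p) = 0"
proof -
  note L = EB_Lsq[OF EB]
  have tr: "trace (B p) = B p \<bullet> mat 1" for p using contract_mat1[of "B p" 1] by (simp add: contract_inner)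
  have ti: "integrable (cylinder T) (\<lambda>p. trace (B p) * g p)" if "continuous_on UNIV g" for g
  proof -
    have "Lsq (cylinder T) (\<lambda>p. g p *\<^sub>R (mat 1 :: real^'n^'n))"
      by (intro cont_Lsq continuous_intros continuous_on_subset[OF that]) auto
    from Lsq_inner[OF L(2) this] show ?thesis by (simp add: tr mult.commute)
  qed
  have u: "AE t in restrict_space lborel {0..T}. (\<integral>x. trace (B (t, x)) * g x \<partial>torus) = 0"
    if g: "smooth g" "periodic g" for g :: "real^'n \<Rightarrow> real"
  proof -
    have gc: "continuous_on UNIV (\<lambda>p::real \<times> (real^'n). g (snd p))"
      by (rule continuous_on_compose2[OF smooth_imp_continuous[OF g(1)]]) (auto intro!: continuous_intros)
    show ?thesis
    proof (rule time_AE_zero)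
      show "integrable (restrict_space lborel {0..T}) (\<lambda>t. \<integral>x. trace (B (t, x)) * g x \<partial>torus)"
        using cylinder_fubini(2)[OF ti[OF gc]] by simp
      fix m
      let ?z = "\<lambda>t::real. t ^ Suc m / real (Suc m)" and ?\<psi> = "\<lambda>x. g x *\<^sub>R (mat 1 :: real^'n^'n)"
      have sm: "smooth_field ?\<psi>" using g smooth_bounded_linear[OF g(1) bounded_linear_scaleR_left] by (simp add: smooth_field_def periodic_def)
      then have "testpair ?z ?\<psi>" unfolding testpair_def using power_primitive(1)[of m] by (auto simp: sym_mat1)
      then have eq: "(\<integral>p. B p \<bullet> (deriv ?z (fst p) *\<^sub>R ?\<psi> (snd p)) \<partial>cylinder T) = (\<integral>p. E p \<bullet> (?z (fst p) *\<^sub>R dualv ?\<psi> (snd p)) \<partial>cylinder T)"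
        using EB unfolding EB_class_iff by blast
      have d0: "dualv ?\<psi> x = 0" for x using dual_field_trace[OF g] by (simp add: dualv_def vec_eq_iff)
      have 0: "(\<integral>p. trace (B p) * (g (snd p) * fst p ^ m) \<partial>cylinder T) = 0"
        using eq unfolding power_primitive(2) d0 by (simp add: tr mult_ac)
      have mc: "continuous_on UNIV (\<lambda>p::real \<times> (real^'n). g (snd p) * fst p ^ m)" by (intro continuous_intros gc)
      have "(\<integral>t. (\<integral>x. trace (B (t, x)) * g x \<partial>torus) * t ^ m \<partial>restrict_space lborel {0..T}) =
        (\<integral>t. (\<integral>x. trace (B (t, x)) * (g (snd (t, x)) * fst (t, x) ^ m) \<partial>torus) \<partial>restrict_space lborel {0..T})"
        by (simp add: mult.assoc[symmetric])
      also have "\<dots> = 0" using cylinder_fubini(3)[OF ti[OF mc]] 0 by simp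
      finally show "(\<integral>t. (\<integral>x. trace (B (t, x)) * g x \<partial>torus) * t ^ m \<partial>restrict_space lborel {0..T}) = 0" .
    qed
  qed
  have ti1: "integrable (cylinder T) (\<lambda>p. trace (B p))" using ti[of "\<lambda>_. 1"] by simp
  have "AE t in restrict_space lborel {0..T}. \<forall>k. (\<integral>x. trace (B (t, x)) * cos (freq k \<bullet> x) \<partial>torus) = 0"
    "AE t in restrict_space lborel {0..T}. \<forall>k. (\<integral>x. trace (B (t, x)) * sin (freq k \<bullet> x) \<partial>torus) = 0"
    by (simp_all add: AE_all_countable u trig_smooth trig_periodic)
  then have ae: "AE t in restrict_space lborel {0..T}. integrable torus (\<lambda>x. trace (B (t, x))) \<and> (\<forall>k. (\<integral>x. trace (B (t, x)) * cos (freq k \<bullet> x) \<partial>torus) = 0)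
    \<and> (\<forall>k. (\<integral>x. trace (B (t, x)) * sin (freq k \<bullet> x) \<partial>torus) = 0)"
    using cylinder_fubini(1)[OF ti1] by eventually_elim auto
  show ?thesis
  proof (rule AE_zero_if_orthogonal[OF ti1])
    fix h :: "real \<times> (real^'n) \<Rightarrow> real" assume h: "testfun h"
    have hc: "continuous_on UNIV h" and hp: "periodic (\<lambda>x. h (t, x))" for t using h by (auto simp: testfun_def)
    have hs: "continuous_on UNIV (\<lambda>x. h (t, x))" for t
      by (rule continuous_on_compose2[OF hc]) (auto intro!: continuous_intros)
    have "(\<integral>p. trace (B p) * h p \<partial>cylinder T) = (\<integral>t. (\<integral>x. trace (B (t, x)) * h (t, x) \<partial>torus) \<partial>restrict_space lborel {0..T})"
      by (rule cylinder_fubini(3)[OF ti[OF hc], symmetric])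
    also have "\<dots> = 0"
    proof (rule integral_eq_zero_AE)
      show "AE t in restrict_space lborel {0..T}. (\<integral>x. trace (B (t, x)) * h (t, x) \<partial>torus) = 0"
        using ae
      proof eventually_elim
        case (elim t)
        show ?case by (rule torus_orthogonal[of "\<lambda>x. trace (B (t, x))", OF _ _ _ hp hs]) (use elim in blast)+
      qed
    qed
    finally show "(\<integral>p. trace (B p) * h p \<partial>cylinder T) = 0" .
  qed
qed

lemma K_finite_constrained:
  assumes EB: "(E, B) \<in> EB_class T" and K: "K T E B \<le> ereal \<kappa>"
  shows "AE p in cylinder T. constrained (B p)"
proof -
  have "AE p in cylinder T. sym_mat (B p)" using EB by (simp add: EB_class_iff)
  then show ?thesis using K_psd[OF EB K] EB_trace_zero[OF EB]
    by eventually_elim (simp add: constrained_def)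
qed

lemma K_energy_test:
  fixes E :: "real \<times> (real^'n) \<Rightarrow> real^'n"
  assumes EB: "(E, B) \<in> EB_class T" and K: "K T E B \<le> ereal \<kappa>" and h: "testfun h"
  shows "(\<integral>p. E p \<bullet> h p \<partial>cylinder T) - real CARD('n) / 2 * nsq (cylinder T) h \<le> \<kappa>"
proof -
  note L = EB_Lsq[OF EB]
  let ?d = "real CARD('n)"
  have hL: "Lsq (cylinder T) h" by (intro cont_Lsq testfun_cont h)
  have tL: "Lsq (cylinder T) (\<lambda>p. tensor (h p) (h p))" by (intro cont_Lsq tensor_cont testfun_cont h)
  have "(h, \<lambda>p. tensor (h p) (h p)) \<in> K_admissible T"
    unfolding K_admissible_def
  proof (clarify, intro conjI ballI)
    show "sym_mat (tensor (h p) (h p))" for p using sym_tensor[of 1 "h p"] by simp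
  qed (use h in \<open>auto simp: testfun_def periodic_def mat_ge_def intro!: tensor_cont intro: continuous_on_subset\<close>)
  then have k: "K_value T E B h (\<lambda>p. tensor (h p) (h p)) \<le> \<kappa>" using K unfolding K_le_iff by blast
  have i1: "integrable (cylinder T) (\<lambda>p. contract (mat 1 + 2 *\<^sub>R B p) (tensor (h p) (h p)))"
    unfolding contract_inner by (rule Lsq_inner[OF Lsq_A[OF L(2)] tL])
  have "(\<integral>p. 2 * (E p \<bullet> h p) - ?d * (norm (h p))\<^sup>2 \<partial>cylinder T) \<le>
    (\<integral>p. 2 * (E p \<bullet> h p) - contract (mat 1 + 2 *\<^sub>R B p) (tensor (h p) (h p)) \<partial>cylinder T)"
  proof (rule integral_mono_AE)
    show "AE p in cylinder T. 2 * (E p \<bullet> h p) - ?d * (norm (h p))\<^sup>2 \<le> 2 * (E p \<bullet> h p) - contract (mat 1 + 2 *\<^sub>R B p) (tensor (h p) (h p))"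
      using K_finite_constrained[OF EB K] by eventually_elim (simp add: contract_tensor constrained_upper)
  qed (use i1 Lsq_inner[OF L(1) hL] Lsq_int[OF hL] in auto)
  moreover have "(\<integral>p. 2 * (E p \<bullet> h p) - ?d * (norm (h p))\<^sup>2 \<partial>cylinder T) = 2 * (\<integral>p. E p \<bullet> h p \<partial>cylinder T) - ?d * nsq (cylinder T) h"
    using Lsq_inner[OF L(1) hL] Lsq_int[OF hL] by (simp add: nsq_def)
  ultimately show ?thesis using k unfolding K_value_def by simp
qed

text \<open>
  The functions \<open>Z\<close> approximate \<open>E/d\<close> where \<open>|E| \<le> m\<close> and 0 elsewhere; then \<open>m\<close> tends to infinity.
\<close>

lemma K_energy:
  fixes E :: "real \<times> (real^'n) \<Rightarrow> real^'n"
  assumes EB: "(E, B) \<in> EB_class T" and K: "K T E B \<le> ereal \<kappa>"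
  shows "nsq (cylinder T) E \<le> 2 * real CARD('n) * \<kappa>"
proof -
  note L = EB_Lsq[OF EB]
  let ?d = "real CARD('n)"
  have Em [measurable]: "E \<in> borel_measurable (cylinder T)" by (rule Lsq_meas[OF L(1)])
  have EI: "integrable (cylinder T) E" by (rule Lsq_integrable[OF cylinder_finite L(1)])
  interpret fin: finite_measure "cylinder T :: (real \<times> (real^'n)) measure" by (rule cylinder_finite)
  have bdd: "(\<integral>p. E p \<bullet> f p \<partial>cylinder T) - ?d / 2 * nsq (cylinder T) f \<le> \<kappa>"
    if f: "f \<in> borel_measurable (cylinder T)" "\<And>p. p \<in> space (cylinder T) \<Longrightarrow> norm (f p) \<le> C" "C \<ge> 0" for f C
  proof -
    obtain h where h: "\<And>n. testfun (h n)" "\<And>n p. norm (h n p) \<le> C" "AE p in cylinder T. (\<lambda>n. h n p) \<longlonglongrightarrow> f p"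
      using testfun_approx[OF f] by blast
    have hm: "h n \<in> borel_measurable (cylinder T)" for n by (intro cylinder_measurable_cont testfun_cont h)
    have 1: "(\<lambda>n. \<integral>p. E p \<bullet> h n p \<partial>cylinder T) \<longlonglongrightarrow> (\<integral>p. E p \<bullet> f p \<partial>cylinder T)"
      by (rule bounded_conv_integral[OF EI hm h(2) f(1) h(3)])
    have "(\<lambda>n. \<integral>p. 1 \<bullet> (norm (h n p))\<^sup>2 \<partial>cylinder T) \<longlonglongrightarrow> (\<integral>p. 1 \<bullet> (norm (f p))\<^sup>2 \<partial>cylinder T)"
    proof (rule bounded_conv_integral)
      show "norm ((norm (h n p))\<^sup>2) \<le> C\<^sup>2" for n p using h(2)[of n p] by (simp add: power_mono)
      show "AE p in cylinder T. (\<lambda>n. (norm (h n p))\<^sup>2) \<longlonglongrightarrow> (norm (f p))\<^sup>2"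
        using h(3) by eventually_elim (intro tendsto_intros)
    qed (use hm f(1) in auto)
    then have 2: "(\<lambda>n. nsq (cylinder T) (h n)) \<longlonglongrightarrow> nsq (cylinder T) f" by (simp add: nsq_def)
    have "(\<lambda>n. (\<integral>p. E p \<bullet> h n p \<partial>cylinder T) - ?d / 2 * nsq (cylinder T) (h n)) \<longlonglongrightarrow> (\<integral>p. E p \<bullet> f p \<partial>cylinder T) - ?d / 2 * nsq (cylinder T) f"
      by (intro tendsto_intros 1 2)
    then show ?thesis by (rule LIMSEQ_le_const2) (use K_energy_test[OF EB K h(1)] in auto)
  qed
  let ?w = "\<lambda>m p. if norm (E p) \<le> real m then (norm (E p))\<^sup>2 else 0"
  have wi: "integrable (cylinder T) (?w m)" for m
    by (rule Bochner_Integration.integrable_bound[OF Lsq_int[OF L(1)]]) auto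
  have w: "(\<integral>p. ?w m p \<partial>cylinder T) \<le> 2 * ?d * \<kappa>" for m
  proof -
    let ?f = "\<lambda>p. if norm (E p) \<le> real m then (1 / ?d) *\<^sub>R E p else 0"
    have "(\<integral>p. E p \<bullet> ?f p \<partial>cylinder T) - ?d / 2 * nsq (cylinder T) ?f \<le> \<kappa>"
    proof (rule bdd[of _ "real m"])
      have "1 \<le> ?d" by (simp add: Suc_leI)
      have A: "norm (E p) / ?d \<le> norm (E p)" for p
        using \<open>1 \<le> ?d\<close> by (simp add: divide_le_eq mult_le_cancel_left1)
      show "norm (?f p) \<le> real m" for p by (auto intro: order_trans[OF A])
    qed measurable
    moreover have "E p \<bullet> ?f p = (1 / ?d) * ?w m p" for p by (simp add: power2_norm_eq_inner)
    moreover have "(norm (?f p))\<^sup>2 = (1 / ?d)\<^sup>2 * ?w m p" for p by (simp add: power_mult_distrib power_divide)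
    ultimately have "(1 / ?d) * (\<integral>p. ?w m p \<partial>cylinder T) - ?d / 2 * ((1 / ?d)\<^sup>2 * (\<integral>p. ?w m p \<partial>cylinder T)) \<le> \<kappa>"
      using wi[of m] unfolding nsq_def by simp
    moreover have "(1 / ?d) * x - ?d / 2 * ((1 / ?d)\<^sup>2 * x) = x / (2 * ?d)" for x
      by (simp add: field_simps power2_eq_square)
    ultimately have "(\<integral>p. ?w m p \<partial>cylinder T) / (2 * ?d) \<le> \<kappa>" by metis
    then show ?thesis by (simp add: divide_le_eq mult_ac)
  qed
  have "(\<lambda>m. \<integral>p. ?w m p \<partial>cylinder T) \<longlonglongrightarrow> (\<integral>p. (norm (E p))\<^sup>2 \<partial>cylinder T)"
  proof (rule integral_dominated_convergence[where w="\<lambda>p. (norm (E p))\<^sup>2"])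
    show "AE p in cylinder T. (\<lambda>m. ?w m p) \<longlonglongrightarrow> (norm (E p))\<^sup>2"
    proof (intro AE_I2 tendsto_eventually)
      fix p
      obtain N where "norm (E p) \<le> real N" using real_arch_simple by blast
      then show "\<forall>\<^sub>F m in sequentially. ?w m p = (norm (E p))\<^sup>2"
        unfolding eventually_sequentially by (intro exI[of _ N]) auto
    qed
  qed (use Lsq_int[OF L(1)] in auto)
  then show ?thesis unfolding nsq_def by (rule LIMSEQ_le_const2) (use w in auto)
qed

section \<open>Bounds on the objective and existence\<close>

lemma Lsq_P:
  assumes "square_integrable torus P" "T > 0"
  shows "Lsq (cylinder T) (\<lambda>p. P (snd p))"
    and "nsq (cylinder T) (\<lambda>p. P (snd p)) = T * (\<integral>x. (norm (P x))\<^sup>2 \<partial>torus)"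
proof -
  have P: "P \<in> borel_measurable torus" "integrable torus (\<lambda>x. (norm (P x))\<^sup>2)"
    using assms by (auto simp: square_integrable_def)
  show "Lsq (cylinder T) (\<lambda>p. P (snd p))"
    unfolding Lsq_def using cylinder_snd(1)[OF P(2), of T] assms(2) measurable_compose[OF snd_meas P(1)] by simp
  show "nsq (cylinder T) (\<lambda>p. P (snd p)) = T * (\<integral>x. (norm (P x))\<^sup>2 \<partial>torus)"
    unfolding nsq_def using cylinder_snd(2)[OF P(2), of T] assms(2) by simp
qed

context
  fixes T :: real and P :: "real^'n \<Rightarrow> real^'n"
  assumes P: "Lsq (cylinder T) (\<lambda>p. P (snd p))"
begin

text \<open>
  The norm of \<open>P\<close> in \<open>L^2\<close> of the cylinder.
\<close>

abbreviation "NP \<equiv> sqrt (nsq (cylinder T) (\<lambda>p. P (snd p)))"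

lemma P_pairing_bound:
  assumes "(E, B) \<in> EB_class T" shows "\<bar>P_pairing T P E\<bar> \<le> sqrt (nsq (cylinder T) E) * NP"
  unfolding P_pairing_def by (rule Lsq_Cauchy_Schwarz_abs[OF EB_Lsq(1)[OF assms] P])

lemma objective_imp_energy:
  assumes EB: "(E, B) \<in> EB_class T" and c: "ereal c \<le> objective T P E B"
  shows "(sqrt (nsq (cylinder T) E))\<^sup>2 \<le> 2 * real CARD('n) * (- c + sqrt (nsq (cylinder T) E) * NP)"
    and "AE p in cylinder T. constrained (B p)"
proof -
  have K: "K T E B \<le> ereal (- c - P_pairing T P E)" using c by (simp add: objective_ge_iff)
  show "AE p in cylinder T. constrained (B p)" by (rule K_finite_constrained[OF EB K])
  have "nsq (cylinder T) E \<le> 2 * real CARD('n) * (- c - P_pairing T P E)" by (rule K_energy[OF EB K])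
  also have "\<dots> \<le> 2 * real CARD('n) * (- c + sqrt (nsq (cylinder T) E) * NP)"
    using P_pairing_bound[OF EB] by (intro mult_left_mono) auto
  finally show "(sqrt (nsq (cylinder T) E))\<^sup>2 \<le> 2 * real CARD('n) * (- c + sqrt (nsq (cylinder T) E) * NP)"
    by (simp add: nsq_nonneg)
qed

text \<open>
  With \<open>e\<close> the norm of \<open>E\<close>, an objective of at least \<open>c\<close> gives \<open>e^2 \<le> 2 d (e NP - c)\<close>; completing the square
  bounds \<open>c\<close> by \<open>d NP^2 / 2\<close>.
\<close>

lemma objective_upper:
  assumes EB: "(E, B) \<in> EB_class T"
  shows "objective T P E B \<le> ereal (real CARD('n) * NP\<^sup>2)"
proof (rule ccontr)
  let ?d = "real CARD('n)" and ?e = "sqrt (nsq (cylinder T) E)"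
  assume "\<not> objective T P E B \<le> ereal (?d * NP\<^sup>2)"
  then have "ereal (?d * NP\<^sup>2) < objective T P E B" by simp
  then obtain c where c: "ereal (?d * NP\<^sup>2) < ereal c" "ereal c < objective T P E B" using ereal_dense2 by blast
  have "?e\<^sup>2 \<le> 2 * ?d * (- c + ?e * NP)" using objective_imp_energy(1)[OF EB less_imp_le[OF c(2)]] .
  moreover have "(?e - ?d * NP)\<^sup>2 \<ge> 0" by simp
  moreover have "(?e - ?d * NP)\<^sup>2 = ?e\<^sup>2 - 2 * ?d * (?e * NP) + ?d * (?d * NP\<^sup>2)"
    by (simp add: power2_eq_square algebra_simps)
  moreover have "2 * ?d * (- c + ?e * NP) = - 2 * (?d * c) + 2 * ?d * (?e * NP)" by (simp add: algebra_simps)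
  ultimately have "2 * (?d * c) \<le> ?d * (?d * NP\<^sup>2)" by linarith
  moreover have "?d * (?d * NP\<^sup>2) < ?d * c" using c(1) by (intro mult_strict_left_mono) auto
  moreover have "0 \<le> ?d * (?d * NP\<^sup>2)" by simp
  ultimately show False by linarith
qed

lemma zero_EB: "((\<lambda>_. 0), (\<lambda>_. 0)) \<in> EB_class T"
  by (auto simp: EB_class_iff Lsq_def sym_mat_def transpose_def vec_eq_iff intro!: exI[of _ 0])

lemma J_nonneg: "0 \<le> J T P"
proof -
  have "objective T P (\<lambda>_. 0) (\<lambda>_. 0) \<le> J T P"
    unfolding J_def by (rule SUP_upper2[OF zero_EB]) simp
  moreover have "ereal 0 \<le> objective T P (\<lambda>_. 0) (\<lambda>_. 0)"
    unfolding objective_ge_iff K_le_iff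
  proof (clarify)
    fix Z :: "real \<times> (real^'n) \<Rightarrow> real^'n" and M assume zm: "(Z, M) \<in> K_admissible T"
    have "mat 1 \<bullet> M p \<ge> 0" if "p \<in> space (cylinder T)" for p
    proof -
      have ge: "mat_ge (M p) (tensor (Z p) (Z p))" using zm that by (auto simp: K_admissible_def)
      have "M p $ i $ i \<ge> 0" for i
      proof -
        have "axis i 1 \<bullet> (tensor (Z p) (Z p) *v axis i 1) \<le> axis i 1 \<bullet> (M p *v axis i 1)" using ge unfolding mat_ge_def by blast
        then show ?thesis unfolding tensor_quad axis_mat using zero_le_power2[of "Z p \<bullet> axis i 1"] by linarith
      qed
      then show ?thesis using contract_mat1[of "M p" 1] by (simp add: contract_inner inner_commute trace_def sum_nonneg)
    qed
    then have "(\<integral>p. mat 1 \<bullet> M p \<partial>cylinder T) \<ge> 0" by (intro integral_nonneg_AE AE_I2)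
    then show "K_value T (\<lambda>_. 0) (\<lambda>_. 0) Z M \<le> - 0 - P_pairing T P (\<lambda>_. 0)" by (simp add: K_value_def P_pairing_def contract_inner)
  qed
  ultimately show ?thesis by (simp add: zero_ereal_def)
qed

lemma J_upper: "J T P \<le> ereal (real CARD('n) * NP\<^sup>2)"
  unfolding J_def by (rule SUP_least) (auto intro: objective_upper)

text \<open>
  The supremum is attained: the sets of almost maximizers are nested, midpoint convex and bounded.
\<close>

theorem solution_exists: "\<exists>E B. is_solution T P E B"
proof -
  obtain j where j: "J T P = ereal j" "j \<ge> 0"
    using J_nonneg J_upper by (cases "J T P") auto
  define C where "C n = {\<lambda>p. (E p, B p) | E B. (E, B) \<in> EB_class T \<and> ereal (j - 1 / real (Suc n)) \<le> objective T P E B}" for n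
  have CI: "(\<lambda>p. (E p, B p)) \<in> C n" if "(E, B) \<in> EB_class T" "ereal (j - 1 / real (Suc n)) \<le> objective T P E B" for E B n
    using that unfolding C_def by blast
  let ?d = "real CARD('n)"
  interpret fin: finite_measure "cylinder T :: (real \<times> (real^'n)) measure" by (rule cylinder_finite)
  \<comment> \<open>pairs \<open>(E, B)\<close> are regarded as functions with values in the product space\<close>
  have pair_Lsq: "Lsq (cylinder T) (\<lambda>p. (E p, B p))" "nsq (cylinder T) (\<lambda>p. (E p, B p)) = nsq (cylinder T) E + nsq (cylinder T) B"
    if "Lsq (cylinder T) E" "Lsq (cylinder T) B" for E :: "real \<times> (real^'n) \<Rightarrow> real^'n" and B :: "real \<times> (real^'n) \<Rightarrow> real^'n^'n"
  proof -
    have n: "(norm (E p, B p))\<^sup>2 = (norm (E p))\<^sup>2 + (norm (B p))\<^sup>2" for p by (simp add: norm_Pair)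
    show "Lsq (cylinder T) (\<lambda>p. (E p, B p))" using that by (auto simp: Lsq_def n)
    show "nsq (cylinder T) (\<lambda>p. (E p, B p)) = nsq (cylinder T) E + nsq (cylinder T) B"
      using that by (simp add: nsq_def n Lsq_def)
  qed
  obtain x F where x: "\<And>n. x n \<in> C n" and F: "Lsq (cylinder T) F" and lim: "(\<lambda>n. nsq (cylinder T) (\<lambda>p. x n p - F p)) \<longlonglongrightarrow> 0"
    and ae: "AE p in cylinder T. (\<lambda>n. x n p) \<longlonglongrightarrow> F p"
  proof (rule nested_midconvex_limit[of "cylinder T" C])
    show "finite_measure (cylinder T :: (real \<times> (real^'n)) measure)" by (rule cylinder_finite)
    show "C n \<noteq> {}" for n
    proof -
      have "ereal (j - 1 / real (Suc n)) < J T P" using j by simp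
      then obtain E B where "(E, B) \<in> EB_class T" "ereal (j - 1 / real (Suc n)) < objective T P E B"
        unfolding J_def less_SUP_iff by auto
      then show ?thesis unfolding C_def by (auto intro: less_imp_le)
    qed
    show "C (Suc n) \<subseteq> C n" for n
    proof -
      have "1 / real (Suc (Suc n)) \<le> 1 / real (Suc n)" by (intro divide_left_mono) auto
      then have "ereal (j - 1 / real (Suc n)) \<le> ereal (j - 1 / real (Suc (Suc n)))" by simp
      then show ?thesis unfolding C_def using order_trans by blast
    qed
    show "(\<lambda>x. (1/2) *\<^sub>R (f x + g x)) \<in> C n" if fg: "f \<in> C n" "g \<in> C n" for n f g
    proof -
      let ?c = "j - 1 / real (Suc n)"
      obtain E B where f: "f = (\<lambda>p. (E p, B p))" and EB: "(E, B) \<in> EB_class T" and o: "ereal ?c \<le> objective T P E B"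
        using fg(1) unfolding C_def by blast
      obtain E' B' where g: "g = (\<lambda>p. (E' p, B' p))" and EB': "(E', B') \<in> EB_class T" and o': "ereal ?c \<le> objective T P E' B'"
        using fg(2) unfolding C_def by blast
      let ?E = "\<lambda>p. (1 - 1/2) *\<^sub>R E p + (1/2) *\<^sub>R E' p" and ?B = "\<lambda>p. (1 - 1/2) *\<^sub>R B p + (1/2) *\<^sub>R B' p"
      have cc: "(?E, ?B) \<in> EB_class T \<and> ereal (1 - 1/2) * objective T P E B + ereal (1/2) * objective T P E' B' \<le> objective T P ?E ?B"
        by (rule objective_concave[OF P EB EB']) simp
      have half: "ereal c = ereal (1 - 1/2) * ereal c + ereal (1/2) * ereal c" for c by simp
      have "ereal ?c = ereal (1 - 1/2) * ereal ?c + ereal (1/2) * ereal ?c" by (rule half)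
      also have "\<dots> \<le> ereal (1 - 1/2) * objective T P E B + ereal (1/2) * objective T P E' B'"
        by (intro add_mono ereal_mult_left_mono o o') auto
      also have "\<dots> \<le> objective T P ?E ?B" using cc by blast
      finally have "ereal ?c \<le> objective T P ?E ?B" .
      moreover have "(\<lambda>x. (1/2) *\<^sub>R (f x + g x)) = (\<lambda>p. (?E p, ?B p))"
        unfolding f g by (simp add: scaleR_add_right)
      ultimately show ?thesis using CI[of ?E ?B n] cc by simp
    qed
    show "Lsq (cylinder T) f" if "f \<in> C n" for n f
      using that pair_Lsq(1)[OF EB_Lsq] unfolding C_def by blast
    show "nsq (cylinder T) f \<le> (4 * ?d + 4 * ?d\<^sup>2 * NP\<^sup>2) + (constrained_bound TYPE('n))\<^sup>2 * measure (cylinder T :: (real \<times> (real^'n)) measure) (space (cylinder T))" if fC: "f \<in> C n" for n f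
    proof -
      obtain E B where f: "f = (\<lambda>p. (E p, B p))" and EB: "(E, B) \<in> EB_class T" and o: "ereal (j - 1 / real (Suc n)) \<le> objective T P E B"
        using fC unfolding C_def by blast
      have "1 / real (Suc n) \<le> 1" by simp
      then have "- 1 \<le> j - 1 / real (Suc n)" using j by linarith
      \<comment> \<open>a lower bound that does not depend on \<open>n\<close>\<close>
      then have o1: "ereal (- 1) \<le> objective T P E B" using o by (meson ereal_less_eq(3) order_trans)
      let ?e = "sqrt (nsq (cylinder T) E)"
      have "?e\<^sup>2 \<le> 2 * ?d * (- (- 1) + ?e * NP)" by (rule objective_imp_energy(1)[OF EB o1])
      moreover have "2 * ?d * (- (- 1) + ?e * NP) = 2 * ?d + 2 * (?d * NP) * ?e" by (simp add: algebra_simps)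
      moreover have "0 \<le> (?e - 2 * (?d * NP))\<^sup>2" by simp
      moreover have "(?e - 2 * (?d * NP))\<^sup>2 = ?e\<^sup>2 - 2 * (2 * (?d * NP) * ?e) + 4 * ?d\<^sup>2 * NP\<^sup>2"
        by (simp add: power2_eq_square algebra_simps)
      ultimately have "?e\<^sup>2 \<le> 4 * ?d + 4 * ?d\<^sup>2 * NP\<^sup>2" by linarith
      then have e: "nsq (cylinder T) E \<le> 4 * ?d + 4 * ?d\<^sup>2 * NP\<^sup>2" by (simp add: nsq_nonneg)
      have "nsq (cylinder T) B \<le> (\<integral>p. (constrained_bound TYPE('n))\<^sup>2 \<partial>(cylinder T :: (real \<times> (real^'n)) measure))"
        unfolding nsq_def
      proof (rule integral_mono_AE)
        show "AE p in cylinder T. (norm (B p))\<^sup>2 \<le> (constrained_bound TYPE('n))\<^sup>2"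
          using objective_imp_energy(2)[OF EB o1] by eventually_elim (intro power_mono constrained_norm; simp)
      qed (use Lsq_int[OF EB_Lsq(2)[OF EB]] in auto)
      then show ?thesis using e unfolding f pair_Lsq(2)[OF EB_Lsq[OF EB]] by (simp add: mult.commute)
    qed
  qed blast
  have "\<forall>n. \<exists>E B. x n = (\<lambda>p. (E p, B p)) \<and> (E, B) \<in> EB_class T \<and> ereal (j - 1 / real (Suc n)) \<le> objective T P E B"
    using x unfolding C_def by blast
  from choice[OF this] obtain En where "\<forall>n. \<exists>B. x n = (\<lambda>p. (En n p, B p)) \<and> (En n, B) \<in> EB_class T \<and> ereal (j - 1 / real (Suc n)) \<le> objective T P (En n) B" ..
  from choice[OF this] obtain Bn where "\<forall>n. x n = (\<lambda>p. (En n p, Bn n p)) \<and> (En n, Bn n) \<in> EB_class T \<and> ereal (j - 1 / real (Suc n)) \<le> objective T P (En n) (Bn n)" ..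
  then have xn: "\<And>n. x n = (\<lambda>p. (En n p, Bn n p))" and EBn: "\<And>n. (En n, Bn n) \<in> EB_class T"
    and on: "\<And>n. ereal (j - 1 / real (Suc n)) \<le> objective T P (En n) (Bn n)" by auto
  define E where "E p = fst (F p)" for p
  define B where "B p = snd (F p)" for p
  note Ln = EB_Lsq[OF EBn]
  have fm: "F \<in> borel_measurable (cylinder T)" using F by (rule Lsq_meas)
  have nfs: "norm (fst z) \<le> norm z" "norm (snd z) \<le> norm z" for z :: "(real^'n) \<times> (real^'n^'n)"
    using norm_fst_le[of "fst z" "snd z"] norm_snd_le[of "snd z" "fst z"] by simp_all
  have EL: "Lsq (cylinder T) E"
  proof (rule Lsq_bound[OF _ Lsq_int[OF F]])
    show "E \<in> borel_measurable (cylinder T)" unfolding E_def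
      by (rule measurable_compose[OF fm]) (intro borel_measurable_continuous_onI continuous_intros)
    show "AE p in cylinder T. (norm (E p))\<^sup>2 \<le> (norm (F p))\<^sup>2"
      unfolding E_def by (intro AE_I2 power_mono nfs) auto
  qed
  have BL: "Lsq (cylinder T) B"
  proof (rule Lsq_bound[OF _ Lsq_int[OF F]])
    show "B \<in> borel_measurable (cylinder T)" unfolding B_def
      by (rule measurable_compose[OF fm]) (intro borel_measurable_continuous_onI continuous_intros)
    show "AE p in cylinder T. (norm (B p))\<^sup>2 \<le> (norm (F p))\<^sup>2"
      unfolding B_def by (intro AE_I2 power_mono nfs) auto
  qed
  have sum: "nsq (cylinder T) (\<lambda>p. x n p - F p) = nsq (cylinder T) (\<lambda>p. En n p - E p) + nsq (cylinder T) (\<lambda>p. Bn n p - B p)" for n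
  proof -
    have "(\<lambda>p. x n p - F p) = (\<lambda>p. (En n p - E p, Bn n p - B p))"
      by (auto simp: xn E_def B_def prod_eq_iff)
    then show ?thesis using pair_Lsq(2)[OF Lsq_diff[OF Ln(1) EL] Lsq_diff[OF Ln(2) BL]] by simp
  qed
  have El: "(\<lambda>n. nsq (cylinder T) (\<lambda>p. En n p - E p)) \<longlonglongrightarrow> 0"
    by (rule tendsto_sandwich[OF _ _ tendsto_const lim]) (auto simp: sum nsq_nonneg)
  have Bl: "(\<lambda>n. nsq (cylinder T) (\<lambda>p. Bn n p - B p)) \<longlonglongrightarrow> 0"
    by (rule tendsto_sandwich[OF _ _ tendsto_const lim]) (auto simp: sum nsq_nonneg)
  note tE = Lsq_tendsto_inner[OF Ln(1) EL _ El] and tB = Lsq_tendsto_inner[OF Ln(2) BL _ Bl]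
  have "AE p in cylinder T. \<forall>n. constrained (Bn n p)"
    unfolding AE_all_countable using objective_imp_energy(2)[OF EBn on] by blast
  then have gb: "AE p in cylinder T. norm (B p) \<le> constrained_bound TYPE('n) \<and> sym_mat (B p)" using ae
  proof eventually_elim
    case (elim p)
    have l: "(\<lambda>n. Bn n p) \<longlonglongrightarrow> B p" using tendsto_snd[OF elim(2)] by (simp add: xn B_def)
    have "norm (B p) \<le> constrained_bound TYPE('n)"
      by (rule LIMSEQ_le_const2[OF tendsto_norm[OF l]]) (use elim(1) constrained_norm in blast)
    moreover have "sym_mat (B p)"
    proof -
      have "B p $ j $ i = B p $ i $ j" for i j
      proof (rule LIMSEQ_unique)
        show "(\<lambda>n. Bn n p $ i $ j) \<longlonglongrightarrow> B p $ i $ j" by (intro tendsto_vec_nth l)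
        have "Bn n p $ i $ j = Bn n p $ j $ i" for n
          using elim(1) unfolding constrained_def sym_mat_def transpose_def by (metis vec_lambda_beta)
        then show "(\<lambda>n. Bn n p $ i $ j) \<longlonglongrightarrow> B p $ j $ i" using tendsto_vec_nth[OF tendsto_vec_nth[OF l]] by simp
      qed
      then show ?thesis by (simp add: sym_mat_def transpose_def vec_eq_iff)
    qed
    ultimately show ?case ..
  qed
  have EB: "(E, B) \<in> EB_class T"
    unfolding EB_class_iff
  proof (intro conjI allI impI)
    show "Lsq (cylinder T) E" "B \<in> borel_measurable (cylinder T)" using EL BL by (auto simp: Lsq_def)
    show "\<exists>C. AE p in cylinder T. norm (B p) \<le> C" "AE p in cylinder T. sym_mat (B p)" using gb by auto
    fix \<zeta> and \<psi> :: "real^'n \<Rightarrow> real^'n^'n" assume t: "testpair \<zeta> \<psi>"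
    then have ts: "smooth \<zeta>" "smooth_field \<psi>" by (auto simp: testpair_def)
    note G = constraint_integral(2,3)[OF EL BL ts]
    have "(\<integral>p. Bn n p \<bullet> (deriv \<zeta> (fst p) *\<^sub>R \<psi> (snd p)) \<partial>cylinder T) = (\<integral>p. En n p \<bullet> (\<zeta> (fst p) *\<^sub>R dualv \<psi> (snd p)) \<partial>cylinder T)" for n
      using EBn t unfolding EB_class_iff by blast
    then show "(\<integral>p. B p \<bullet> (deriv \<zeta> (fst p) *\<^sub>R \<psi> (snd p)) \<partial>cylinder T) = (\<integral>p. E p \<bullet> (\<zeta> (fst p) *\<^sub>R dualv \<psi> (snd p)) \<partial>cylinder T)"
      using tE[OF G(2)] tB[OF G(1)] LIMSEQ_unique by (simp only:)
  qed
  have "ereal j \<le> objective T P E B"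
    unfolding objective_ge_iff K_le_iff
  proof clarify
    fix Z :: "real \<times> (real^'n) \<Rightarrow> real^'n" and M assume zm: "(Z, M) \<in> K_admissible T"
    then have ZM: "Lsq (cylinder T) Z" "Lsq (cylinder T) M" using K_admissible_Lsq by auto
    have "(\<lambda>n. K_value T (En n) (Bn n) Z M + P_pairing T P (En n)) \<longlonglongrightarrow> K_value T E B Z M + P_pairing T P E"
      unfolding K_value_eq[OF Ln ZM] K_value_eq[OF EL BL ZM] P_pairing_def
      by (intro tendsto_intros tE[OF ZM(1)] tB[OF ZM(2)] tE[OF P])
    moreover have "(\<lambda>n. - j + 1 / real (Suc n)) \<longlonglongrightarrow> - j + 0"
      by (intro tendsto_intros LIMSEQ_Suc[OF lim_1_over_n])
    moreover have "K_value T (En n) (Bn n) Z M + P_pairing T P (En n) \<le> - j + 1 / real (Suc n)" for n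
      using on[of n] zm unfolding objective_ge_iff K_le_iff by fastforce
    ultimately have "K_value T E B Z M + P_pairing T P E \<le> - j + 0" by (intro LIMSEQ_le) auto
    then show "K_value T E B Z M \<le> - j - P_pairing T P E" by simp
  qed
  moreover have "objective T P E B \<le> J T P" unfolding J_def by (rule SUP_upper2[OF EB]) simp
  ultimately have "objective T P E B = J T P" using j by simp
  then show ?thesis using EB unfolding is_solution_def by blast
qed

lemma solution_bounds:
  assumes "is_solution T P E B"
  shows "(E, B) \<in> EB_class T" "AE p in cylinder T. constrained (B p)" "nsq (cylinder T) E \<le> 4 * (real CARD('n))\<^sup>2 * NP\<^sup>2"
proof -
  let ?d = "real CARD('n)" and ?e = "sqrt (nsq (cylinder T) E)"
  show EB: "(E, B) \<in> EB_class T" using assms by (simp add: is_solution_def)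
  have o: "ereal 0 \<le> objective T P E B" using assms J_nonneg by (simp add: is_solution_def zero_ereal_def)
  show "AE p in cylinder T. constrained (B p)" by (rule objective_imp_energy(2)[OF EB o])
  have 1: "?e\<^sup>2 \<le> 2 * ?d * (- 0 + ?e * NP)" by (rule objective_imp_energy(1)[OF EB o])
  have e0: "?e \<ge> 0" by (simp add: nsq_nonneg)
  have "?e \<le> 2 * ?d * NP"
  proof (cases "?e = 0")
    case True
    then show ?thesis by (simp add: nsq_nonneg)
  next
    case False
    then have "?e > 0" using e0 by simp
    moreover have "?e * ?e \<le> ?e * (2 * ?d * NP)" using 1 by (simp add: power2_eq_square mult_ac)
    ultimately show ?thesis by (simp only: mult_le_cancel_left_pos)
  qed
  then have "?e\<^sup>2 \<le> (2 * ?d * NP)\<^sup>2" using e0 by (rule power_mono)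
  also have "(2 * ?d * NP)\<^sup>2 = 4 * ?d\<^sup>2 * NP\<^sup>2" by (simp add: power_mult_distrib)
  finally show "nsq (cylinder T) E \<le> 4 * ?d\<^sup>2 * NP\<^sup>2" by (simp add: nsq_nonneg)
qed

end

section \<open>The evolution equation at almost every time\<close>

text \<open>
  The time interval with Lebesgue measure.
\<close>

abbreviation time_space :: "real \<Rightarrow> real measure" where "time_space T \<equiv> restrict_space lborel {0..T}"

lemma time_fubini:
  fixes a :: "real \<Rightarrow> real"
  assumes a: "integrable (time_space T) a"
  shows "integrable (time_space T) (\<lambda>s. \<integral>t. indicator {s..T} t * a t \<partial>time_space T)"
    and "(\<integral>s. (\<integral>t. indicator {s..T} t * a t \<partial>time_space T) * s ^ m \<partial>time_space T) = (\<integral>t. a t * (t ^ Suc m / real (Suc m)) \<partial>time_space T)"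
proof -
  interpret t: finite_measure "time_space T" by (rule time_finite)
  interpret tt: pair_sigma_finite "time_space T" "time_space T" by (intro pair_sigma_finite.intro finite_measure.axioms(1)[OF time_finite])
  have am [measurable]: "a \<in> borel_measurable (time_space T)" using a by auto
  have ids: "(\<lambda>s. s) \<in> measurable (time_space T) borel" by (rule measurable_restrict_space1) simp
  have i: "integrable (time_space T \<Otimes>\<^sub>M time_space T) (\<lambda>(s, t). (if s \<le> t then 1 else 0) * a t * s ^ m)" for m
  proof (rule Bochner_Integration.integrable_bound[of _ "\<lambda>(s, t). a t * (max T 0) ^ m"])
    show "integrable (time_space T \<Otimes>\<^sub>M time_space T) (\<lambda>(s, t). a t * (max T 0) ^ m)"
    proof (rule tt.Fubini_integrable)
      show "(\<lambda>(s, t). a t * (max T 0) ^ m) \<in> borel_measurable (time_space T \<Otimes>\<^sub>M time_space T)" by measurable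
    qed (use a in simp_all)
    have 1: "(\<lambda>p. fst p) \<in> borel_measurable (time_space T \<Otimes>\<^sub>M time_space T)" "(\<lambda>p. snd p) \<in> borel_measurable (time_space T \<Otimes>\<^sub>M time_space T)"
      by (rule measurable_compose[OF measurable_fst ids], rule measurable_compose[OF measurable_snd ids])
    have 2: "(\<lambda>p. if fst p \<le> snd p then 1 else 0 :: real) \<in> borel_measurable (time_space T \<Otimes>\<^sub>M time_space T)"
      using borel_measurable_pred_less 1 by (intro measurable_If) (auto intro!: borel_measurable_le)
    have 3: "(\<lambda>p. a (snd p)) \<in> borel_measurable (time_space T \<Otimes>\<^sub>M time_space T)" by measurable
    show "(\<lambda>(s, t). (if s \<le> t then 1 else 0) * a t * s ^ m) \<in> borel_measurable (time_space T \<Otimes>\<^sub>M time_space T)"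
      unfolding split_beta by (intro borel_measurable_times borel_measurable_power 1 2 3)
    show "AE p in time_space T \<Otimes>\<^sub>M time_space T. norm (case p of (s, t) \<Rightarrow> (if s \<le> t then 1 else 0) * a t * s ^ m)
      \<le> norm (case p of (s, t) \<Rightarrow> a t * (max T 0) ^ m)"
    proof (intro AE_I2)
      fix p assume p: "p \<in> space (time_space T \<Otimes>\<^sub>M time_space T)"
      then have s: "0 \<le> fst p" "fst p \<le> T" by (auto simp: space_pair_measure space_restrict_space)
      have "\<bar>a (snd p)\<bar> * \<bar>fst p ^ m\<bar> \<le> \<bar>a (snd p)\<bar> * (max T 0) ^ m"
        using s by (intro mult_left_mono) (auto simp: power_abs intro!: power_mono)
      then show "norm (case p of (s, t) \<Rightarrow> (if s \<le> t then 1 else 0) * a t * s ^ m)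
        \<le> norm (case p of (s, t) \<Rightarrow> a t * (max T 0) ^ m)"
        by (auto simp: split_beta abs_mult)
    qed
  qed
  have ind: "(\<integral>t. indicator {s..T} t * a t \<partial>time_space T) = (\<integral>t. (if s \<le> t then 1 else 0) * a t \<partial>time_space T)" for s
    by (intro Bochner_Integration.integral_cong) (auto simp: space_restrict_space indicator_def)
  show "integrable (time_space T) (\<lambda>s. \<integral>t. indicator {s..T} t * a t \<partial>time_space T)"
    using tt.integrable_fst'[OF i[of 0]] by (simp add: ind)
  have pw: "(\<integral>s. (if s \<le> t then 1 else 0) * s ^ m \<partial>time_space T) = t ^ Suc m / real (Suc m)" if t: "t \<in> {0..T}" for t
  proof -
    have "(\<integral>s. (if s \<le> t then 1 else 0) * s ^ m \<partial>time_space T) = (\<integral>s. indicator {0..T} s *\<^sub>R ((if s \<le> t then 1 else 0) * s ^ m) \<partial>lborel)"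
      by (rule integral_restrict_space) simp
    also have "\<dots> = (\<integral>s. s ^ m * indicator {0..t} s \<partial>lborel)"
      using t by (intro Bochner_Integration.integral_cong) (auto simp: indicator_def)
    also have "\<dots> = (t ^ Suc m - 0 ^ Suc m) / real (Suc m)" using t by (intro integral_power) auto
    finally show ?thesis by simp
  qed
  have "(\<integral>s. (\<integral>t. indicator {s..T} t * a t \<partial>time_space T) * s ^ m \<partial>time_space T) = (\<integral>s. (\<integral>t. (if s \<le> t then 1 else 0) * a t * s ^ m \<partial>time_space T) \<partial>time_space T)"
    by (simp add: ind)
  also have "\<dots> = (\<integral>t. (\<integral>s. (if s \<le> t then 1 else 0) * a t * s ^ m \<partial>time_space T) \<partial>time_space T)"
    by (rule tt.Fubini_integral[OF i, symmetric])
  also have "\<dots> = (\<integral>t. a t * (\<integral>s. (if s \<le> t then 1 else 0) * s ^ m \<partial>time_space T) \<partial>time_space T)"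
  proof (intro Bochner_Integration.integral_cong refl)
    fix t
    have "(\<lambda>s. (if s \<le> t then 1 else 0) * a t * s ^ m) = (\<lambda>s. a t * ((if s \<le> t then 1 else 0) * s ^ m))" by (auto simp: mult_ac)
    then show "(\<integral>s. (if s \<le> t then 1 else 0) * a t * s ^ m \<partial>time_space T) = a t * (\<integral>s. (if s \<le> t then 1 else 0) * s ^ m \<partial>time_space T)"
      by (simp only: integral_mult_right_zero)
  qed
  also have "\<dots> = (\<integral>t. a t * (t ^ Suc m / real (Suc m)) \<partial>time_space T)"
    by (intro Bochner_Integration.integral_cong refl) (simp add: pw space_restrict_space del: power_Suc of_nat_Suc)
  finally show "(\<integral>s. (\<integral>t. indicator {s..T} t * a t \<partial>time_space T) * s ^ m \<partial>time_space T) = (\<integral>t. a t * (t ^ Suc m / real (Suc m)) \<partial>time_space T)" .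
qed

lemma time_identity:
  fixes a u :: "real \<Rightarrow> real"
  assumes u: "integrable (time_space T) u" and a: "integrable (time_space T) a"
    and eq: "\<And>m. (\<integral>t. u t * t ^ m \<partial>time_space T) = (\<integral>t. a t * (t ^ Suc m / real (Suc m)) \<partial>time_space T)"
  shows "AE s in time_space T. u s = (\<integral>t. indicator {s..T} t * a t \<partial>time_space T)"
proof -
  let ?A = "\<lambda>s. \<integral>t. indicator {s..T} t * a t \<partial>time_space T"
  note A = time_fubini(1)[OF a]
  have ub: "integrable (time_space T) (\<lambda>t. f t * t ^ m)" if f: "integrable (time_space T) f" for f :: "real \<Rightarrow> real" and m
  proof (rule Bochner_Integration.integrable_bound[of _ "\<lambda>t. f t * max T 0 ^ m"])
    have "(\<lambda>s. s) \<in> measurable (time_space T) borel" by (rule measurable_restrict_space1) simp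
    moreover have "f \<in> borel_measurable (time_space T)" using f by auto
    ultimately show "(\<lambda>t. f t * t ^ m) \<in> borel_measurable (time_space T)" by (intro borel_measurable_times borel_measurable_power)
    show "AE t in time_space T. norm (f t * t ^ m) \<le> norm (f t * max T 0 ^ m)"
      by (intro AE_I2) (auto simp: space_restrict_space abs_mult power_abs intro!: mult_left_mono power_mono)
  qed (use f in simp)
  have "AE s in time_space T. u s - ?A s = 0"
  proof (rule time_AE_zero)
    show "integrable (time_space T) (\<lambda>s. u s - ?A s)" using u A by simp
    show "(\<integral>t. (u t - ?A t) * t ^ m \<partial>time_space T) = 0" for m
    proof -
      have "(\<integral>t. (u t - ?A t) * t ^ m \<partial>time_space T) = (\<integral>t. u t * t ^ m \<partial>time_space T) - (\<integral>t. ?A t * t ^ m \<partial>time_space T)"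
        unfolding left_diff_distrib by (intro Bochner_Integration.integral_diff ub u A)
      then show ?thesis using eq[of m] time_fubini(2)[OF a, of m] by simp
    qed
  qed
  then show ?thesis by eventually_elim simp
qed

text \<open>
  The function of time whose regularity is claimed, \<open>s \<mapsto> \<integral>B(s,\<cdot>) : \<psi>\<close>.
\<close>

definition pairB :: "(real \<times> (real^'n) \<Rightarrow> real^'n^'n) \<Rightarrow> (real^'n \<Rightarrow> real^'n^'n) \<Rightarrow> real \<Rightarrow> real" where
  "pairB B \<psi> s = (\<integral>x. B (s, x) \<bullet> \<psi> x \<partial>torus)"

text \<open>
  What the evolution equation and the final condition \<open>B(T,\<cdot>) = 0\<close> make of it: \<open>\<integral>_s^T \<integral>E \<cdot> w\<close>, where \<open>w\<close> is the
  dual field of \<open>\<psi>\<close>. As an integral over the cylinder it is linear in \<open>\<psi>\<close> for every \<open>s\<close>.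
\<close>

definition fluxE :: "real \<Rightarrow> (real \<times> (real^'n) \<Rightarrow> real^'n) \<Rightarrow> (real^'n \<Rightarrow> real^'n^'n) \<Rightarrow> real \<Rightarrow> real" where
  "fluxE T E \<psi> s = (\<integral>p. E p \<bullet> (indicator {s..T} (fst p) *\<^sub>R dualv \<psi> (snd p)) \<partial>cylinder T)"

lemma fst_meas: "fst \<in> borel_measurable (cylinder T)"
proof -
  have "(\<lambda>s. s) \<in> measurable (time_space T) borel" by (rule measurable_restrict_space1) simp
  then show ?thesis unfolding cylinder_def by (rule measurable_compose[OF measurable_fst])
qed

lemma dualv_snd_Lsq: assumes "smooth_field \<psi>" shows "Lsq (cylinder T) (\<lambda>p. dualv \<psi> (snd p))"
  by (intro cont_Lsq continuous_on_compose2[OF dualv_cont[OF assms]] continuous_intros) auto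

lemma dualv_ind_Lsq:
  assumes "smooth_field \<psi>" "S \<in> sets borel"
  shows "Lsq (cylinder T) (\<lambda>p. (indicator S (fst p) :: real) *\<^sub>R dualv \<psi> (snd p))"
proof (rule Lsq_bound[OF _ Lsq_int[OF dualv_snd_Lsq[OF assms(1)]]])
  have "(\<lambda>p. indicator S (fst p) :: real) \<in> borel_measurable (cylinder T)"
    by (rule measurable_compose[OF fst_meas]) (use assms in simp)
  then show "(\<lambda>p. (indicator S (fst p) :: real) *\<^sub>R dualv \<psi> (snd p)) \<in> borel_measurable (cylinder T)"
    by (rule borel_measurable_scaleR[OF _ Lsq_meas[OF dualv_snd_Lsq[OF assms(1)]]])
qed (auto simp: indicator_def)

lemma dualv_lin:
  assumes "smooth_field \<psi>" "smooth_field \<eta>"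
  shows "dualv (\<lambda>x. a *\<^sub>R \<psi> x + b *\<^sub>R \<eta> x) x = a *\<^sub>R dualv \<psi> x + b *\<^sub>R dualv \<eta> x"
  by (simp add: dualv_def vec_eq_iff dual_field_lin[OF assms])

lemma dualv_energy:
  assumes "smooth_field \<psi>"
  shows "(\<integral>x. (norm (dualv \<psi> x))\<^sup>2 \<partial>torus) \<le> (\<integral>x. (\<Sum>k\<in>UNIV. (mdiv \<psi> k x)\<^sup>2) \<partial>torus)"
proof -
  have n: "(norm (dualv \<psi> x))\<^sup>2 = (\<Sum>k\<in>UNIV. (dual_field \<psi> k x)\<^sup>2)" for x
    unfolding power2_norm_eq_inner inner_vec_def by (simp add: dualv_def power2_eq_square)
  have c1: "continuous_on UNIV (\<lambda>x. \<Sum>k\<in>UNIV. (dual_field \<psi> k x)\<^sup>2)"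
    by (intro continuous_intros smooth_imp_continuous dual_field_smooth assms)
  have c2: "continuous_on UNIV (\<lambda>x. \<Sum>k\<in>UNIV. (mdiv \<psi> k x)\<^sup>2)"
    by (intro continuous_intros smooth_imp_continuous mdiv_smooth assms)
  show ?thesis unfolding n torus_integral_smooth[OF c1] torus_integral_smooth[OF c2] by (rule dual_field_energy[OF assms])
qed

lemma nsq_ind_dualv:
  assumes \<psi>: "smooth_field \<psi>" and S: "S \<in> sets borel" "S \<subseteq> {0..T}"
  shows "nsq (cylinder T) (\<lambda>p. (indicator S (fst p) :: real) *\<^sub>R dualv \<psi> (snd p)) =
    measure lborel S * (\<integral>x. (norm (dualv \<psi> x))\<^sup>2 \<partial>torus)"
proof -
  have i: "integrable (cylinder T) (\<lambda>p. (norm ((indicator S (fst p) :: real) *\<^sub>R dualv \<psi> (snd p)))\<^sup>2)"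
    by (rule Lsq_int[OF dualv_ind_Lsq[OF \<psi> S(1)]])
  have e: "(norm ((indicator S s :: real) *\<^sub>R v))\<^sup>2 = indicator S s * (norm v)\<^sup>2" for s and v :: "real^'n"
    by (simp add: indicator_def)
  have "nsq (cylinder T) (\<lambda>p. (indicator S (fst p) :: real) *\<^sub>R dualv \<psi> (snd p)) =
    (\<integral>t. (\<integral>x. indicator S t * (norm (dualv \<psi> x))\<^sup>2 \<partial>torus) \<partial>time_space T)"
    unfolding nsq_def e using cylinder_fubini(3)[OF i[unfolded e]] by simp
  also have "\<dots> = (\<integral>t. indicator S t \<partial>time_space T) * (\<integral>x. (norm (dualv \<psi> x))\<^sup>2 \<partial>torus)" by simp
  also have "(\<integral>t. indicator S t \<partial>time_space T) = measure (time_space T) S"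
    using S by (simp add: sets_restrict_space_iff space_restrict_space Int_absorb2 integral_indicator)
  also have "measure (time_space T) S = measure lborel S" using S by (simp add: measure_restrict_space)
  finally show ?thesis .
qed

lemma fluxE_diff:
  assumes E: "Lsq (cylinder T) E" and \<psi>: "smooth_field \<psi>" and s: "s \<in> {0..T}" "s' \<in> {0..T}"
    and L: "(\<integral>x. (norm (dualv \<psi> x))\<^sup>2 \<partial>torus) \<le> L"
  shows "\<bar>fluxE T E \<psi> s - fluxE T E \<psi> s'\<bar> \<le> sqrt (nsq (cylinder T) E) * sqrt L * sqrt \<bar>s - s'\<bar>"
proof -
  have main: "\<bar>fluxE T E \<psi> s - fluxE T E \<psi> s'\<bar> \<le> sqrt (nsq (cylinder T) E) * sqrt L * sqrt (s' - s)"
    if s: "s \<in> {0..T}" "s' \<in> {0..T}" "s \<le> s'" for s s'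
  proof -
    note D = dualv_ind_Lsq[OF \<psi>, of _ T]
    have "indicator {s..T} t - indicator {s'..T} t = (indicator {s..<s'} t :: real)" for t
      using s by (auto simp: indicator_def)
    then have eq: "fluxE T E \<psi> s - fluxE T E \<psi> s' = (\<integral>p. E p \<bullet> ((indicator {s..<s'} (fst p) :: real) *\<^sub>R dualv \<psi> (snd p)) \<partial>cylinder T)"
      unfolding fluxE_def
      by (subst Bochner_Integration.integral_diff[symmetric])
         (auto intro!: Lsq_inner E D Bochner_Integration.integral_cong simp: left_diff_distrib[symmetric] inner_diff_right[symmetric] scaleR_diff_left[symmetric] simp del: inner_scaleR_right)
    have "\<bar>fluxE T E \<psi> s - fluxE T E \<psi> s'\<bar> \<le> sqrt (nsq (cylinder T) E) * sqrt ((s' - s) * (\<integral>x. (norm (dualv \<psi> x))\<^sup>2 \<partial>torus))"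
      unfolding eq using Lsq_Cauchy_Schwarz_abs[OF E D, of "{s..<s'}"] nsq_ind_dualv[OF \<psi>, of "{s..<s'}" T] s by (simp add: subset_iff)
    also have "\<dots> \<le> sqrt (nsq (cylinder T) E) * sqrt ((s' - s) * L)"
      using L s by (intro mult_left_mono real_sqrt_le_mono) (auto simp: nsq_nonneg)
    finally show ?thesis by (simp add: real_sqrt_mult mult_ac)
  qed
  show ?thesis
  proof (cases "s \<le> s'")
    case True
    then show ?thesis using main[of s s'] s by (simp add: abs_minus_commute)
  next
    case False
    then show ?thesis using main[of s' s] s by (simp add: abs_minus_commute)
  qed
qed

text \<open>
  The null set depends on the test field.
\<close>

lemma pairB_eq_fluxE:
  assumes EB: "(E, B) \<in> EB_class T" and \<psi>: "smooth_field \<psi>" "\<And>x. sym_mat (\<psi> x)"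
  shows "AE s in time_space T. pairB B \<psi> s = fluxE T E \<psi> s"
proof -
  note L = EB_Lsq[OF EB]
  have \<psi>c: "continuous_on UNIV \<psi>" using \<psi>(1) by (simp add: smooth_field_def smooth_imp_continuous)
  have BL: "integrable (cylinder T) (\<lambda>p. B p \<bullet> (f (fst p) *\<^sub>R \<psi> (snd p)))" if "continuous_on UNIV f" for f :: "real \<Rightarrow> real"
    by (intro Lsq_inner L cont_Lsq continuous_intros continuous_on_compose2[OF that] continuous_on_compose2[OF \<psi>c]) auto
  have EL: "integrable (cylinder T) (\<lambda>p. E p \<bullet> (f (fst p) *\<^sub>R dualv \<psi> (snd p)))" if "continuous_on UNIV f" for f :: "real \<Rightarrow> real"
    by (intro Lsq_inner L cont_Lsq continuous_intros continuous_on_compose2[OF that] continuous_on_compose2[OF dualv_cont[OF \<psi>(1)]]) auto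
  let ?a = "\<lambda>t. \<integral>x. E (t, x) \<bullet> dualv \<psi> x \<partial>torus"
  have "AE s in time_space T. pairB B \<psi> s = (\<integral>t. indicator {s..T} t * ?a t \<partial>time_space T)"
  proof (rule time_identity)
    show "integrable (time_space T) (pairB B \<psi>)"
      using cylinder_fubini(2)[OF BL[of "\<lambda>_. 1"]] by (simp add: pairB_def[abs_def])
    show "integrable (time_space T) ?a"
      using cylinder_fubini(2)[OF EL[of "\<lambda>_. 1"]] by simp
    fix m
    let ?z = "\<lambda>t::real. t ^ Suc m / real (Suc m)"
    have zc: "continuous_on UNIV ?z" by (rule smooth_imp_continuous[OF power_primitive(1)])
    have pc: "continuous_on UNIV (\<lambda>t::real. t ^ m)" by (intro continuous_intros)
    have "testpair ?z \<psi>" unfolding testpair_def using power_primitive(1)[of m] \<psi> by auto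
    then have "(\<integral>p. B p \<bullet> (deriv ?z (fst p) *\<^sub>R \<psi> (snd p)) \<partial>cylinder T) = (\<integral>p. E p \<bullet> (?z (fst p) *\<^sub>R dualv \<psi> (snd p)) \<partial>cylinder T)"
      using EB unfolding EB_class_iff by blast
    then have eq: "(\<integral>p. B p \<bullet> (fst p ^ m *\<^sub>R \<psi> (snd p)) \<partial>cylinder T) = (\<integral>p. E p \<bullet> (?z (fst p) *\<^sub>R dualv \<psi> (snd p)) \<partial>cylinder T)"
      unfolding power_primitive(2) .
    have "(\<integral>t. pairB B \<psi> t * t ^ m \<partial>time_space T) = (\<integral>t. (\<integral>x. B (t, x) \<bullet> (fst (t, x) ^ m *\<^sub>R \<psi> (snd (t, x))) \<partial>torus) \<partial>time_space T)"
      by (simp add: pairB_def mult.commute)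
    also have "\<dots> = (\<integral>p. B p \<bullet> (fst p ^ m *\<^sub>R \<psi> (snd p)) \<partial>cylinder T)" by (rule cylinder_fubini(3)[OF BL[OF pc]])
    also have "\<dots> = (\<integral>t. (\<integral>x. E (t, x) \<bullet> (?z (fst (t, x)) *\<^sub>R dualv \<psi> (snd (t, x))) \<partial>torus) \<partial>time_space T)"
      unfolding eq by (rule cylinder_fubini(3)[OF EL[OF zc], symmetric])
    also have "\<dots> = (\<integral>t. ?a t * ?z t \<partial>time_space T)"
    proof (intro Bochner_Integration.integral_cong refl)
      fix t
      have "(\<integral>x. E (t, x) \<bullet> (?z t *\<^sub>R dualv \<psi> x) \<partial>torus) = ?z t * ?a t"
        unfolding inner_scaleR_right by (rule integral_mult_right_zero)
      then show "(\<integral>x. E (t, x) \<bullet> (?z (fst (t, x)) *\<^sub>R dualv \<psi> (snd (t, x))) \<partial>torus) = ?a t * ?z t"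
        by (simp only: fst_conv snd_conv mult.commute)
    qed
    finally show "(\<integral>t. pairB B \<psi> t * t ^ m \<partial>time_space T) = (\<integral>t. ?a t * ?z t \<partial>time_space T)" .
  qed
  moreover have "(\<integral>t. indicator {s..T} t * ?a t \<partial>time_space T) = fluxE T E \<psi> s" for s
    unfolding fluxE_def using cylinder_fubini(3)[OF Lsq_inner[OF L(1) dualv_ind_Lsq[OF \<psi>(1), of "{s..T}"]]] by simp
  ultimately show ?thesis by simp
qed

section \<open>Symmetric matrix fields and their entries\<close>

text \<open>
  These matrices span the symmetric ones; see the next two lemmas.
\<close>

definition sym_unit :: "'n \<Rightarrow> 'n \<Rightarrow> real^'n^'n" where
  "sym_unit i j = (\<chi> a b. (if a = i \<and> b = j then 1/2 else 0) + (if a = j \<and> b = i then 1/2 else 0))"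

lemma sym_sym_unit: "sym_mat (sym_unit i j)"
proof -
  have "sym_unit i j $ a $ b = sym_unit i j $ b $ a" for a b
    unfolding sym_unit_def vec_lambda_beta by (cases "a = i"; cases "a = j"; cases "b = i"; cases "b = j") simp_all
  then show ?thesis unfolding sym_mat_def transpose_def vec_eq_iff vec_lambda_beta by blast
qed

lemma sym_expand:
  fixes C :: "real^'n^'n"
  assumes "sym_mat C" shows "C = (\<Sum>i\<in>UNIV. \<Sum>j\<in>UNIV. (C $ i $ j) *\<^sub>R sym_unit i j)"
proof -
  have s: "C $ b $ a = C $ a $ b" for a b
  proof -
    have "transpose C $ a $ b = C $ a $ b" using assms by (simp add: sym_mat_def)
    then show ?thesis by (simp add: transpose_def)
  qed
  have "(\<Sum>i\<in>UNIV. \<Sum>j\<in>UNIV. (C $ i $ j) *\<^sub>R sym_unit i j) $ a $ b = C $ a $ b" for a b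
  proof -
    have 1: "(\<Sum>j\<in>UNIV. C $ i $ j * (if a = i \<and> b = j then 1/2 else 0)) = (if a = i then C $ a $ b / 2 else 0)" for i
      by (cases "a = i") (simp_all add: if_distrib[of "\<lambda>x. _ * x"] cong: if_cong)
    have 2: "(\<Sum>j\<in>UNIV. C $ i $ j * (if a = j \<and> b = i then 1/2 else 0)) = (if b = i then C $ b $ a / 2 else 0)" for i
      by (cases "b = i") (simp_all add: if_distrib[of "\<lambda>x. _ * x"] cong: if_cong)
    have "(\<Sum>i\<in>UNIV. \<Sum>j\<in>UNIV. (C $ i $ j) *\<^sub>R sym_unit i j) $ a $ b =
      (\<Sum>i\<in>UNIV. (\<Sum>j\<in>UNIV. C $ i $ j * (if a = i \<and> b = j then 1/2 else 0))
      + (\<Sum>j\<in>UNIV. C $ i $ j * (if a = j \<and> b = i then 1/2 else 0)))"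
      by (simp add: sym_unit_def distrib_left sum.distrib)
    also have "\<dots> = C $ a $ b / 2 + C $ b $ a / 2"
      unfolding 1 2 by (simp add: sum.distrib)
    finally show ?thesis by (simp add: s[of b a])
  qed
  then show ?thesis by (simp add: vec_eq_iff)
qed

lemma sym_integral:
  fixes f :: "real^'n \<Rightarrow> real^'n^'n"
  assumes "f integrable_on cbox 0 1" "\<And>x. sym_mat (f x)" shows "sym_mat (integral (cbox 0 1) f)"
proof -
  have e: "integral (cbox 0 1) f $ i $ j = integral (cbox 0 1) (\<lambda>x. f x $ i $ j)" for i j
    using integral_linear[OF assms(1) bounded_linear_entry[of i j]] by (simp add: o_def)
  have "f x $ j $ i = f x $ i $ j" for x i j
  proof -
    have "transpose (f x) $ i $ j = f x $ i $ j" using assms(2)[of x] by (simp add: sym_mat_def)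
    then show ?thesis by (simp add: transpose_def)
  qed
  then show ?thesis by (simp add: sym_mat_def transpose_def vec_eq_iff e)
qed

lemma C_diff_1_entry:
  fixes \<psi> :: "real^'n \<Rightarrow> real^'n^'n"
  assumes "C_diff 1 \<psi>" "periodic \<psi>"
  shows "C1_periodic (\<lambda>x. \<psi> x $ i $ j)"
proof -
  have d: "\<psi> differentiable (at x)" for x using assms by simp
  have c: "continuous_on UNIV (\<lambda>x. frechet_derivative \<psi> (at x) b)" if "b \<in> Basis" for b using assms that by simp
  have D: "((\<lambda>x. \<psi> x $ i $ j) has_derivative (\<lambda>h. frechet_derivative \<psi> (at x) h $ i $ j)) (at x)" for x
    by (rule bounded_linear.has_derivative[OF bounded_linear_entry differentiable_derivative[OF d]])
  have "pd k (\<lambda>x. \<psi> x $ i $ j) = (\<lambda>x. frechet_derivative \<psi> (at x) (axis k 1) $ i $ j)" for k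
    using pd_eq[OF D] by auto
  then show ?thesis unfolding C1_periodic_def using D assms(2) c
    by (auto simp: differentiable_def periodic_def intro!: continuous_on_component axis_in_Basis_iff[THEN iffD2])
qed

lemma conv_entry:
  fixes \<psi> :: "real^'n \<Rightarrow> real^'n^'n"
  assumes "continuous_on UNIV q" "continuous_on UNIV \<psi>"
  shows "conv q \<psi> x $ i $ j = conv q (\<lambda>x. \<psi> x $ i $ j) x"
proof -
  have "(\<lambda>y. q y *\<^sub>R \<psi> (x + y)) integrable_on cbox 0 1"
    by (intro cbox_integrable continuous_intros assms shift_cont[OF assms(2)])
  from integral_linear[OF this bounded_linear_entry[of i j]] show ?thesis
    by (simp add: conv_def o_def)
qed

lemma time_dense:
  assumes G: "AE s in time_space T. s \<in> G" and ab: "a < b" "0 \<le> a" "b \<le> T"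
  obtains s where "s \<in> G" "a < s" "s < b"
proof -
  have "\<exists>s\<in>G. a < s \<and> s < b"
  proof (rule ccontr)
    assume n: "\<not> ?thesis"
    have "AE s in lborel. s \<in> {0..T} \<longrightarrow> s \<in> G" using G by (simp add: AE_restrict_space_iff)
    then have "AE s in lborel. s \<notin> {a<..<b}" using n ab by (auto elim!: eventually_mono)
    then have "emeasure lborel {a<..<b} = 0" by (subst (asm) AE_iff_null_sets[symmetric]) auto
    then show False using ab by simp
  qed
  then show ?thesis using that by blast
qed

lemma sqrt_le_sum: "0 \<le> a \<Longrightarrow> 0 \<le> b \<Longrightarrow> c \<le> a + b \<Longrightarrow> sqrt c \<le> sqrt a + sqrt b"
  by (meson order_trans real_sqrt_le_mono sqrt_add_le_add_sqrt)

section \<open>Hoelder continuity at almost every time\<close>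

text \<open>
  The integrated evolution equation holds with the test field \<open>\<psi>\<close> at all times in \<open>G\<close>.
\<close>

definition evolves :: "real \<Rightarrow> real set \<Rightarrow> (real \<times> (real^'n) \<Rightarrow> real^'n) \<Rightarrow> (real \<times> (real^'n) \<Rightarrow> real^'n^'n) \<Rightarrow> (real^'n \<Rightarrow> real^'n^'n) \<Rightarrow> bool" where
  "evolves T G E B \<psi> \<longleftrightarrow> smooth_field \<psi> \<and> (\<forall>s\<in>G. pairB B \<psi> s = fluxE T E \<psi> s)"

lemma torus_Lsq_cont:
  fixes f :: "real^'n \<Rightarrow> 'b::euclidean_space"
  assumes "continuous_on UNIV f" shows "Lsq torus f"
proof -
  have f: "continuous_on (cbox 0 1) f" by (rule continuous_on_subset[OF assms]) auto
  then have "continuous_on (cbox 0 1) (\<lambda>x. (norm (f x))\<^sup>2)" by (intro continuous_intros)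
  then show ?thesis unfolding Lsq_def
    by (intro conjI torus_integral(1) borel_measurable_integrable[OF torus_integral(1)[OF f]])
qed

lemma evolves_lin:
  assumes E: "Lsq (cylinder T) E" and B: "\<And>s. s \<in> G \<Longrightarrow> Lsq torus (\<lambda>x. B (s, x))"
    and \<psi>: "evolves T G E B \<psi>" and \<eta>: "evolves T G E B \<eta>"
  shows "evolves T G E B (\<lambda>x. a *\<^sub>R \<psi> x + b *\<^sub>R \<eta> x)"
  unfolding evolves_def
proof (intro conjI ballI)
  have s: "smooth_field \<psi>" "smooth_field \<eta>" using assms by (auto simp: evolves_def)
  then have c: "continuous_on UNIV \<psi>" "continuous_on UNIV \<eta>" by (auto simp: smooth_field_def smooth_imp_continuous)
  show "smooth_field (\<lambda>x. a *\<^sub>R \<psi> x + b *\<^sub>R \<eta> x)" by (rule smooth_field_lin[OF s])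
  fix t assume t: "t \<in> G"
  have "pairB B (\<lambda>x. a *\<^sub>R \<psi> x + b *\<^sub>R \<eta> x) t = (\<integral>x. a * (B (t, x) \<bullet> \<psi> x) + b * (B (t, x) \<bullet> \<eta> x) \<partial>torus)"
    by (simp add: pairB_def inner_add_right)
  also have "\<dots> = a * pairB B \<psi> t + b * pairB B \<eta> t"
    using Lsq_inner[OF B[OF t] torus_Lsq_cont[OF c(1)]] Lsq_inner[OF B[OF t] torus_Lsq_cont[OF c(2)]]
    by (simp add: pairB_def)
  also have "\<dots> = a * fluxE T E \<psi> t + b * fluxE T E \<eta> t"
    using \<psi> \<eta> t by (simp add: evolves_def)
  also have "\<dots> = (\<integral>p. a * (E p \<bullet> ((indicator {t..T} (fst p) :: real) *\<^sub>R dualv \<psi> (snd p)))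
      + b * (E p \<bullet> ((indicator {t..T} (fst p) :: real) *\<^sub>R dualv \<eta> (snd p))) \<partial>cylinder T)"
    using Lsq_inner[OF E dualv_ind_Lsq[OF s(1), of "{t..T}"]] Lsq_inner[OF E dualv_ind_Lsq[OF s(2), of "{t..T}"]]
    unfolding fluxE_def by (simp del: inner_scaleR_right)
  also have "\<dots> = fluxE T E (\<lambda>x. a *\<^sub>R \<psi> x + b *\<^sub>R \<eta> x) t"
    unfolding fluxE_def dualv_lin[OF s] by (intro Bochner_Integration.integral_cong refl) (simp add: inner_add_right algebra_simps)
  finally show "pairB B (\<lambda>x. a *\<^sub>R \<psi> x + b *\<^sub>R \<eta> x) t = fluxE T E (\<lambda>x. a *\<^sub>R \<psi> x + b *\<^sub>R \<eta> x) t" .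
qed

lemma evolves_sum:
  assumes E: "Lsq (cylinder T) E" and B: "\<And>s. s \<in> G \<Longrightarrow> Lsq torus (\<lambda>x. B (s, x))"
    and I: "finite I" "\<And>i. i \<in> I \<Longrightarrow> evolves T G E B (\<psi> i)" and z: "evolves T G E B \<eta>"
  shows "evolves T G E B (\<lambda>x. \<Sum>i\<in>I. c i *\<^sub>R \<psi> i x)"
  using I
proof (induction I rule: finite_induct)
  case empty
  show ?case using evolves_lin[OF E B z z, of 0 0] by simp
next
  case (insert i I)
  have "evolves T G E B (\<lambda>x. c i *\<^sub>R \<psi> i x + 1 *\<^sub>R (\<Sum>i\<in>I. c i *\<^sub>R \<psi> i x))"
    by (rule evolves_lin[OF E B]) (use insert in auto)
  then show ?case using insert by simp
qed

text \<open>
  A countable family that spans the symmetric trigonometric polynomials.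
\<close>

definition trig_mat :: "bool \<Rightarrow> int^'n \<Rightarrow> 'n \<Rightarrow> 'n \<Rightarrow> real^'n \<Rightarrow> real^'n^'n" where
  "trig_mat b k i j x = (if b then cos (freq k \<bullet> x) else sin (freq k \<bullet> x)) *\<^sub>R sym_unit i j"

lemma trig_mat_smooth_field: "smooth_field (trig_mat b k i j)"
proof -
  have "smooth (trig_mat b k i j)"
  proof (cases b)
    case True
    then show ?thesis using smooth_bounded_linear[OF trig_smooth(1) bounded_linear_scaleR_left, of k "sym_unit i j"] by (simp add: trig_mat_def[abs_def])
  next
    case False
    then show ?thesis using smooth_bounded_linear[OF trig_smooth(2) bounded_linear_scaleR_left, of k "sym_unit i j"] by (simp add: trig_mat_def[abs_def])
  qed
  then show ?thesis by (simp add: smooth_field_def periodic_def trig_mat_def cos_freq_shift)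
qed

lemma sym_scaleR: "sym_mat A \<Longrightarrow> sym_mat (c *\<^sub>R A)"
  by (simp add: sym_mat_def transpose_def vec_eq_iff)

lemma evolves_conv:
  fixes \<psi> :: "real^'n \<Rightarrow> real^'n^'n"
  assumes E: "Lsq (cylinder T) E" and B: "\<And>s. s \<in> G \<Longrightarrow> Lsq torus (\<lambda>x. B (s, x))"
    and tr: "\<And>b k i j. evolves T G E B (trig_mat b k i j)"
    and \<psi>: "periodic \<psi>" "continuous_on UNIV \<psi>" "\<And>x. sym_mat (\<psi> x)" and q: "q \<in> cosspan"
  shows "evolves T G E B (conv q \<psi>)"
  using q \<psi>(1,2)
proof (induction rule: conv_cosspan_induct)
  case (mode k)
  have one: "evolves T G E B (\<lambda>x. (if b then cos (freq k \<bullet> x) else sin (freq k \<bullet> x)) *\<^sub>R C)" if C: "sym_mat C" for b C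
  proof -
    have "evolves T G E B (\<lambda>x. \<Sum>ij\<in>UNIV. (C $ fst ij $ snd ij) *\<^sub>R trig_mat b k (fst ij) (snd ij) x)"
      by (rule evolves_sum[OF E B _ tr tr]) auto
    also have "(\<lambda>x. \<Sum>ij\<in>UNIV. (C $ fst ij $ snd ij) *\<^sub>R trig_mat b k (fst ij) (snd ij) x) =
      (\<lambda>x. (if b then cos (freq k \<bullet> x) else sin (freq k \<bullet> x)) *\<^sub>R (\<Sum>ij\<in>UNIV. (C $ fst ij $ snd ij) *\<^sub>R sym_unit (fst ij) (snd ij)))"
      by (simp add: trig_mat_def scaleR_sum_right mult.commute)
    also have "(\<Sum>ij\<in>UNIV. (C $ fst ij $ snd ij) *\<^sub>R sym_unit (fst ij) (snd ij)) = C"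
      using sym_expand[OF C] by (simp add: sum.cartesian_product split_beta)
    finally show ?thesis .
  qed
  have "sym_mat (cos_coeff \<psi> k)" "sym_mat (sin_coeff \<psi> k)"
    unfolding cos_coeff_def sin_coeff_def by (intro sym_integral sym_scaleR \<psi> cbox_integrable continuous_intros)+
  then show ?case
    using evolves_lin[OF E B one[of "cos_coeff \<psi> k" True] one[of "sin_coeff \<psi> k" False], of 1 1] by (simp add: fourier_mode_def[abs_def])
next
  case (add p q g h)
  then show ?case using evolves_lin[where \<psi>=g and \<eta>=h and a=1 and b=1, OF E B] by simp
next
  case (scale c q g)
  then show ?case using evolves_lin[where \<psi>=g and \<eta>=g and a=c and b=0, OF E B] by simp
qed

lemma conv_mdiv_bound:
  fixes \<psi> :: "real^'n \<Rightarrow> real^'n^'n"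
  assumes \<psi>: "C_diff 1 \<psi>" "periodic \<psi>"
  obtains L where "\<And>n. smooth_field (conv (vp_kernel n) \<psi>) \<Longrightarrow> (\<integral>x. (norm (dualv (conv (vp_kernel n) \<psi>) x))\<^sup>2 \<partial>torus) \<le> L"
proof -
  note C1 = C_diff_1_entry[OF \<psi>]
  have \<psi>c: "continuous_on UNIV \<psi>" by (rule C_diff_imp_continuous[OF \<psi>(1)])
  have "\<exists>S. \<forall>x. norm (pd j (\<lambda>y. \<psi> y $ k $ j) x) \<le> S" for k j
    using periodic_bounded[OF C1_periodic_pd_periodic[OF C1]] C1 unfolding C1_periodic_def by metis
  then have "\<forall>kj. \<exists>S. \<forall>x. norm (pd (snd kj) (\<lambda>y. \<psi> y $ fst kj $ snd kj) x) \<le> S" by blast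
  from choice[OF this] obtain S where S: "\<And>kj x. norm (pd (snd kj) (\<lambda>y. \<psi> y $ fst kj $ snd kj) x) \<le> S kj" by blast
  define L where "L = (\<Sum>k\<in>UNIV. (\<Sum>j\<in>UNIV. S (k, j))\<^sup>2)"
  have "(\<integral>x. (norm (dualv (conv (vp_kernel n) \<psi>) x))\<^sup>2 \<partial>torus) \<le> L" if sm: "smooth_field (conv (vp_kernel n) \<psi>)" for n
  proof -
    have md: "mdiv (conv (vp_kernel n) \<psi>) k x = (\<Sum>j\<in>UNIV. conv (vp_kernel n) (pd j (\<lambda>y. \<psi> y $ k $ j)) x)" for k x
    proof -
      have "(\<lambda>y. conv (vp_kernel n) \<psi> y $ k $ j) = conv (vp_kernel n) (\<lambda>y. \<psi> y $ k $ j)" for j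
        using conv_entry[OF vp_kernel_cont \<psi>c] by auto
      then show ?thesis unfolding mdiv_def by (simp add: conv_pd[OF vp_kernel_cosspan C1])
    qed
    have le: "\<bar>mdiv (conv (vp_kernel n) \<psi>) k x\<bar> \<le> (\<Sum>j\<in>UNIV. S (k, j))" for k x
      unfolding md
    proof (rule order_trans[OF sum_abs], rule sum_mono)
      fix j
      have "norm (conv (vp_kernel n) (pd j (\<lambda>y. \<psi> y $ k $ j)) x) \<le> S (k, j)"
        by (rule conv_vp_kernel_bound) (use C1 S[of "(k, j)"] in \<open>auto simp: C1_periodic_def\<close>)
      then show "\<bar>conv (vp_kernel n) (pd j (\<lambda>y. \<psi> y $ k $ j)) x\<bar> \<le> S (k, j)" by simp
    qed
    have "(\<integral>x. (norm (dualv (conv (vp_kernel n) \<psi>) x))\<^sup>2 \<partial>torus) \<le> (\<integral>x. (\<Sum>k\<in>UNIV. (mdiv (conv (vp_kernel n) \<psi>) k x)\<^sup>2) \<partial>torus)"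
      by (rule dualv_energy[OF sm])
    also have "\<dots> \<le> (\<integral>x. L \<partial>(torus :: (real^'n) measure))"
    proof (rule integral_mono)
      have "continuous_on UNIV (\<lambda>x. \<Sum>k\<in>UNIV. (mdiv (conv (vp_kernel n) \<psi>) k x)\<^sup>2)"
        by (intro continuous_intros smooth_imp_continuous mdiv_smooth sm)
      then show "integrable torus (\<lambda>x. \<Sum>k\<in>UNIV. (mdiv (conv (vp_kernel n) \<psi>) k x)\<^sup>2)"
        by (intro torus_integral(1)) (auto intro: continuous_on_subset)
      show "(\<Sum>k\<in>UNIV. (mdiv (conv (vp_kernel n) \<psi>) k x)\<^sup>2) \<le> L" for x
        unfolding L_def
      proof (rule sum_mono)
        fix k
        have "\<bar>mdiv (conv (vp_kernel n) \<psi>) k x\<bar>\<^sup>2 \<le> (\<Sum>j\<in>UNIV. S (k, j))\<^sup>2" by (intro power_mono le) auto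
        then show "(mdiv (conv (vp_kernel n) \<psi>) k x)\<^sup>2 \<le> (\<Sum>j\<in>UNIV. S (k, j))\<^sup>2" by simp
      qed
    qed simp
    finally show ?thesis by simp
  qed
  then show ?thesis using that by blast
qed

text \<open>
  The Hoelder constant for the trigonometric approximations of \<open>\<psi>\<close> depends only on bounds for the first
  derivatives, which convolution does not increase.
\<close>

lemma pairB_holder_good:
  fixes B :: "real \<times> (real^'n) \<Rightarrow> real^'n^'n"
  assumes E: "Lsq (cylinder T) E" and B: "\<And>s. s \<in> G \<Longrightarrow> Lsq torus (\<lambda>x. B (s, x))" and G: "G \<subseteq> {0..T}"
    and tr: "\<And>b k i j. evolves T G E B (trig_mat b k i j)"
    and \<psi>: "C_diff 1 \<psi>" "periodic \<psi>" "\<And>x. sym_mat (\<psi> x)"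
  obtains L where "L \<ge> 0" "\<And>s s'. s \<in> G \<Longrightarrow> s' \<in> G \<Longrightarrow> \<bar>pairB B \<psi> s - pairB B \<psi> s'\<bar> \<le> L * sqrt \<bar>s - s'\<bar>"
proof -
  have \<psi>c: "continuous_on UNIV \<psi>" by (rule C_diff_imp_continuous[OF \<psi>(1)])
  obtain L0 where L0: "\<And>n. smooth_field (conv (vp_kernel n) \<psi>) \<Longrightarrow> (\<integral>x. (norm (dualv (conv (vp_kernel n) \<psi>) x))\<^sup>2 \<partial>torus) \<le> L0"
    using conv_mdiv_bound[OF \<psi>(1,2)] by blast
  have V: "evolves T G E B (conv (vp_kernel n) \<psi>)" for n
    by (rule evolves_conv[OF E B tr \<psi>(2) \<psi>c \<psi>(3) vp_kernel_cosspan])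
  then have sm: "smooth_field (conv (vp_kernel n) \<psi>)" for n by (simp add: evolves_def)
  have L00: "0 \<le> L0" using order_trans[OF _ L0[OF sm]] by simp
  obtain C where C: "\<And>x. norm (\<psi> x) \<le> C" using periodic_bounded[OF \<psi>(2) \<psi>c] by metis
  have lim: "(\<lambda>n. pairB B (conv (vp_kernel n) \<psi>) s) \<longlonglongrightarrow> pairB B \<psi> s" if s: "s \<in> G" for s
    unfolding pairB_def
  proof (rule bounded_conv_integral[OF Lsq_integrable[OF finite_torus B[OF s]]])
    show "norm (conv (vp_kernel n) \<psi> x) \<le> C" for n x by (rule conv_vp_kernel_bound[OF \<psi>c C])
    show "AE x in torus. (\<lambda>n. conv (vp_kernel n) \<psi> x) \<longlonglongrightarrow> \<psi> x" by (intro AE_I2 conv_vp_kernel_tendsto \<psi> \<psi>c)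
    show "conv (vp_kernel n) \<psi> \<in> borel_measurable torus" for n
      by (intro Lsq_meas torus_Lsq_cont smooth_imp_continuous) (use sm in \<open>simp add: smooth_field_def\<close>)
    show "\<psi> \<in> borel_measurable torus" by (rule Lsq_meas[OF torus_Lsq_cont[OF \<psi>c]])
  qed
  let ?L = "sqrt (nsq (cylinder T) E) * sqrt L0"
  have "\<bar>pairB B \<psi> s - pairB B \<psi> s'\<bar> \<le> ?L * sqrt \<bar>s - s'\<bar>" if s: "s \<in> G" "s' \<in> G" for s s'
  proof (rule LIMSEQ_le_const2)
    show "(\<lambda>n. \<bar>pairB B (conv (vp_kernel n) \<psi>) s - pairB B (conv (vp_kernel n) \<psi>) s'\<bar>) \<longlonglongrightarrow> \<bar>pairB B \<psi> s - pairB B \<psi> s'\<bar>"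
      by (intro tendsto_intros lim s)
    have "\<bar>pairB B (conv (vp_kernel n) \<psi>) s - pairB B (conv (vp_kernel n) \<psi>) s'\<bar> \<le> ?L * sqrt \<bar>s - s'\<bar>" for n
    proof -
      have sT: "s \<in> {0..T}" "s' \<in> {0..T}" using s G by blast+
      have "pairB B (conv (vp_kernel n) \<psi>) s = fluxE T E (conv (vp_kernel n) \<psi>) s"
        "pairB B (conv (vp_kernel n) \<psi>) s' = fluxE T E (conv (vp_kernel n) \<psi>) s'"
        using V[of n] s unfolding evolves_def by blast+
      then show ?thesis using fluxE_diff[OF E sm sT L0[OF sm]] by simp
    qed
    then show "\<exists>N. \<forall>n\<ge>N. \<bar>pairB B (conv (vp_kernel n) \<psi>) s - pairB B (conv (vp_kernel n) \<psi>) s'\<bar> \<le> ?L * sqrt \<bar>s - s'\<bar>" by blast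
  qed
  moreover have "?L \<ge> 0" using L00 by (simp add: nsq_nonneg)
  ultimately show ?thesis using that by blast
qed

section \<open>Exceptional times\<close>

text \<open>
  The sets to which the lemma on nested convex sets is applied consist of the bounded \<open>b\<close> whose integrals
  against all \<open>\<psi>\<close> are compatible with the Hoelder estimate, up to \<open>1/(n+1)\<close>; sections \<open>B(s,\<cdot>)\<close> at good times
  near \<open>t\<close> belong to them.
\<close>

lemma torus_section_limit:
  fixes B :: "real \<times> (real^'n) \<Rightarrow> real^'n^'n" and \<Psi> :: "(real^'n \<Rightarrow> real^'n^'n) set"
  assumes T: "T > 0" and t: "t \<in> {0..T}" and G: "AE s in time_space T. s \<in> G" "G \<subseteq> {0..T}"
    and B: "\<And>s. s \<in> G \<Longrightarrow> (\<lambda>x. B (s, x)) \<in> borel_measurable torus" "\<And>s. s \<in> G \<Longrightarrow> AE x in torus. norm (B (s, x)) \<le> C0"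
    and \<Psi>: "\<And>\<psi>. \<psi> \<in> \<Psi> \<Longrightarrow> continuous_on UNIV \<psi>"
    and L: "\<And>\<psi>. \<psi> \<in> \<Psi> \<Longrightarrow> L \<psi> \<ge> 0"
      "\<And>\<psi> s s'. \<psi> \<in> \<Psi> \<Longrightarrow> s \<in> G \<Longrightarrow> s' \<in> G \<Longrightarrow> \<bar>pairB B \<psi> s - pairB B \<psi> s'\<bar> \<le> L \<psi> * sqrt \<bar>s - s'\<bar>"
  obtains b where "integrable torus b"
    "\<And>\<psi> s. \<psi> \<in> \<Psi> \<Longrightarrow> s \<in> G \<Longrightarrow> \<bar>(\<integral>x. b x \<bullet> \<psi> x \<partial>torus) - pairB B \<psi> s\<bar> \<le> L \<psi> * sqrt \<bar>t - s\<bar>"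
proof -
  define C where "C n = {b. b \<in> borel_measurable torus \<and> (AE x in torus. norm (b x) \<le> C0) \<and>
    (\<forall>\<psi>\<in>\<Psi>. \<forall>s\<in>G. \<bar>(\<integral>x. b x \<bullet> \<psi> x \<partial>torus) - pairB B \<psi> s\<bar> \<le> L \<psi> * (sqrt \<bar>t - s\<bar> + 1 / real (Suc n)))}" for n
  have CL: "Lsq torus b" if "b \<in> C n" for b n
    using that Lsq_bounded[OF finite_torus, of b C0] unfolding C_def by blast
  have \<Psi>L: "Lsq torus \<psi>" if "\<psi> \<in> \<Psi>" for \<psi> by (rule torus_Lsq_cont[OF \<Psi>[OF that]])
  obtain x F where x: "\<And>n. x n \<in> C n" and F: "Lsq torus F" and lim: "(\<lambda>n. nsq torus (\<lambda>p. x n p - F p)) \<longlonglongrightarrow> 0"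
  proof (rule nested_midconvex_limit[of "torus :: (real^'n) measure" C])
    show "finite_measure (torus :: (real^'n) measure)" by (rule finite_torus)
    show "C n \<noteq> {}" for n
    proof -
      \<comment> \<open>times at distance at most \<open>\<delta>\<close> cost \<open>sqrt \<delta> = 1/(n+1)\<close> in the estimate\<close>
      define \<delta> where "\<delta> = (1 / real (Suc n))\<^sup>2"
      have \<delta>: "\<delta> > 0" by (simp add: \<delta>_def)
      obtain s where s: "s \<in> G" "\<bar>s - t\<bar> \<le> \<delta>"
      proof (cases "t < T")
        case True
        obtain s where "s \<in> G" "t < s" "s < min T (t + \<delta>)"
          by (rule time_dense[OF G(1), of t "min T (t + \<delta>)"]) (use True t \<delta> in auto)
        then show ?thesis using that[of s] by auto
      next
        case False
        then have tT: "t = T" using t by simp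
        obtain s where "s \<in> G" "max 0 (t - \<delta>) < s" "s < t"
          by (rule time_dense[OF G(1), of "max 0 (t - \<delta>)" t]) (use tT T \<delta> in auto)
        then show ?thesis using that[of s] by auto
      qed
      have "\<bar>pairB B \<psi> s - pairB B \<psi> s'\<bar> \<le> L \<psi> * (sqrt \<bar>t - s'\<bar> + 1 / real (Suc n))" if "\<psi> \<in> \<Psi>" "s' \<in> G" for \<psi> s'
      proof -
        have "sqrt \<bar>s - s'\<bar> \<le> sqrt \<bar>t - s'\<bar> + sqrt \<delta>"
          by (rule sqrt_le_sum) (use s \<delta> in auto)
        also have "sqrt \<delta> = 1 / real (Suc n)" unfolding \<delta>_def by (rule real_sqrt_unique) auto
        finally have "L \<psi> * sqrt \<bar>s - s'\<bar> \<le> L \<psi> * (sqrt \<bar>t - s'\<bar> + 1 / real (Suc n))"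
          by (intro mult_left_mono L(1) that)
        then show ?thesis using L(2)[OF that(1) s(1) that(2)] by linarith
      qed
      then have "(\<lambda>x. B (s, x)) \<in> C n" unfolding C_def using B[OF s(1)] by (auto simp: pairB_def)
      then show ?thesis by blast
    qed
    show "C (Suc n) \<subseteq> C n" for n
    proof
      fix b assume b: "b \<in> C (Suc n)"
      have "1 / real (Suc (Suc n)) \<le> 1 / real (Suc n)" by (intro divide_left_mono) auto
      then have "L \<psi> * (sqrt \<bar>t - s\<bar> + 1 / real (Suc (Suc n))) \<le> L \<psi> * (sqrt \<bar>t - s\<bar> + 1 / real (Suc n))" if "\<psi> \<in> \<Psi>" for \<psi> s
        by (intro mult_left_mono add_left_mono L(1) that)
      then show "b \<in> C n" using b unfolding C_def by (blast intro: order_trans)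
    qed
    show "(\<lambda>x. (1/2) *\<^sub>R (f x + g x)) \<in> C n" if fg: "f \<in> C n" "g \<in> C n" for n f g
      unfolding C_def
    proof (intro CollectI conjI ballI)
      show "(\<lambda>x. (1/2) *\<^sub>R (f x + g x)) \<in> borel_measurable torus"
        by (intro Lsq_meas Lsq_scale Lsq_add CL[OF fg(1)] CL[OF fg(2)])
      have "AE x in torus. norm (f x) \<le> C0" "AE x in torus. norm (g x) \<le> C0" using fg by (auto simp: C_def)
      then show "AE x in torus. norm ((1/2) *\<^sub>R (f x + g x)) \<le> C0"
      proof eventually_elim
        case (elim x)
        then show ?case using norm_triangle_ineq[of "f x" "g x"] by simp
      qed
      fix \<psi> s assume a: "\<psi> \<in> \<Psi>" "s \<in> G"
      let ?R = "L \<psi> * (sqrt \<bar>t - s\<bar> + 1 / real (Suc n))" and ?p = "pairB B \<psi> s"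
      have "(\<integral>x. ((1/2) *\<^sub>R (f x + g x)) \<bullet> \<psi> x \<partial>torus) = ((\<integral>x. f x \<bullet> \<psi> x \<partial>torus) + (\<integral>x. g x \<bullet> \<psi> x \<partial>torus)) / 2"
        using Lsq_inner[OF CL[OF fg(1)] \<Psi>L[OF a(1)]] Lsq_inner[OF CL[OF fg(2)] \<Psi>L[OF a(1)]] by (simp add: inner_add_left)
      moreover have "\<bar>(\<integral>x. f x \<bullet> \<psi> x \<partial>torus) - ?p\<bar> \<le> ?R" "\<bar>(\<integral>x. g x \<bullet> \<psi> x \<partial>torus) - ?p\<bar> \<le> ?R"
        using fg a unfolding C_def by blast+
      moreover have "\<bar>(u + v) / 2 - w\<bar> \<le> r" if "\<bar>u - w\<bar> \<le> r" "\<bar>v - w\<bar> \<le> r" for u v w r :: real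
        using that unfolding add_divide_distrib by linarith
      ultimately show "\<bar>(\<integral>x. ((1/2) *\<^sub>R (f x + g x)) \<bullet> \<psi> x \<partial>torus) - ?p\<bar> \<le> ?R" by simp
    qed
    show "Lsq torus f" if "f \<in> C n" for n f by (rule CL[OF that])
    show "nsq torus f \<le> C0\<^sup>2" if f: "f \<in> C n" for n f
    proof -
      have "nsq torus f \<le> (\<integral>x. C0\<^sup>2 \<partial>(torus :: (real^'n) measure))"
        unfolding nsq_def
      proof (rule integral_mono_AE)
        have "AE x in torus. norm (f x) \<le> C0" using f by (simp add: C_def)
        then show "AE x in torus. (norm (f x))\<^sup>2 \<le> C0\<^sup>2" by eventually_elim (intro power_mono; simp)
      qed (use Lsq_int[OF CL[OF f]] in auto)
      then show ?thesis by simp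
    qed
  qed blast
  have "\<bar>(\<integral>x. F x \<bullet> \<psi> x \<partial>torus) - pairB B \<psi> s\<bar> \<le> L \<psi> * sqrt \<bar>t - s\<bar>" if a: "\<psi> \<in> \<Psi>" "s \<in> G" for \<psi> s
  proof -
    have "(\<lambda>n. \<bar>(\<integral>p. x n p \<bullet> \<psi> p \<partial>torus) - pairB B \<psi> s\<bar>) \<longlonglongrightarrow> \<bar>(\<integral>p. F p \<bullet> \<psi> p \<partial>torus) - pairB B \<psi> s\<bar>"
      by (intro tendsto_intros Lsq_tendsto_inner[OF CL[OF x] F \<Psi>L[OF a(1)] lim])
    moreover have "(\<lambda>n. L \<psi> * (sqrt \<bar>t - s\<bar> + 1 / real (Suc n))) \<longlonglongrightarrow> L \<psi> * (sqrt \<bar>t - s\<bar> + 0)"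
      by (intro tendsto_intros LIMSEQ_Suc[OF lim_1_over_n])
    moreover have "\<bar>(\<integral>p. x n p \<bullet> \<psi> p \<partial>torus) - pairB B \<psi> s\<bar> \<le> L \<psi> * (sqrt \<bar>t - s\<bar> + 1 / real (Suc n))" for n
      using x[of n] a unfolding C_def by blast
    ultimately have "\<bar>(\<integral>p. F p \<bullet> \<psi> p \<partial>torus) - pairB B \<psi> s\<bar> \<le> L \<psi> * (sqrt \<bar>t - s\<bar> + 0)"
      by (intro LIMSEQ_le) auto
    then show ?thesis by simp
  qed
  then show ?thesis using that[OF Lsq_integrable[OF finite_torus F]] by blast
qed

theorem EB_holder:
  fixes B :: "real \<times> (real^'n) \<Rightarrow> real^'n^'n"
  assumes T: "T > 0" and EB: "(E, B) \<in> EB_class T"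
  shows "holder_half_weak_star T B"
proof -
  note LEB = EB_Lsq[OF EB]
  obtain C0 where C0: "AE p in cylinder T. norm (B p) \<le> C0" using EB by (auto simp: EB_class_iff)
  have Bm: "B \<in> borel_measurable (time_space T \<Otimes>\<^sub>M torus)" using Lsq_meas[OF LEB(2)] by (simp add: cylinder_def)
  have ae1: "AE t in time_space T. AE x in torus. norm (B (t, x)) \<le> C0"
    using C0 unfolding cylinder_def by (rule cyl.AE_pair)
  have ae2: "AE t in time_space T. \<forall>z. pairB B (case z of (b, k, i, j) \<Rightarrow> trig_mat b k i j) t = fluxE T E (case z of (b, k, i, j) \<Rightarrow> trig_mat b k i j) t"
    unfolding AE_all_countable
  proof
    fix z :: "bool \<times> (int^'n) \<times> 'n \<times> 'n"
    obtain b k i j where z: "z = (b, k, i, j)" by (cases z) auto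
    show "AE t in time_space T. pairB B (case z of (b, k, i, j) \<Rightarrow> trig_mat b k i j) t = fluxE T E (case z of (b, k, i, j) \<Rightarrow> trig_mat b k i j) t"
      unfolding z prod.case
      by (rule pairB_eq_fluxE[OF EB trig_mat_smooth_field]) (simp add: trig_mat_def sym_scaleR sym_sym_unit)
  qed
  \<comment> \<open>the good times: the trigonometric fields are countably many, so they share one null set\<close>
  define G where "G = {t \<in> {0..T}. (AE x in torus. norm (B (t, x)) \<le> C0) \<and>
    (\<forall>z. pairB B (case z of (b, k, i, j) \<Rightarrow> trig_mat b k i j) t = fluxE T E (case z of (b, k, i, j) \<Rightarrow> trig_mat b k i j) t)}"
  have G: "AE s in time_space T. s \<in> G"
    using ae1 ae2 AE_space by eventually_elim (simp add: G_def space_restrict_space)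
  have GT: "G \<subseteq> {0..T}" by (auto simp: G_def)
  have secm: "(\<lambda>x. B (s, x)) \<in> borel_measurable torus" if "s \<in> G" for s
    using measurable_Pair2[OF Bm, of s] that by (simp add: G_def space_restrict_space)
  have secb: "AE x in torus. norm (B (s, x)) \<le> C0" if "s \<in> G" for s using that by (simp add: G_def)
  have secL: "Lsq torus (\<lambda>x. B (s, x))" if "s \<in> G" for s
    by (rule Lsq_bounded[OF finite_torus secm[OF that] secb[OF that]])
  have tr: "evolves T G E B (trig_mat b k i j)" for b k i j
  proof -
    have "pairB B (trig_mat b k i j) s = fluxE T E (trig_mat b k i j) s" if "s \<in> G" for s
      using that unfolding G_def by (auto dest!: spec[of _ "(b, k, i, j)"])
    then show ?thesis by (simp add: evolves_def trig_mat_smooth_field)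
  qed
  define \<Psi> :: "(real^'n \<Rightarrow> real^'n^'n) set" where "\<Psi> = {\<psi>. C_diff 1 \<psi> \<and> periodic \<psi> \<and> (\<forall>x. sym_mat (\<psi> x))}"
  have "\<exists>L\<ge>0. \<forall>s\<in>G. \<forall>s'\<in>G. \<bar>pairB B \<psi> s - pairB B \<psi> s'\<bar> \<le> L * sqrt \<bar>s - s'\<bar>" if \<psi>: "\<psi> \<in> \<Psi>" for \<psi>
  proof -
    have "C_diff 1 \<psi>" "periodic \<psi>" "\<And>x. sym_mat (\<psi> x)" using \<psi> unfolding \<Psi>_def by blast+
    from pairB_holder_good[OF LEB(1) secL GT tr this] obtain L where "L \<ge> 0"
      "\<And>s s'. s \<in> G \<Longrightarrow> s' \<in> G \<Longrightarrow> \<bar>pairB B \<psi> s - pairB B \<psi> s'\<bar> \<le> L * sqrt \<bar>s - s'\<bar>" by blast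
    then show ?thesis by blast
  qed
  then have "\<forall>\<psi>\<in>\<Psi>. \<exists>L. L \<ge> 0 \<and> (\<forall>s\<in>G. \<forall>s'\<in>G. \<bar>pairB B \<psi> s - pairB B \<psi> s'\<bar> \<le> L * sqrt \<bar>s - s'\<bar>)" by blast
  from bchoice[OF this] obtain L where L: "\<And>\<psi>. \<psi> \<in> \<Psi> \<Longrightarrow> L \<psi> \<ge> 0"
    "\<And>\<psi> s s'. \<psi> \<in> \<Psi> \<Longrightarrow> s \<in> G \<Longrightarrow> s' \<in> G \<Longrightarrow> \<bar>pairB B \<psi> s - pairB B \<psi> s'\<bar> \<le> L \<psi> * sqrt \<bar>s - s'\<bar>" by blast
  have \<Psi>c: "continuous_on UNIV \<psi>" if "\<psi> \<in> \<Psi>" for \<psi>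
    using that C_diff_imp_continuous unfolding \<Psi>_def by blast
  have "\<exists>b. integrable torus b \<and> (\<forall>\<psi>\<in>\<Psi>. \<forall>s\<in>G. \<bar>(\<integral>x. b x \<bullet> \<psi> x \<partial>torus) - pairB B \<psi> s\<bar> \<le> L \<psi> * sqrt \<bar>t - s\<bar>)"
    if t: "t \<in> {0..T}" for t
  proof -
    show ?thesis
    proof (rule torus_section_limit[OF T t G GT secm secb \<Psi>c L])
      fix b :: "real^'n \<Rightarrow> real^'n^'n"
      assume "integrable torus b" and
        le: "\<And>\<psi> s. \<psi> \<in> \<Psi> \<Longrightarrow> s \<in> G \<Longrightarrow> \<bar>(\<integral>x. b x \<bullet> \<psi> x \<partial>torus) - pairB B \<psi> s\<bar> \<le> L \<psi> * sqrt \<bar>t - s\<bar>"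
      then show ?thesis by (intro exI[of _ b] conjI ballI le)
    qed
  qed
  then have "\<forall>t\<in>{0..T}. \<exists>b. integrable torus b \<and> (\<forall>\<psi>\<in>\<Psi>. \<forall>s\<in>G. \<bar>(\<integral>x. b x \<bullet> \<psi> x \<partial>torus) - pairB B \<psi> s\<bar> \<le> L \<psi> * sqrt \<bar>t - s\<bar>)" by blast
  from bchoice[OF this] obtain b where b: "\<And>t. t \<in> {0..T} \<Longrightarrow> integrable torus (b t)"
    "\<And>t \<psi> s. t \<in> {0..T} \<Longrightarrow> \<psi> \<in> \<Psi> \<Longrightarrow> s \<in> G \<Longrightarrow> \<bar>(\<integral>x. b t x \<bullet> \<psi> x \<partial>torus) - pairB B \<psi> s\<bar> \<le> L \<psi> * sqrt \<bar>t - s\<bar>" by blast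
  \<comment> \<open>only the sections at exceptional times are modified\<close>
  define B' where "B' p = (if fst p \<in> G then B p else b (fst p) (snd p))" for p
  have B'i: "integrable torus (\<lambda>x. B' (t, x))" if t: "t \<in> {0..T}" for t
    using b(1)[OF t] Lsq_integrable[OF finite_torus secL, of t] by (cases "t \<in> G") (simp_all add: B'_def)
  have B'p: "\<bar>pairB B' \<psi> t - pairB B \<psi> s\<bar> \<le> L \<psi> * sqrt \<bar>t - s\<bar>" if "t \<in> {0..T}" "\<psi> \<in> \<Psi>" "s \<in> G" for t \<psi> s
  proof (cases "t \<in> G")
    case True
    then show ?thesis using L(2)[OF that(2) True that(3)] by (simp add: pairB_def B'_def)
  next
    case False
    then show ?thesis using b(2)[OF that] by (simp add: pairB_def B'_def)
  qed
  show ?thesis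
    unfolding holder_half_weak_star_def
  proof (intro exI[of _ B'] conjI allI impI ballI)
    show "AE t in time_space T. \<forall>x\<in>cbox 0 1. B' (t, x) = B (t, x)"
      using G by eventually_elim (simp add: B'_def)
    show "integrable torus (\<lambda>x. B' (t, x))" if "t \<in> {0..T}" for t by (rule B'i[OF that])
    fix \<psi> :: "real^'n \<Rightarrow> real^'n^'n" assume "C_diff 1 \<psi> \<and> periodic \<psi> \<and> (\<forall>x. sym_mat (\<psi> x))"
    then have \<psi>: "\<psi> \<in> \<Psi>" unfolding \<Psi>_def by blast
    have main: "\<bar>pairB B' \<psi> s - pairB B' \<psi> t\<bar> \<le> 2 * L \<psi> * sqrt \<bar>s - t\<bar>" if st: "s \<in> {0..T}" "t \<in> {0..T}" "s < t" for s t
    proof -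
      \<comment> \<open>both sections are compared with one at a good time in between\<close>
      obtain r where r: "r \<in> G" "s < r" "r < t" by (rule time_dense[OF G st(3)]) (use st in auto)
      have "L \<psi> * sqrt \<bar>s - r\<bar> \<le> L \<psi> * sqrt \<bar>s - t\<bar>" "L \<psi> * sqrt \<bar>t - r\<bar> \<le> L \<psi> * sqrt \<bar>s - t\<bar>"
        using r by (auto intro!: mult_left_mono L(1) \<psi>)
      then show ?thesis using B'p[OF st(1) \<psi> r(1)] B'p[OF st(2) \<psi> r(1)] by linarith
    qed
    show "holder_on (1/2) {0..T} (\<lambda>t. \<integral>x. contract (B' (t, x)) (\<psi> x) \<partial>torus)"
      unfolding holder_on_def contract_inner pairB_def[symmetric]
    proof (intro exI[of _ "2 * L \<psi>"] ballI)
      fix s t assume st: "s \<in> {0..T}" "t \<in> {0..T}"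
      have "\<bar>pairB B' \<psi> s - pairB B' \<psi> t\<bar> \<le> 2 * L \<psi> * sqrt \<bar>s - t\<bar>"
        using main[OF st] main[OF st(2,1)] by (cases s t rule: linorder_cases) (simp_all add: abs_minus_commute)
      then show "\<bar>pairB B' \<psi> s - pairB B' \<psi> t\<bar> \<le> 2 * L \<psi> * \<bar>s - t\<bar> powr (1/2)" by (simp add: powr_half_sqrt)
    qed
  qed
qed

section \<open>Existence, bounds and regularity of solutions\<close>

theorem theorem2p1:
  fixes T :: real and P\<^sub>0 :: "real^'n \<Rightarrow> real^'n"
  assumes "T > 0"
    and "square_integrable torus P\<^sub>0"
    and "divergence_free P\<^sub>0"
    and "(\<integral>x. P\<^sub>0 x \<partial>torus) = 0"
  shows "concave_problem T P\<^sub>0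
    \<and> (\<exists>E B. is_solution T P\<^sub>0 E B)
    \<and> 0 \<le> J T P\<^sub>0
    \<and> J T P\<^sub>0 \<le> ereal (T * real CARD('n) * (\<integral>x. (norm (P\<^sub>0 x))\<^sup>2 \<partial>torus))
    \<and> (\<forall>E B. is_solution T P\<^sub>0 E B \<longrightarrow>
         (AE p in cylinder T. spect (B p) \<subseteq> {- 1/2 .. (real CARD('n) - 1) / 2})
       \<and> (\<integral>p. (norm (E p))\<^sup>2 \<partial>cylinder T)
           \<le> 4 * (real CARD('n))\<^sup>2 * T * (\<integral>x. (norm (P\<^sub>0 x))\<^sup>2 \<partial>torus)
       \<and> holder_half_weak_star T B)"
proof -
  note P = Lsq_P(1)[OF assms(2,1)]
  have NP: "(sqrt (nsq (cylinder T) (\<lambda>p. P\<^sub>0 (snd p))))\<^sup>2 = T * (\<integral>x. (norm (P\<^sub>0 x))\<^sup>2 \<partial>torus)"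
    using Lsq_P(2)[OF assms(2,1)] nsq_nonneg[of "cylinder T" "\<lambda>p. P\<^sub>0 (snd p)"] by simp
  show ?thesis
  proof (intro conjI allI impI)
    show "concave_problem T P\<^sub>0" by (rule concave_problem[OF P])
    show "\<exists>E B. is_solution T P\<^sub>0 E B" by (rule solution_exists[OF P])
    show "0 \<le> J T P\<^sub>0" by (rule J_nonneg[OF P])
    show "J T P\<^sub>0 \<le> ereal (T * real CARD('n) * (\<integral>x. (norm (P\<^sub>0 x))\<^sup>2 \<partial>torus))"
      using J_upper[OF P] unfolding NP by (simp add: mult_ac)
    fix E :: "real \<times> (real^'n) \<Rightarrow> real^'n" and B assume s: "is_solution T P\<^sub>0 E B"
    note sb = solution_bounds[OF P s]
    show "AE p in cylinder T. spect (B p) \<subseteq> {- 1/2 .. (real CARD('n) - 1) / 2}"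
      using sb(2) by eventually_elim (rule constrained_spect)
    show "(\<integral>p. (norm (E p))\<^sup>2 \<partial>cylinder T) \<le> 4 * (real CARD('n))\<^sup>2 * T * (\<integral>x. (norm (P\<^sub>0 x))\<^sup>2 \<partial>torus)"
      using sb(3)[unfolded NP] unfolding nsq_def by (simp add: mult_ac)
    show "holder_half_weak_star T B" by (rule EB_holder[OF assms(1) sb(1)])
  qed
qed

end
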